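(* Let $\Gamma$ be a finite connected simple undirected graph on $d$ vertices with chromatic polynomial $\chi_\Gamma$. Suppose that $\Gamma$ contains a clique on $\ell\geq 1$ vertices, let $n=d-\ell$, and write $$\frac{\chi_\Gamma(t)}{(t)_\ell}=a_0t^n-a_1t^{n-1}+\cdots+(-1)^na_n,$$ where $(t)_\ell=t(t-1)\cdots(t-\ell+1)$. The sequence $a_0,\ldots,a_n$ is log-concave.
   Context: A sequence $a_0,\ldots,a_n$ of positive numbers is log-concave if $a_r^2\geq a_{r-1}a_{r+1}$ for all $r\in\{1,\ldots,n-1\}$. *)

theory Defs
  imports
    Complex_Main
    "HOL-Library.FuncSet"
    "HOL-Computational_Algebra.Polynomial"
    "Graph_Theory.Graph_Theory"
begin

text \<open>
  Finite simple undirected graphs are the locale \<^locale>\<open>pair_graph\<close>: a finite vertex set with a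
  symmetric, loop-free arc relation, an edge \<open>uv\<close> being the pair of arcs \<open>(u,v)\<close>, \<open>(v,u)\<close>.
\<close>

definition clique :: "'a pair_pre_digraph \<Rightarrow> 'a set \<Rightarrow> bool" where
  "clique G W \<longleftrightarrow> W \<subseteq> pverts G \<and> (\<forall>u\<in>W. \<forall>v\<in>W. u \<noteq> v \<longrightarrow> (u, v) \<in> parcs G)"

definition proper_colourings :: "'a pair_pre_digraph \<Rightarrow> nat \<Rightarrow> ('a \<Rightarrow> nat) set" where
  "proper_colourings G k = {c \<in> pverts G \<rightarrow>\<^sub>E {..<k}. \<forall>(u, v)\<in>parcs G. c u \<noteq> c v}"

text \<open>
  Existence and uniqueness of this polynomial are proved in \<open>ex1_chromatic_polynomial\<close> below.
\<close>

definition chromatic_polynomial :: "'a pair_pre_digraph \<Rightarrow> real poly" where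
  "chromatic_polynomial G =
     (THE p. \<forall>k. poly p (of_nat k) = of_nat (card (proper_colourings G k)))"

definition falling_factorial_poly :: "nat \<Rightarrow> real poly" where
  "falling_factorial_poly l = (\<Prod>i<l. [:- of_nat i, 1:])"

text \<open>Log-concavity is a notion for sequences of positive numbers, so positivity is part of it.\<close>

definition log_concave :: "nat \<Rightarrow> (nat \<Rightarrow> real) \<Rightarrow> bool" where
  "log_concave n a \<longleftrightarrow>
     (\<forall>r\<le>n. a r > 0) \<and> (\<forall>r\<in>{1..<n}. (a r)\<^sup>2 \<ge> a (r - 1) * a (r + 1))"

lemma poly_falling_factorial_poly:
  "poly (falling_factorial_poly l) (of_nat k) = fact l * of_nat (k choose l)"
  by (simp add: falling_factorial_poly_def poly_prod binomial_gbinomial gbinomial_prod_rev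
      atLeast0LessThan add.commute)

definition onto_colourings :: "'a pair_pre_digraph \<Rightarrow> nat set \<Rightarrow> ('a \<Rightarrow> nat) set" where
  "onto_colourings G S =
     {c \<in> extensional (pverts G). c ` pverts G = S \<and> (\<forall>(u, v)\<in>parcs G. c u \<noteq> c v)}"

context pair_graph
begin

lemma card_onto_colourings_le:
  assumes h: "bij_betw h S T" and fin: "finite T"
  shows "card (onto_colourings G S) \<le> card (onto_colourings G T)"
proof (rule card_inj_on_le[where f = "\<lambda>c. restrict (h \<circ> c) (pverts G)"])
  have inj: "inj_on h S" and im: "h ` S = T" using h by (auto simp: bij_betw_def)
  show "inj_on (\<lambda>c. restrict (h \<circ> c) (pverts G)) (onto_colourings G S)"
  proof (rule inj_onI)
    fix c c' assume c: "c \<in> onto_colourings G S" "c' \<in> onto_colourings G S"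
      and eq: "restrict (h \<circ> c) (pverts G) = restrict (h \<circ> c') (pverts G)"
    show "c = c'"
    proof (rule extensionalityI[of _ "pverts G"])
      fix v assume v: "v \<in> pverts G"
      have "h (c v) = h (c' v)" using fun_cong[OF eq, of v] v by simp
      moreover have "c v \<in> S" "c' v \<in> S" using c v by (auto simp: onto_colourings_def)
      ultimately show "c v = c' v" using inj by (meson inj_onD)
    qed (use c in \<open>auto simp: onto_colourings_def\<close>)
  qed
  show "(\<lambda>c. restrict (h \<circ> c) (pverts G)) ` onto_colourings G S \<subseteq> onto_colourings G T"
  proof (rule image_subsetI)
    fix c assume c: "c \<in> onto_colourings G S"
    have "restrict (h \<circ> c) (pverts G) u \<noteq> restrict (h \<circ> c) (pverts G) v"
      if "(u, v) \<in> parcs G" for u v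
    proof -
      have "u \<in> pverts G" "v \<in> pverts G" using that by (auto dest: in_arcsD1 in_arcsD2)
      then have "c u \<in> S" "c v \<in> S" "c u \<noteq> c v"
        using c that by (auto simp: onto_colourings_def)
      then show ?thesis using inj \<open>u \<in> pverts G\<close> \<open>v \<in> pverts G\<close> by (auto dest: inj_onD)
    qed
    moreover have "restrict (h \<circ> c) (pverts G) \<in> extensional (pverts G)" by simp
    moreover have "restrict (h \<circ> c) (pverts G) ` pverts G = T"
      using c im by (auto simp: onto_colourings_def)
    ultimately show "restrict (h \<circ> c) (pverts G) \<in> onto_colourings G T"
      unfolding onto_colourings_def by blast
  qed
  have "onto_colourings G T \<subseteq> pverts G \<rightarrow>\<^sub>E T"
    by (auto simp: onto_colourings_def PiE_def)
  then show "finite (onto_colourings G T)"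
    using finite_PiE[of "pverts G" "\<lambda>_. T"] pair_finite_verts fin finite_subset by blast
qed

lemma card_onto_colourings:
  assumes "finite S"
  shows "card (onto_colourings G S) = card (onto_colourings G {..<card S})"
proof -
  obtain h where h: "bij_betw h S {..<card S}"
    using assms ex_bij_betw_finite_nat[of S] by (auto simp: atLeast0LessThan)
  show ?thesis
    using card_onto_colourings_le[OF h] card_onto_colourings_le[OF bij_betw_inv_into[OF h]] assms
    by simp
qed

lemma card_proper_colourings:
  "card (proper_colourings G k) =
     (\<Sum>j\<le>card (pverts G). (k choose j) * card (onto_colourings G {..<j}))"
proof -
  let ?F = "\<lambda>S. onto_colourings G S" and ?N = "\<lambda>j. card (onto_colourings G {..<j})"
  let ?P = "{S \<in> Pow {..<k}. card S \<le> card (pverts G)}"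
  have le: "card (c ` pverts G) \<le> card (pverts G)" for c :: "'a \<Rightarrow> nat"
    using pair_finite_verts by (rule card_image_le)
  have eq: "proper_colourings G k = (\<Union>S\<in>?P. ?F S)"
    using le by (auto simp: proper_colourings_def onto_colourings_def PiE_def Pi_def)
  have finF: "finite (?F S)" if "S \<in> ?P" for S
  proof -
    have "?F S \<subseteq> pverts G \<rightarrow>\<^sub>E S" "finite S"
      using that finite_subset by (auto simp: onto_colourings_def PiE_def)
    then show ?thesis
      using finite_PiE[of "pverts G" "\<lambda>_. S"] pair_finite_verts finite_subset by blast
  qed
  have "card (proper_colourings G k) = (\<Sum>S\<in>?P. card (?F S))"
    unfolding eq
    by (rule card_UN_disjoint) (use finF in \<open>auto simp: onto_colourings_def\<close>)
  also have "\<dots> = (\<Sum>S\<in>?P. ?N (card S))"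
    by (rule sum.cong) (auto intro: card_onto_colourings finite_subset)
  also have "\<dots> = (\<Sum>j\<le>card (pverts G). \<Sum>S\<in>{S\<in>?P. card S = j}. ?N (card S))"
    by (rule sum.group[symmetric]) auto
  also have "\<dots> = (\<Sum>j\<le>card (pverts G). (k choose j) * ?N j)"
  proof (rule sum.cong[OF refl])
    fix j assume "j \<in> {..card (pverts G)}"
    then have "{S\<in>?P. card S = j} = {S. S \<subseteq> {..<k} \<and> card S = j}" by auto
    then show "(\<Sum>S\<in>{S\<in>?P. card S = j}. ?N (card S)) = (k choose j) * ?N j"
      by (simp add: n_subsets)
  qed
  finally show ?thesis .
qed

lemma ex1_chromatic_polynomial:
  "\<exists>!p::real poly. \<forall>k. poly p (of_nat k) = of_nat (card (proper_colourings G k))"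
proof (rule ex_ex1I)
  let ?p = "\<Sum>j\<le>card (pverts G).
    smult (of_nat (card (onto_colourings G {..<j})) / fact j) (falling_factorial_poly j)"
  have "poly ?p (of_nat k) = of_nat (card (proper_colourings G k))" for k
    by (simp add: card_proper_colourings poly_sum poly_falling_factorial_poly mult.commute)
  then show "\<exists>p::real poly. \<forall>k. poly p (of_nat k) = of_nat (card (proper_colourings G k))"
    by blast
next
  fix p q :: "real poly"
  assume p: "\<forall>k. poly p (of_nat k) = of_nat (card (proper_colourings G k))"
    and q: "\<forall>k. poly q (of_nat k) = of_nat (card (proper_colourings G k))"
  have "range (of_nat :: nat \<Rightarrow> real) \<subseteq> {x. poly (p - q) x = 0}" using p q by auto
  moreover have "infinite (range (of_nat :: nat \<Rightarrow> real))"
    by (simp add: finite_image_iff inj_on_def)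
  ultimately show "p = q"
    using poly_roots_finite[of "p - q"] finite_subset by (metis right_minus_eq)
qed

lemma poly_chromatic_polynomial:
  "poly (chromatic_polynomial G) (of_nat k) = of_nat (card (proper_colourings G k))"
  using theI'[OF ex1_chromatic_polynomial] by (simp add: chromatic_polynomial_def)

end

end

theory Submission
  imports Defs "HOL-Analysis.Analysis"
begin

text \<open>
  Fix a proper colouring of the clique \<open>W\<close>. Its proper extensions avoid the affine arrangement of the
  hyperplanes \<open>x\<^sub>u = x\<^sub>v\<close> and \<open>x\<^sub>u = const\<^sub>w\<close>, so \<open>\<chi>/(t)\<^sub>l\<close> is the characteristic polynomial of that
  arrangement, and its unsigned coefficients are sums of \<open>\<bar>\<mu>(F)\<bar>\<close> over the flats \<open>F\<close> of given rank not
  containing the hyperplane at infinity \<open>e\<close>. By Weisner's theorem these sums are the mixed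
  intersection numbers of \<open>\<alpha> = \<Sum> {x\<^sub>F | e \<in> F}\<close> and \<open>\<beta> = \<Sum> {x\<^sub>F | e \<notin> F}\<close> on the complex of flags of flats
  (the Bergman fan). Both classes are nef, so log-concavity follows from the Hodge index inequality
  for ample classes. That inequality is proved by induction on the dimension: the quadratic form at a
  face is a positive combination of the forms at its neighbours, and a Bochner argument with a
  Perron--Frobenius eigenvector shows that it has only one positive eigenvalue. The induction starts
  with flags of codimension two.
\<close>

section \<open>Quadratic forms with one positive eigenvalue\<close>

text \<open>No Chow ring is constructed. An intersection number is a recursion over links that
  starts from weight one on maximal flags, and the balancing condition takes over the role of the
  linear relations. The index inequality is stated as a reverse Cauchy-Schwarz inequality: it needs
  no bases or eigenvalues, specialises to log-concavity, and its conclusion survives limits. The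
  last point matters because \<alpha> and \<beta> are only nef, while the induction needs ample
  classes, whose intersection numbers are positive; so all classes are perturbed by a multiple of
  the ample cut function \<open>card F * card (E - F)\<close>, and the multiple tends to zero.
  Dividing by (t)_l amounts to fixing the colours of the clique, as all its proper colourings have
  equally many proper extensions. The lattice is that of the cone over the affine arrangement, with
  \<open>e\<close> as the added hyperplane. Connectedness of the graph makes its rank n + 1, so the
  flag complex has dimension n and the flats avoiding \<open>e\<close> occur in exactly the ranks 0
  to n.\<close>

definition qform :: "'v set \<Rightarrow> ('v \<Rightarrow> 'v \<Rightarrow> real) \<Rightarrow> ('v \<Rightarrow> real) \<Rightarrow> ('v \<Rightarrow> real) \<Rightarrow> real" where
  "qform I h x y = (\<Sum>i\<in>I. x i * (\<Sum>j\<in>I. h i j * y j))"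

lemma qform_commute:
  assumes "\<And>i j. i \<in> I \<Longrightarrow> j \<in> I \<Longrightarrow> h i j = h j i"
  shows "qform I h x y = qform I h y x"
proof -
  have "qform I h x y = (\<Sum>i\<in>I. \<Sum>j\<in>I. x i * h i j * y j)"
    by (simp add: qform_def sum_distrib_left mult.assoc)
  also have "\<dots> = (\<Sum>j\<in>I. \<Sum>i\<in>I. x i * h i j * y j)" by (rule sum.swap)
  also have "\<dots> = qform I h y x"
    using assms by (simp add: qform_def sum_distrib_left mult_ac cong: sum.cong)
  finally show ?thesis .
qed

lemma qform_add_scale:
  fixes h :: "'v \<Rightarrow> 'v \<Rightarrow> real"
  assumes "\<And>i j. i \<in> I \<Longrightarrow> j \<in> I \<Longrightarrow> h i j = h j i"
  shows "qform I h (\<lambda>i. x i + t * y i) (\<lambda>i. x i + t * y i)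
    = qform I h x x + 2 * t * qform I h x y + t\<^sup>2 * qform I h y y"
proof -
  have "qform I h (\<lambda>i. x i + t * y i) (\<lambda>i. x i + t * y i) =
    qform I h x x + t * qform I h x y + t * qform I h y x + t\<^sup>2 * qform I h y y"
    by (simp add: qform_def algebra_simps sum.distrib sum_distrib_left power2_eq_square)
  then show ?thesis using qform_commute[of I h x y] assms by (simp add: algebra_simps)
qed

text \<open>Vectors indexed by a finite subset of an arbitrary type are modelled as functions that
  vanish off it, and Tychonoff's theorem for the product topology replaces compactness in a
  Euclidean space.\<close>

lemma compact_box_fun:
  "compact {x :: 'v \<Rightarrow> real. \<forall>i. x i \<in> (if i \<in> I then {-M..M} else {0})}"
proof -
  have "compactin (product_topology (\<lambda>_. euclidean) UNIV)
      (PiE UNIV (\<lambda>i. if i \<in> I then {-M..M} else {0::real}))"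
    by (subst compactin_PiE) auto
  moreover have "{x :: 'v \<Rightarrow> real. \<forall>i. x i \<in> (if i \<in> I then {-M..M} else {0})} =
      PiE UNIV (\<lambda>i. if i \<in> I then {-M..M} else {0::real})" by (auto simp: PiE_def Pi_def)
  ultimately show ?thesis by (simp add: euclidean_product_topology)
qed

text \<open>For small t the linear term decides the sign; t = b/c with c larger than \<bar>a\<bar>
  is small enough.\<close>

lemma nonpos_quadratic_all:
  fixes a b :: real
  assumes "\<And>t. 2 * t * b + t\<^sup>2 * a \<le> 0"
  shows "b = 0"
proof (rule ccontr)
  assume b: "b \<noteq> 0"
  define c where "c = \<bar>a\<bar> + 1"
  have c: "c > 0" "\<bar>a\<bar> < c" by (auto simp: c_def)
  have "2 * (b / c) * b + (b / c)\<^sup>2 * a = b\<^sup>2 / c * (2 + a / c)"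
    using c by (simp add: field_simps power2_eq_square)
  moreover have "2 + a / c > 0"
    using c by (simp add: field_simps abs_less_iff)
  moreover have "b\<^sup>2 / c > 0" using b c by simp
  ultimately show False using assms[of "b / c"] by (metis mult_pos_pos not_le)
qed

text \<open>A maximiser of the form on the unit sphere of the metric m, inside the hyperplane
  orthogonal to u, satisfies the Lagrange condition in all directions of that hyperplane; the
  maximum c is the multiplier.\<close>

lemma qform_maximizer:
  fixes h :: "'v \<Rightarrow> 'v \<Rightarrow> real"
  assumes I: "finite I" and sym: "\<And>i j. i \<in> I \<Longrightarrow> j \<in> I \<Longrightarrow> h i j = h j i"
    and m: "\<And>i. i \<in> I \<Longrightarrow> m i > 0"
    and x0: "(\<Sum>i\<in>I. u i * x0 i) = 0" "qform I h x0 x0 > 0"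
  shows "\<exists>x c. c > 0 \<and> (\<Sum>i\<in>I. m i * (x i)\<^sup>2) = 1 \<and> (\<Sum>i\<in>I. u i * x i) = 0 \<and> qform I h x x = c
    \<and> (\<forall>y. (\<Sum>i\<in>I. u i * y i) = 0 \<longrightarrow> qform I h x y = c * (\<Sum>i\<in>I. m i * x i * y i))"
proof -
  define N where "N x = (\<Sum>i\<in>I. m i * (x i)\<^sup>2)" for x :: "'v \<Rightarrow> real"
  define L where "L x = (\<Sum>i\<in>I. u i * x i)" for x :: "'v \<Rightarrow> real"
  let ?q = "\<lambda>x. qform I h x x"
  have N0: "N x \<ge> 0" for x unfolding N_def using m by (intro sum_nonneg) (simp add: less_imp_le)
  have Nz: "N x = 0 \<Longrightarrow> i \<in> I \<Longrightarrow> x i = 0" for x i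
    unfolding N_def using m I
    by (subst (asm) sum_nonneg_eq_0_iff) (force simp: less_imp_le)+
  have qz: "N x = 0 \<Longrightarrow> ?q x = 0" for x unfolding qform_def using Nz[of x] by simp
  have scaleN: "N (\<lambda>i. s * x i) = s\<^sup>2 * N x" for s x
    by (simp add: N_def power_mult_distrib sum_distrib_left mult_ac)
  have scaleL: "L (\<lambda>i. s * x i) = s * L x" for s x
    by (simp add: L_def sum_distrib_left mult_ac)
  have scaleq: "?q (\<lambda>i. s * x i) = s\<^sup>2 * ?q x" for s x
    by (simp add: qform_def sum_distrib_left mult_ac power2_eq_square)
  \<comment> \<open>On the unit sphere \<open>m i * (x i)\<^sup>2\<close> is at most 1, so a common
    bound M on the coordinates exists; it makes the sphere a closed part of a compact box.\<close>
  obtain M where M: "M \<ge> 0" "\<And>i. i \<in> I \<Longrightarrow> 1 / m i \<le> M\<^sup>2"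
  proof -
    define S where "S = (\<Sum>i\<in>I. 1 / m i)"
    have S0: "S \<ge> 0" unfolding S_def using m by (intro sum_nonneg) (simp add: less_imp_le)
    have "1 / m i \<le> S" if "i \<in> I" for i
      unfolding S_def using I that m by (intro member_le_sum) (auto simp: less_imp_le)
    then show ?thesis using that[of "sqrt S"] S0 by simp
  qed
  define C where "C = {x. \<forall>i. x i \<in> (if i \<in> I then {-M..M} else {0})} \<inter> {x. N x = 1} \<inter> {x. L x = 0}"
  have cont: "continuous_on UNIV N" "continuous_on UNIV L" "continuous_on UNIV ?q"
    unfolding N_def L_def qform_def
    by (intro continuous_intros continuous_on_product_coordinates)+
  have cC: "compact C" unfolding C_def
    by (intro compact_Int_closed compact_box_fun closed_Collect_eq cont continuous_intros)
  \<comment> \<open>Besides normalising, \<open>nz\<close> cuts the vector off outside I, as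
    membership in the box requires.\<close>
  define nz where "nz x = (\<lambda>i. if i \<in> I then x i / sqrt (N x) else 0)" for x
  have restrictN: "N (\<lambda>i. if i \<in> I then x i else 0) = N x"
    and restrictL: "L (\<lambda>i. if i \<in> I then x i else 0) = L x"
    and restrictq: "?q (\<lambda>i. if i \<in> I then x i else 0) = ?q x" for x
    by (simp_all add: N_def L_def qform_def)
  have nzC: "nz x \<in> C" and qnz: "?q (nz x) = ?q x / N x" if "N x > 0" "L x = 0" for x
  proof -
    have nzeq: "nz x = (\<lambda>i. if i \<in> I then (1 / sqrt (N x)) * x i else 0)" by (auto simp: nz_def)
    have N1: "N (nz x) = 1" unfolding nzeq restrictN scaleN using that by (simp add: field_simps)
    have L1: "L (nz x) = 0" unfolding nzeq restrictL scaleL using that by simp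
    show "?q (nz x) = ?q x / N x"
      unfolding nzeq restrictq scaleq using that by (simp add: field_simps)
    have "nz x i \<in> {-M..M}" if i: "i \<in> I" for i
    proof -
      have "m i * (nz x i)\<^sup>2 \<le> N (nz x)" unfolding N_def
        using I i m by (intro member_le_sum[of i I "\<lambda>i. m i * (nz x i)\<^sup>2"]) (auto simp: less_imp_le)
      then have "(nz x i)\<^sup>2 \<le> 1 / m i" using N1 m[OF i] by (simp add: field_simps)
      then have "(nz x i)\<^sup>2 \<le> M\<^sup>2" using M(2)[OF i] by linarith
      then have "\<bar>nz x i\<bar> \<le> M" using M(1) abs_le_square_iff[of "nz x i" M] by simp
      then show ?thesis by auto
    qed
    then show "nz x \<in> C" using N1 L1 by (auto simp: C_def nz_def)
  qed
  have "N x0 > 0" using N0[of x0] qz[of x0] x0(2) by (cases "N x0 = 0") auto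
  then have C0: "nz x0 \<in> C" "?q (nz x0) > 0" using nzC qnz x0 by (auto simp: L_def)
  then obtain x where x: "x \<in> C" "\<And>y. y \<in> C \<Longrightarrow> ?q y \<le> ?q x"
    using continuous_attains_sup[OF cC, of ?q] cont(3) continuous_on_subset by blast
  define c where "c = ?q x"
  have c0: "c > 0" using x(2)[OF C0(1)] C0(2) by (simp add: c_def)
  have Nx: "N x = 1" and Lx: "L x = 0" using x(1) by (auto simp: C_def)
  have max: "?q y \<le> c * N y" if "L y = 0" for y
  proof (cases "N y = 0")
    case True then show ?thesis using qz by simp
  next
    case False
    then have "N y > 0" using N0[of y] by linarith
    then show ?thesis using x(2)[OF nzC[OF _ that]] qnz[OF _ that] by (simp add: c_def field_simps)
  qed
  have "qform I h x y = c * (\<Sum>i\<in>I. m i * x i * y i)" if y: "L y = 0" for y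
  proof -
    define B where "B = (\<Sum>i\<in>I. m i * x i * y i)"
    \<comment> \<open>This is the maximality of x tested at x + t y; the constant terms cancel
      because the form takes the value c at x and x has norm 1.\<close>
    have "2 * t * (qform I h x y - c * B) + t\<^sup>2 * (?q y - c * N y) \<le> 0" for t
    proof -
      have "N (\<lambda>i. x i + t * y i) = N x + 2 * t * B + t\<^sup>2 * N y"
        by (simp add: N_def B_def power2_eq_square algebra_simps sum.distrib sum_distrib_left)
      moreover have "L (\<lambda>i. x i + t * y i) = 0"
        using Lx y by (simp add: L_def algebra_simps sum.distrib sum_distrib_left[symmetric])
      ultimately have "?q (\<lambda>i. x i + t * y i) \<le> c * (1 + 2 * t * B + t\<^sup>2 * N y)"
        using max[of "\<lambda>i. x i + t * y i"] Nx by simp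
      moreover have "?q (\<lambda>i. x i + t * y i) = c + 2 * t * qform I h x y + t\<^sup>2 * ?q y"
        using qform_add_scale[of I h x t y] sym by (simp add: c_def)
      ultimately show ?thesis by (simp add: algebra_simps)
    qed
    then show ?thesis using nonpos_quadratic_all unfolding B_def by fastforce
  qed
  then show ?thesis using c0 Nx Lx unfolding N_def L_def c_def by blast
qed

text \<open>
  With \<open>D = diag (v/u)\<close>, the form \<open>h\<close> satisfies \<open>h \<le> h D h\<close> by hypothesis and \<open>h \<le> D\<^sup>-\<^sup>1\<close> because the
  off-diagonal entries are nonnegative and \<open>h v = u\<close>. So eigenvalues relative to \<open>D\<^sup>-\<^sup>1\<close> are \<open>\<le> 0\<close> or \<open>1\<close>,
  and connectedness makes \<open>v\<close> the only eigenvector for \<open>1\<close>.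
\<close>

lemma qform_nonpos_on_orthogonal:
  fixes h :: "'v \<Rightarrow> 'v \<Rightarrow> real"
  assumes I: "finite I" and sym: "\<And>i j. i \<in> I \<Longrightarrow> j \<in> I \<Longrightarrow> h i j = h j i"
    and off: "\<And>i j. i \<in> I \<Longrightarrow> j \<in> I \<Longrightarrow> i \<noteq> j \<Longrightarrow> h i j \<ge> 0"
    and conn: "\<And>z :: 'v \<Rightarrow> real. (\<And>i j. i \<in> I \<Longrightarrow> j \<in> I \<Longrightarrow> i \<noteq> j \<Longrightarrow> h i j > 0 \<Longrightarrow> z i = z j)
       \<Longrightarrow> \<exists>k. \<forall>i\<in>I. z i = k"
    and v: "\<And>i. i \<in> I \<Longrightarrow> v i > 0" and u: "\<And>i. i \<in> I \<Longrightarrow> u i > 0"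
    and hv: "\<And>i. i \<in> I \<Longrightarrow> (\<Sum>j\<in>I. h i j * v j) = u i"
    and boch: "\<And>x. qform I h x x \<le> (\<Sum>i\<in>I. v i / u i * (\<Sum>j\<in>I. h i j * x j)\<^sup>2)"
    and orth: "(\<Sum>i\<in>I. u i * x0 i) = 0"
  shows "qform I h x0 x0 \<le> 0"
proof (rule ccontr)
  assume "\<not> ?thesis"
  then have q0: "qform I h x0 x0 > 0" by simp
  define m where "m i = u i / v i" for i
  have m: "m i > 0" if "i \<in> I" for i using u v that by (simp add: m_def)
  obtain x c where c: "c > 0" and nx: "(\<Sum>i\<in>I. m i * (x i)\<^sup>2) = 1"
    and ox: "(\<Sum>i\<in>I. u i * x i) = 0" and qx: "qform I h x x = c"
    and crit: "\<And>y. (\<Sum>i\<in>I. u i * y i) = 0 \<Longrightarrow> qform I h x y = c * (\<Sum>i\<in>I. m i * x i * y i)"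
    using qform_maximizer[of I h m u x0, OF I sym m orth q0] by blast
  have muv: "m i * v i = u i" if "i \<in> I" for i using v[OF that] by (simp add: m_def)
  have qxv: "qform I h x v = 0"
    using hv ox by (simp add: qform_def mult.commute cong: sum.cong)
  have U: "(\<Sum>i\<in>I. u i * v i) > 0"
  proof -
    have "I \<noteq> {}" using nx by auto
    then show ?thesis using I u v by (intro sum_pos) auto
  qed
  \<comment> \<open>Any y is moved into the hyperplane by subtracting a multiple of v. Both sides
    are unaffected: h v = u and m v = u, so v pairs to zero with x in either form.\<close>
  have crit': "qform I h x y = c * (\<Sum>i\<in>I. m i * x i * y i)" for y
  proof -
    define t where "t = (\<Sum>i\<in>I. u i * y i) / (\<Sum>i\<in>I. u i * v i)"
    let ?y = "\<lambda>i. y i + (-t) * v i"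
    have "(\<Sum>i\<in>I. u i * ?y i) = (\<Sum>i\<in>I. u i * y i) - t * (\<Sum>i\<in>I. u i * v i)"
      by (simp add: algebra_simps sum_subtractf sum_distrib_left)
    then have "(\<Sum>i\<in>I. u i * ?y i) = 0" using U by (simp add: t_def)
    then have "qform I h x ?y = c * (\<Sum>i\<in>I. m i * x i * ?y i)" by (rule crit)
    moreover have "qform I h x ?y = qform I h x y - t * qform I h x v"
      by (simp add: qform_def algebra_simps sum_subtractf sum_distrib_left)
    moreover have "(\<Sum>i\<in>I. m i * x i * ?y i) = (\<Sum>i\<in>I. m i * x i * y i) - t * (\<Sum>i\<in>I. u i * x i)"
      using muv by (simp add: algebra_simps sum_subtractf sum_distrib_left flip: muv cong: sum.cong)
    ultimately show ?thesis using qxv ox by simp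
  qed
  have eig: "(\<Sum>j\<in>I. h i j * x j) = c * m i * x i" if i: "i \<in> I" for i
  proof -
    have "qform I h x (\<lambda>j. if j = i then 1 else 0) = c * (m i * x i)"
      using crit'[of "\<lambda>j. if j = i then 1 else 0"] I i by (simp add: if_distrib cong: if_cong)
    then have "qform I h (\<lambda>j. if j = i then 1 else 0) x = c * (m i * x i)"
      using qform_commute[of I h x] sym by metis
    then show ?thesis
      using I i by (simp add: qform_def if_distribR if_distrib cong: if_cong)
  qed
  \<comment> \<open>At an eigenvector the Bochner hypothesis \<open>boch\<close> reads c \<le> c^2,
    that is c \<ge> 1.\<close>
  have "c \<le> (\<Sum>i\<in>I. v i / u i * (c * m i * x i)\<^sup>2)" using boch[of x] eig qx by simp
  also have "\<dots> = (\<Sum>i\<in>I. c\<^sup>2 * (m i * (x i)\<^sup>2))"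
  proof (rule sum.cong[OF refl])
    fix i assume "i \<in> I"
    then have "v i / u i * m i = 1" using u[of i] v[of i] by (simp add: m_def)
    have "v i / u i * (c * m i * x i)\<^sup>2 = (v i / u i * m i) * (m i * c\<^sup>2 * (x i)\<^sup>2)"
      by (simp add: power2_eq_square)
    also note \<open>v i / u i * m i = 1\<close>
    finally show "v i / u i * (c * m i * x i)\<^sup>2 = c\<^sup>2 * (m i * (x i)\<^sup>2)" by simp
  qed
  also have "\<dots> = c\<^sup>2" using nx by (simp add: sum_distrib_left[symmetric])
  finally have c1: "c \<ge> 1" using c by (simp add: power2_eq_square)
  define z where "z i = x i / v i" for i
  have xz: "x i = z i * v i" if "i \<in> I" for i using v[OF that] by (simp add: z_def)
  \<comment> \<open>T is the Laplacian energy of z = x / v. Diagonal terms drop out, so T is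
    nonnegative; since h v = u it equals 2 - 2 c, and c \<ge> 1 then forces T = 0.\<close>
  define T where "T = (\<Sum>i\<in>I. \<Sum>j\<in>I. h i j * v i * v j * (z i - z j)\<^sup>2)"
  have "T = 2 * (\<Sum>i\<in>I. \<Sum>j\<in>I. h i j * v i * v j * (z i)\<^sup>2) - 2 * qform I h x x"
  proof -
    have "T = (\<Sum>i\<in>I. \<Sum>j\<in>I. h i j * v i * v j * (z i)\<^sup>2) + (\<Sum>i\<in>I. \<Sum>j\<in>I. h i j * v i * v j * (z j)\<^sup>2)
        - 2 * (\<Sum>i\<in>I. \<Sum>j\<in>I. h i j * v i * v j * z i * z j)"
      unfolding T_def by (simp add: power2_eq_square algebra_simps sum.distrib sum_subtractf sum_distrib_left)
    moreover have "(\<Sum>i\<in>I. \<Sum>j\<in>I. h i j * v i * v j * (z j)\<^sup>2) = (\<Sum>i\<in>I. \<Sum>j\<in>I. h i j * v i * v j * (z i)\<^sup>2)"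
      by (subst sum.swap) (use sym in \<open>simp add: mult_ac cong: sum.cong\<close>)
    moreover have "(\<Sum>i\<in>I. \<Sum>j\<in>I. h i j * v i * v j * z i * z j) = qform I h x x"
      unfolding qform_def sum_distrib_left by (intro sum.cong refl) (simp add: xz)
    ultimately show ?thesis by simp
  qed
  also have "(\<Sum>i\<in>I. \<Sum>j\<in>I. h i j * v i * v j * (z i)\<^sup>2) = 1"
  proof -
    have "(\<Sum>j\<in>I. h i j * v i * v j * (z i)\<^sup>2) = m i * (x i)\<^sup>2" if i: "i \<in> I" for i
    proof -
      have "(\<Sum>j\<in>I. h i j * v i * v j * (z i)\<^sup>2) = v i * (z i)\<^sup>2 * (\<Sum>j\<in>I. h i j * v j)"
        by (simp add: sum_distrib_left mult_ac)
      also have "\<dots> = m i * (x i)\<^sup>2"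
        using v[OF i] by (simp add: hv[OF i] m_def z_def power2_eq_square)
      finally show ?thesis .
    qed
    then show ?thesis using nx by simp
  qed
  finally have T: "T = 2 - 2 * c" using qx by simp
  have Tij: "h i j * v i * v j * (z i - z j)\<^sup>2 \<ge> 0" if "i \<in> I" "j \<in> I" for i j
    using off[OF that] v[OF that(1)] v[OF that(2)] by (cases "i = j") auto
  then have "T \<ge> 0" unfolding T_def by (intro sum_nonneg)
  then have "T = 0" using T c1 by simp
  then have "h i j * v i * v j * (z i - z j)\<^sup>2 = 0" if "i \<in> I" "j \<in> I" for i j
    unfolding T_def using I that Tij
    by (subst (asm) sum_nonneg_eq_0_iff) (auto intro: sum_nonneg simp: sum_nonneg_eq_0_iff)
  then have "z i = z j" if "i \<in> I" "j \<in> I" "h i j > 0" for i j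
    using v[of i] v[of j] that by fastforce
  then obtain k where k: "\<And>i. i \<in> I \<Longrightarrow> z i = k" using conn[of z] by blast
  \<comment> \<open>Constant z means x = k v, but x is orthogonal to u while v is not.\<close>
  have "k * (\<Sum>i\<in>I. u i * v i) = (\<Sum>i\<in>I. u i * x i)"
    by (simp add: sum_distrib_left xz k mult_ac)
  then have "k = 0" using ox U by simp
  then have "x i = 0" if "i \<in> I" for i using that xz k by simp
  then show False using nx by simp
qed

section \<open>Intersection numbers on balanced complexes\<close>

text \<open>The Hodge index property of a symmetric form, at most one positive direction, written
  without reference to a basis.\<close>

definition reverse_cs :: "('x \<Rightarrow> 'x \<Rightarrow> real) \<Rightarrow> bool" where
  "reverse_cs Q \<longleftrightarrow> (\<forall>x v. Q v v > 0 \<longrightarrow> Q x x * Q v v \<le> (Q x v)\<^sup>2)"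

lemma discriminant_nonneg:
  fixes a b c t :: real
  assumes "a > 0" "c + 2 * t * b + t\<^sup>2 * a \<le> 0"
  shows "c * a \<le> b\<^sup>2"
proof -
  have "a * (c + 2 * t * b + t\<^sup>2 * a) \<le> 0" using assms by (simp add: mult_nonneg_nonpos)
  moreover have "a * (c + 2 * t * b + t\<^sup>2 * a) = (t * a + b)\<^sup>2 + c * a - b\<^sup>2"
    by (simp add: power2_eq_square algebra_simps)
  moreover have "(t * a + b)\<^sup>2 \<ge> 0" by simp
  ultimately show ?thesis by linarith
qed

text \<open>A vector v with \<open>Q v v > 0\<close> lies outside the kernel of L, so x can be
  shifted along v into that kernel. There the quadratic polynomial in the shift is nonpositive, and
  its discriminant gives the inequality.\<close>

lemma reverse_csI:
  fixes Q :: "('v \<Rightarrow> real) \<Rightarrow> ('v \<Rightarrow> real) \<Rightarrow> real" and L :: "('v \<Rightarrow> real) \<Rightarrow> real"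
  assumes Q: "\<And>x v t. Q (\<lambda>G. x G + t * v G) (\<lambda>G. x G + t * v G) = Q x x + 2 * t * Q x v + t\<^sup>2 * Q v v"
    and L: "\<And>x v t. L (\<lambda>G. x G + t * v G) = L x + t * L v"
    and neg: "\<And>x. L x = 0 \<Longrightarrow> Q x x \<le> 0"
  shows "reverse_cs Q"
  unfolding reverse_cs_def
proof (intro allI impI)
  fix x v assume v: "Q v v > 0"
  then have Lv: "L v \<noteq> 0" using neg by fastforce
  define t where "t = - L x / L v"
  have "L (\<lambda>G. x G + t * v G) = 0" unfolding L using Lv by (simp add: t_def)
  from neg[OF this] show "Q x x * Q v v \<le> (Q x v)\<^sup>2"
    unfolding Q by (rule discriminant_nonneg[OF v])
qed

text \<open>A unimodular fan with all weights one, recorded combinatorially: vertices are rays,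
  faces are cones, n is the dimension, and \<open>lins\<close> holds the restrictions of global
  linear functions to the rays. \<open>lins_dual\<close> is unimodularity of the cones,
  \<open>balanced\<close> the tropical balancing condition in codimension one.\<close>

locale balanced_complex =
  fixes faces :: "'v set set" and lins :: "('v \<Rightarrow> real) set" and n :: nat
  assumes finite_vertices: "finite (\<Union>faces)"
    and face_subset: "\<sigma> \<in> faces \<Longrightarrow> \<rho> \<subseteq> \<sigma> \<Longrightarrow> \<rho> \<in> faces"
    and face_extend: "\<sigma> \<in> faces \<Longrightarrow> card \<sigma> < n \<Longrightarrow> \<exists>G. G \<notin> \<sigma> \<and> insert G \<sigma> \<in> faces"
    and lins_zero: "(\<lambda>_. 0) \<in> lins"
    and lins_add: "f \<in> lins \<Longrightarrow> g \<in> lins \<Longrightarrow> (\<lambda>G. f G + g G) \<in> lins"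
    and lins_scale: "f \<in> lins \<Longrightarrow> (\<lambda>G. c * f G) \<in> lins"
    and lins_dual: "\<sigma> \<in> faces \<Longrightarrow> G \<in> \<sigma> \<Longrightarrow> \<exists>f\<in>lins. f G = 1 \<and> (\<forall>H\<in>\<sigma> - {G}. f H = 0)"
    and balanced: "\<sigma> \<in> faces \<Longrightarrow> Suc (card \<sigma>) = n \<Longrightarrow> f \<in> lins \<Longrightarrow> \<forall>G\<in>\<sigma>. f G = 0 \<Longrightarrow>
      (\<Sum>G\<in>{G. G \<notin> \<sigma> \<and> insert G \<sigma> \<in> faces}. f G) = 0"
begin

definition lk :: "'v set \<Rightarrow> 'v set" where
  "lk \<sigma> = {G. G \<notin> \<sigma> \<and> insert G \<sigma> \<in> faces}"

definition dual :: "'v set \<Rightarrow> 'v \<Rightarrow> 'v \<Rightarrow> real" where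
  "dual \<sigma> G = (SOME f. f \<in> lins \<and> f G = 1 \<and> (\<forall>H\<in>\<sigma> - {G}. f H = 0))"

definition interp :: "'v set \<Rightarrow> ('v \<Rightarrow> real) \<Rightarrow> 'v \<Rightarrow> real" where
  "interp \<sigma> x = (\<lambda>H. \<Sum>G\<in>\<sigma>. x G * dual \<sigma> G H)"

text \<open>
  Intersection of a Minkowski weight with the divisor of the piecewise linear function \<open>x\<close>. On
  balanced weights \<open>interp\<close> may be replaced by any linear function that agrees with \<open>x\<close> on \<open>\<sigma>\<close>.
\<close>

definition mul :: "('v \<Rightarrow> real) \<Rightarrow> ('v set \<Rightarrow> real) \<Rightarrow> 'v set \<Rightarrow> real" where
  "mul x w \<sigma> = (\<Sum>G\<in>lk \<sigma>. (x G - interp \<sigma> x G) * w (insert G \<sigma>))"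

definition balanced_at :: "('v set \<Rightarrow> real) \<Rightarrow> 'v set \<Rightarrow> bool" where
  "balanced_at w \<sigma> \<longleftrightarrow>
    (\<forall>f\<in>lins. (\<forall>G\<in>\<sigma>. f G = 0) \<longrightarrow> (\<Sum>G\<in>lk \<sigma>. f G * w (insert G \<sigma>)) = 0)"

lemma balanced_atD:
  "balanced_at w \<sigma> \<Longrightarrow> f \<in> lins \<Longrightarrow> \<forall>G\<in>\<sigma>. f G = 0 \<Longrightarrow>
    (\<Sum>G\<in>lk \<sigma>. f G * w (insert G \<sigma>)) = 0"
  by (simp add: balanced_at_def)

text \<open>The degree of the product of the listed divisors on the star of a face. It has this
  meaning when the size of the face and the length of the list add up to n.\<close>

primrec mixed :: "('v \<Rightarrow> real) list \<Rightarrow> 'v set \<Rightarrow> real" where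
  "mixed [] = (\<lambda>_. 1)"
| "mixed (x # xs) = mul x (mixed xs)"

lemma finite_lk: "finite (lk \<sigma>)"
  by (rule finite_subset[OF _ finite_vertices]) (auto simp: lk_def)

lemma finite_face: "\<sigma> \<in> faces \<Longrightarrow> finite \<sigma>"
  by (rule finite_subset[OF _ finite_vertices]) auto

lemma lk_face: "G \<in> lk \<sigma> \<Longrightarrow> insert G \<sigma> \<in> faces"
  and lk_notin: "G \<in> lk \<sigma> \<Longrightarrow> G \<notin> \<sigma>"
  by (auto simp: lk_def)

lemma lk_card: "G \<in> lk \<sigma> \<Longrightarrow> card (insert G \<sigma>) = Suc (card \<sigma>)"
  using finite_face[of "insert G \<sigma>"] by (auto simp: lk_def)

lemma lk_insert_subset: "H \<in> lk (insert G \<sigma>) \<Longrightarrow> H \<in> lk \<sigma>"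
  by (auto simp: lk_def intro: face_subset)

lemma lk_insert_commute: "G \<in> lk \<sigma> \<Longrightarrow> H \<in> lk (insert G \<sigma>) \<longleftrightarrow> H \<in> lk \<sigma> \<and> G \<in> lk (insert H \<sigma>)"
  using face_subset[of "insert G (insert H \<sigma>)" "insert H \<sigma>"]
  by (auto simp: lk_def insert_commute[of H G])

lemma dual:
  assumes "\<sigma> \<in> faces" "G \<in> \<sigma>"
  shows dual_lins: "dual \<sigma> G \<in> lins" and dual_same: "dual \<sigma> G G = 1"
    and dual_other: "H \<in> \<sigma> \<Longrightarrow> H \<noteq> G \<Longrightarrow> dual \<sigma> G H = 0"
proof -
  have "\<exists>f. f \<in> lins \<and> f G = 1 \<and> (\<forall>H\<in>\<sigma> - {G}. f H = 0)" using lins_dual[OF assms] by blast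
  from someI_ex[OF this, folded dual_def] show "dual \<sigma> G \<in> lins" "dual \<sigma> G G = 1"
    "H \<in> \<sigma> \<Longrightarrow> H \<noteq> G \<Longrightarrow> dual \<sigma> G H = 0" by auto
qed

lemma dual_insert:
  assumes "G \<in> lk \<sigma>"
  shows "dual (insert G \<sigma>) G \<in> lins" "dual (insert G \<sigma>) G G = 1" "\<forall>H\<in>\<sigma>. dual (insert G \<sigma>) G H = 0"
  using dual[of "insert G \<sigma>" G] lk_face[OF assms] lk_notin[OF assms] by auto

lemma lins_sum: "finite A \<Longrightarrow> (\<And>a. a \<in> A \<Longrightarrow> f a \<in> lins) \<Longrightarrow> (\<lambda>H. \<Sum>a\<in>A. f a H) \<in> lins"
  by (induction A rule: finite_induct) (auto intro: lins_zero lins_add)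

lemma lins_diff: "f \<in> lins \<Longrightarrow> g \<in> lins \<Longrightarrow> (\<lambda>G. f G - g G) \<in> lins"
  using lins_add[of f "\<lambda>G. (-1) * g G"] lins_scale[of g "-1"] by simp

lemma interp_lins: "\<sigma> \<in> faces \<Longrightarrow> interp \<sigma> x \<in> lins"
  unfolding interp_def by (intro lins_sum finite_face lins_scale dual_lins)

lemma interp_eq: assumes "\<sigma> \<in> faces" "H \<in> \<sigma>" shows "interp \<sigma> x H = x H"
proof -
  have "interp \<sigma> x H = (\<Sum>G\<in>\<sigma>. if G = H then x H else 0)"
    unfolding interp_def using assms by (intro sum.cong) (auto simp: dual_same dual_other)
  then show ?thesis using assms finite_face by simp
qed

lemma interp_zero: "\<forall>G\<in>\<sigma>. x G = 0 \<Longrightarrow> interp \<sigma> x = (\<lambda>_. 0)"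
  by (auto simp: interp_def)

lemma mul_vanishing: "\<forall>G\<in>\<sigma>. x G = 0 \<Longrightarrow> mul x w \<sigma> = (\<Sum>G\<in>lk \<sigma>. x G * w (insert G \<sigma>))"
  by (simp add: mul_def interp_zero)

lemma mul_eq:
  assumes "\<sigma> \<in> faces" "balanced_at w \<sigma>" "f \<in> lins" "\<forall>G\<in>\<sigma>. f G = x G"
  shows "mul x w \<sigma> = (\<Sum>G\<in>lk \<sigma>. (x G - f G) * w (insert G \<sigma>))"
proof -
  have "(\<lambda>G. f G - interp \<sigma> x G) \<in> lins" using assms interp_lins lins_diff by blast
  moreover have "\<forall>G\<in>\<sigma>. f G - interp \<sigma> x G = 0" using assms interp_eq by simp
  ultimately have "(\<Sum>G\<in>lk \<sigma>. (f G - interp \<sigma> x G) * w (insert G \<sigma>)) = 0"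
    by (rule balanced_atD[OF assms(2)])
  then show ?thesis by (simp add: mul_def algebra_simps sum_subtractf)
qed

lemma mul_lins: "\<sigma> \<in> faces \<Longrightarrow> balanced_at w \<sigma> \<Longrightarrow> f \<in> lins \<Longrightarrow> mul f w \<sigma> = 0"
  by (subst mul_eq[where f = f]) auto

lemma mul_add: "mul (\<lambda>G. x G + t * y G) w \<sigma> = mul x w \<sigma> + t * mul y w \<sigma>"
  by (simp add: mul_def interp_def algebra_simps sum.distrib sum_subtractf sum_distrib_left)

lemma mul_add_fun: "mul (\<lambda>G. x G + t * y G) w = (\<lambda>\<sigma>. mul x w \<sigma> + t * mul y w \<sigma>)"
  by (rule ext) (rule mul_add)

lemma mul_add_weight: "mul x (\<lambda>\<sigma>. w \<sigma> + t * w' \<sigma>) \<sigma> = mul x w \<sigma> + t * mul x w' \<sigma>"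
  by (simp add: mul_def algebra_simps sum.distrib sum_subtractf sum_distrib_left)

lemma mul_cong: "(\<And>G. G \<in> lk \<sigma> \<Longrightarrow> w (insert G \<sigma>) = w' (insert G \<sigma>)) \<Longrightarrow> mul x w \<sigma> = mul x w' \<sigma>"
  by (simp add: mul_def)

lemma mul_diff_lins:
  assumes "\<sigma> \<in> faces" "balanced_at w \<sigma>" "f \<in> lins"
  shows "mul (\<lambda>G. x G - f G) w \<sigma> = mul x w \<sigma>"
  using mul_add[of x "-1" f w \<sigma>] mul_lins[OF assms] by simp

text \<open>As y vanishes on \<sigma>, only its value at G has to be matched, and the multiple
  \<open>y G\<close> of any linear function dual to G does so.\<close>

lemma mul_insert:
  assumes "G \<in> lk \<sigma>" "balanced_at w (insert G \<sigma>)" "\<forall>H\<in>\<sigma>. y H = 0"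
    and f: "f \<in> lins" "f G = 1" "\<forall>H\<in>\<sigma>. f H = 0"
  shows "mul y w (insert G \<sigma>) = (\<Sum>H\<in>lk (insert G \<sigma>). y H * w (insert H (insert G \<sigma>)))
     - y G * (\<Sum>H\<in>lk (insert G \<sigma>). f H * w (insert H (insert G \<sigma>)))"
proof -
  have "mul y w (insert G \<sigma>) = (\<Sum>H\<in>lk (insert G \<sigma>). (y H - y G * f H) * w (insert H (insert G \<sigma>)))"
    by (rule mul_eq) (use assms lk_face lins_scale in auto)
  then show ?thesis by (simp add: algebra_simps sum_subtractf sum_distrib_left)
qed

text \<open>With x and y made to vanish on \<sigma>, the double product is a sum over ordered edges
  of the link plus a diagonal sum with coefficients independent of x and y. Both are symmetric, the
  first after swapping the two ends of an edge.\<close>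

lemma mul_commute:
  assumes \<sigma>: "\<sigma> \<in> faces" and bal: "\<And>G. G \<in> lk \<sigma> \<Longrightarrow> balanced_at w (insert G \<sigma>)"
  shows "mul x (mul y w) \<sigma> = mul y (mul x w) \<sigma>"
proof -
  \<comment> \<open>Up to sign the self-intersection number of the ray G.\<close>
  define c where "c G = (\<Sum>H\<in>lk (insert G \<sigma>). dual (insert G \<sigma>) G H * w (insert H (insert G \<sigma>)))" for G
  define rd where "rd x = (\<lambda>G. x G - interp \<sigma> x G)" for x
  have rd0: "\<forall>H\<in>\<sigma>. rd x H = 0" for x using interp_eq[OF \<sigma>] by (simp add: rd_def)
  have eq: "mul x (mul y w) \<sigma> =
      (\<Sum>G\<in>lk \<sigma>. \<Sum>H\<in>{H\<in>lk \<sigma>. H \<in> lk (insert G \<sigma>)}. rd x G * rd y H * w (insert H (insert G \<sigma>)))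
      - (\<Sum>G\<in>lk \<sigma>. rd x G * rd y G * c G)" for x y
  proof -
    have step: "rd x G * mul y w (insert G \<sigma>) =
        (\<Sum>H\<in>{H\<in>lk \<sigma>. H \<in> lk (insert G \<sigma>)}. rd x G * rd y H * w (insert H (insert G \<sigma>)))
        - rd x G * rd y G * c G" if G: "G \<in> lk \<sigma>" for G
    proof -
      have "mul y w (insert G \<sigma>) = mul (rd y) w (insert G \<sigma>)"
        unfolding rd_def by (rule mul_diff_lins[symmetric]) (use G bal lk_face interp_lins \<sigma> in auto)
      also have "\<dots> = (\<Sum>H\<in>lk (insert G \<sigma>). rd y H * w (insert H (insert G \<sigma>))) - rd y G * c G"
        unfolding c_def
        by (rule mul_insert) (use G bal rd0 dual_insert in auto)
      also have "lk (insert G \<sigma>) = {H\<in>lk \<sigma>. H \<in> lk (insert G \<sigma>)}" using lk_insert_subset by blast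
      finally show ?thesis by (simp add: right_diff_distrib sum_distrib_left mult.assoc)
    qed
    have "mul x (mul y w) \<sigma> = (\<Sum>G\<in>lk \<sigma>. rd x G * mul y w (insert G \<sigma>))"
      by (simp add: mul_def[of x] rd_def)
    also have "\<dots> = (\<Sum>G\<in>lk \<sigma>. (\<Sum>H\<in>{H\<in>lk \<sigma>. H \<in> lk (insert G \<sigma>)}.
        rd x G * rd y H * w (insert H (insert G \<sigma>))) - rd x G * rd y G * c G)"
      by (rule sum.cong[OF refl step])
    finally show ?thesis by (simp only: sum_subtractf)
  qed
  have "(\<Sum>G\<in>lk \<sigma>. \<Sum>H\<in>{H\<in>lk \<sigma>. H \<in> lk (insert G \<sigma>)}. rd x G * rd y H * w (insert H (insert G \<sigma>)))
      = (\<Sum>H\<in>lk \<sigma>. \<Sum>G\<in>{G\<in>lk \<sigma>. H \<in> lk (insert G \<sigma>)}. rd x G * rd y H * w (insert H (insert G \<sigma>)))"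
    by (rule sum.swap_restrict) (rule finite_lk)+
  also have "\<dots> = (\<Sum>H\<in>lk \<sigma>. \<Sum>G\<in>{G\<in>lk \<sigma>. G \<in> lk (insert H \<sigma>)}. rd y H * rd x G * w (insert G (insert H \<sigma>)))"
    by (intro sum.cong refl) (auto simp: lk_insert_commute insert_commute)
  finally show ?thesis unfolding eq by (simp add: mult.commute)
qed

text \<open>Testing against a linear f that vanishes on \<sigma> is multiplication by f. By
  commutativity f can act first on the shorter product, which is balanced by induction, and there a
  linear function acts as zero.\<close>

lemma mixed_balanced:
  "\<sigma> \<in> faces \<Longrightarrow> card \<sigma> + Suc (length xs) = n \<Longrightarrow> balanced_at (mixed xs) \<sigma>"
proof (induction xs arbitrary: \<sigma>)
  case Nil
  then show ?case using balanced[of \<sigma>] by (simp add: balanced_at_def lk_def)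
next
  case (Cons x xs)
  have bal: "balanced_at (mixed xs) (insert G \<sigma>)" if "G \<in> lk \<sigma>" for G
    using Cons.IH[OF lk_face[OF that]] lk_card[OF that] Cons.prems by simp
  show ?case unfolding balanced_at_def
  proof (intro ballI impI)
    fix f assume f: "f \<in> lins" "\<forall>G\<in>\<sigma>. f G = 0"
    have "(\<Sum>G\<in>lk \<sigma>. f G * mixed (x # xs) (insert G \<sigma>)) = mul f (mul x (mixed xs)) \<sigma>"
      using f by (simp add: mul_vanishing)
    also have "\<dots> = mul x (mul f (mixed xs)) \<sigma>" by (rule mul_commute[OF Cons.prems(1) bal])
    also have "\<dots> = mul x (\<lambda>_. 0) \<sigma>"
      by (rule mul_cong) (use mul_lins f bal lk_face in blast)
    finally show "(\<Sum>G\<in>lk \<sigma>. f G * mixed (x # xs) (insert G \<sigma>)) = 0" by (simp add: mul_def)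
  qed
qed

lemma mixed_swap:
  assumes "\<sigma> \<in> faces" "card \<sigma> + length xs + 2 = n"
  shows "mixed (x # y # xs) \<sigma> = mixed (y # x # xs) \<sigma>"
  unfolding mixed.simps
  by (rule mul_commute[OF assms(1)]) (use mixed_balanced lk_face lk_card assms(2) in simp)

lemma mixed_move:
  "\<sigma> \<in> faces \<Longrightarrow> card \<sigma> + length xs + length ys + 1 = n \<Longrightarrow>
    mixed (xs @ x # ys) \<sigma> = mixed (x # xs @ ys) \<sigma>"
proof (induction xs arbitrary: \<sigma>)
  case (Cons a xs)
  have "mixed ((a # xs) @ x # ys) \<sigma> = mixed (a # x # xs @ ys) \<sigma>"
    unfolding append_Cons mixed.simps(2)[of a]
    by (rule mul_cong) (use Cons lk_face lk_card in simp)
  also have "\<dots> = mixed (x # a # xs @ ys) \<sigma>"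
    by (rule mixed_swap) (use Cons.prems in auto)
  finally show ?case by simp
qed simp

lemma mixed_bilinear:
  assumes "\<sigma> \<in> faces" "card \<sigma> + length xs + 2 = n"
  shows "mixed ((\<lambda>G. x G + t * v G) # (\<lambda>G. x G + t * v G) # xs) \<sigma>
    = mixed (x # x # xs) \<sigma> + 2 * t * mixed (x # v # xs) \<sigma> + t\<^sup>2 * mixed (v # v # xs) \<sigma>"
  using mixed_swap[OF assms, of v x]
  by (simp add: mul_add_fun mul_add_weight algebra_simps power2_eq_square)

lemma mixed_diff_lins:
  assumes "\<sigma> \<in> faces" "card \<sigma> + Suc (length xs) = n" "f \<in> lins"
  shows "mixed ((\<lambda>G. x G - f G) # xs) \<sigma> = mixed (x # xs) \<sigma>"
  using mul_diff_lins mixed_balanced assms by simp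

section \<open>Ample and nef classes: strict and weak local convexity of piecewise linear
  functions\<close>

definition ample :: "('v \<Rightarrow> real) \<Rightarrow> bool" where
  "ample v \<longleftrightarrow> (\<forall>\<sigma>\<in>faces. \<exists>f\<in>lins. (\<forall>G\<in>\<sigma>. f G = v G) \<and> (\<forall>G\<in>lk \<sigma>. f G < v G))"

definition nef :: "('v \<Rightarrow> real) \<Rightarrow> bool" where
  "nef v \<longleftrightarrow> (\<forall>\<sigma>\<in>faces. \<exists>f\<in>lins. (\<forall>G\<in>\<sigma>. f G = v G) \<and> (\<forall>G\<in>lk \<sigma>. f G \<le> v G))"

lemma ampleE:
  assumes "ample v" "\<sigma> \<in> faces"
  obtains f where "f \<in> lins" "\<forall>G\<in>\<sigma>. f G = v G" "\<forall>G\<in>lk \<sigma>. f G < v G"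
  using bspec[OF assms(1)[unfolded ample_def] assms(2)] by blast

lemma nefE:
  assumes "nef v" "\<sigma> \<in> faces"
  obtains f where "f \<in> lins" "\<forall>G\<in>\<sigma>. f G = v G" "\<forall>G\<in>lk \<sigma>. f G \<le> v G"
  using bspec[OF assms(1)[unfolded nef_def] assms(2)] by blast

lemma ample_perturb:
  assumes "nef x" "ample v" "e > 0"
  shows "ample (\<lambda>G. x G + e * v G)"
  unfolding ample_def
proof
  fix \<sigma> assume "\<sigma> \<in> faces"
  obtain f where f: "f \<in> lins" "\<forall>G\<in>\<sigma>. f G = x G" "\<forall>G\<in>lk \<sigma>. f G \<le> x G"
    by (rule nefE[OF assms(1) \<open>\<sigma> \<in> faces\<close>])
  obtain g where g: "g \<in> lins" "\<forall>G\<in>\<sigma>. g G = v G" "\<forall>G\<in>lk \<sigma>. g G < v G"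
    by (rule ampleE[OF assms(2) \<open>\<sigma> \<in> faces\<close>])
  show "\<exists>f\<in>lins. (\<forall>G\<in>\<sigma>. f G = x G + e * v G) \<and> (\<forall>G\<in>lk \<sigma>. f G < x G + e * v G)"
  proof (intro bexI conjI ballI)
    show "(\<lambda>G. f G + e * g G) \<in> lins" by (rule lins_add[OF f(1) lins_scale[OF g(1)]])
    show "f G + e * g G = x G + e * v G" if "G \<in> \<sigma>" for G using f g that by simp
    show "f G + e * g G < x G + e * v G" if "G \<in> lk \<sigma>" for G
    proof -
      have "f G \<le> x G" "e * g G < e * v G" using f g that \<open>e > 0\<close> by auto
      then show ?thesis by linarith
    qed
  qed
qed

text \<open>Modulo a linear function the first class is positive on the link, which
  \<open>face_extend\<close> keeps nonempty, so the number is a positive combination of numbers of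
  one class less.\<close>

lemma mixed_pos:
  "\<sigma> \<in> faces \<Longrightarrow> card \<sigma> + length vs = n \<Longrightarrow> \<forall>v\<in>set vs. ample v \<Longrightarrow> mixed vs \<sigma> > 0"
proof (induction vs arbitrary: \<sigma>)
  case (Cons v vs)
  obtain f where f: "f \<in> lins" "\<forall>G\<in>\<sigma>. f G = v G" "\<forall>G\<in>lk \<sigma>. f G < v G"
    by (rule ampleE[of v \<sigma>]) (use Cons.prems in auto)
  have "mixed (v # vs) \<sigma> = (\<Sum>G\<in>lk \<sigma>. (v G - f G) * mixed vs (insert G \<sigma>))"
    unfolding mixed.simps by (rule mul_eq) (use Cons.prems f mixed_balanced in auto)
  also have "\<dots> > 0"
  proof (rule sum_pos[OF finite_lk])
    show "lk \<sigma> \<noteq> {}" using face_extend[of \<sigma>] Cons.prems by (auto simp: lk_def)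
    fix G assume G: "G \<in> lk \<sigma>"
    then have "mixed vs (insert G \<sigma>) > 0"
      using Cons.IH[OF lk_face[OF G]] lk_card[OF G] Cons.prems by simp
    then show "(v G - f G) * mixed vs (insert G \<sigma>) > 0" using f(3) G by simp
  qed
  finally show ?case .
qed simp

lemma mixed_tendsto:
  "((\<lambda>e. mixed (map (\<lambda>x G. x G + e * v G) xs) \<sigma>) \<longlongrightarrow> mixed xs \<sigma>) (at_right 0)"
proof (induction xs arbitrary: \<sigma>)
  case (Cons x xs)
  let ?M = "\<lambda>e. mixed (map (\<lambda>x G. x G + e * v G) xs)"
  have mul: "((\<lambda>e. mul y (?M e) \<sigma>) \<longlongrightarrow> mul y (mixed xs) \<sigma>) (at_right 0)" for y
    unfolding mul_def[of y] by (rule tendsto_sum) (rule tendsto_mult[OF tendsto_const Cons.IH])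
  have "((\<lambda>e. mul x (?M e) \<sigma> + e * mul v (?M e) \<sigma>) \<longlongrightarrow>
      mul x (mixed xs) \<sigma> + 0 * mul v (mixed xs) \<sigma>) (at_right 0)"
    by (intro tendsto_add tendsto_mult mul tendsto_ident_at)
  then show ?case by (simp add: mul_add)
qed simp

text \<open>Makes the base case a concrete quadratic form: twice the edges of the link, minus k on
  the diagonal. The number \<open>- k G\<close> is the self-intersection of G, and by balancing any
  linear function dual to G computes it.\<close>

lemma mixed_codim2:
  assumes \<sigma>: "\<sigma> \<in> faces" "card \<sigma> + 2 = n" and x: "\<forall>H\<in>\<sigma>. x H = 0"
    and f: "\<And>G. G \<in> lk \<sigma> \<Longrightarrow> \<exists>f\<in>lins. f G = 1 \<and> (\<forall>H\<in>\<sigma>. f H = 0) \<and> (\<Sum>H\<in>lk (insert G \<sigma>). f H) = k G"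
  shows "mixed [x, x] \<sigma> = (\<Sum>G\<in>lk \<sigma>. x G * ((\<Sum>H\<in>lk (insert G \<sigma>). x H) - k G * x G))"
proof -
  have "mul x (\<lambda>_. 1) (insert G \<sigma>) = (\<Sum>H\<in>lk (insert G \<sigma>). x H) - k G * x G" if G: "G \<in> lk \<sigma>" for G
  proof -
    obtain f where f: "f \<in> lins" "f G = 1" "\<forall>H\<in>\<sigma>. f H = 0" "(\<Sum>H\<in>lk (insert G \<sigma>). f H) = k G"
      using f[OF G] by blast
    have "balanced_at (mixed []) (insert G \<sigma>)"
      by (rule mixed_balanced) (use lk_face[OF G] lk_card[OF G] \<sigma> in auto)
    then show ?thesis
      using mul_insert[OF G _ x f(1-3), of "\<lambda>_. 1"] f(4) by simp
  qed
  then show ?thesis using x by (simp add: mul_vanishing)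
qed

text \<open>The functional of \<open>reverse_csI\<close> is the coordinate sum over P, taken after
  the linear part is removed; hence negativity has to be checked only for x that vanish on
  \<sigma>.\<close>

lemma reverse_cs_codim2I:
  assumes \<sigma>: "\<sigma> \<in> faces" "card \<sigma> + 2 = n"
    and neg: "\<And>x. \<forall>H\<in>\<sigma>. x H = 0 \<Longrightarrow> (\<Sum>G\<in>P. x G) = 0 \<Longrightarrow> mixed [x, x] \<sigma> \<le> 0"
  shows "reverse_cs (\<lambda>x y. mixed [x, y] \<sigma>)"
proof (rule reverse_csI[where L = "\<lambda>x. \<Sum>G\<in>P. x G - interp \<sigma> x G"])
  fix x v :: "'v \<Rightarrow> real" and t :: real
  show "mixed [\<lambda>G. x G + t * v G, \<lambda>G. x G + t * v G] \<sigma>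
      = mixed [x, x] \<sigma> + 2 * t * mixed [x, v] \<sigma> + t\<^sup>2 * mixed [v, v] \<sigma>"
    by (rule mixed_bilinear) (use \<sigma> in auto)
  show "(\<Sum>G\<in>P. x G + t * v G - interp \<sigma> (\<lambda>G. x G + t * v G) G)
      = (\<Sum>G\<in>P. x G - interp \<sigma> x G) + t * (\<Sum>G\<in>P. v G - interp \<sigma> v G)"
    by (simp add: interp_def algebra_simps sum.distrib sum_subtractf sum_distrib_left)
next
  fix x assume 0: "(\<Sum>G\<in>P. x G - interp \<sigma> x G) = 0"
  let ?x = "\<lambda>G. x G - interp \<sigma> x G"
  have red: "mixed [?x, y] \<sigma> = mixed [x, y] \<sigma>" for y
    by (rule mixed_diff_lins) (use \<sigma> interp_lins in auto)
  have "mixed [?x, ?x] \<sigma> = mixed [x, x] \<sigma>"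
    using red mixed_swap[of \<sigma> "[]" x ?x] \<sigma> by (simp del: mixed.simps)
  then show "mixed [x, x] \<sigma> \<le> 0" using neg[of ?x] 0 interp_eq \<sigma> by simp
qed

end

section \<open>The index inequality by induction on the dimension\<close>

locale lorentzian_complex = balanced_complex +
  assumes link_connected: "\<sigma> \<in> faces \<Longrightarrow> card \<sigma> + 2 \<le> n \<Longrightarrow> G \<in> lk \<sigma> \<Longrightarrow> H \<in> lk \<sigma> \<Longrightarrow>
      \<forall>z :: _ \<Rightarrow> real. (\<forall>F\<in>lk \<sigma>. \<forall>K\<in>lk (insert F \<sigma>). z F = z K) \<longrightarrow> z G = z H"
    and reverse_cs_codim2: "\<sigma> \<in> faces \<Longrightarrow> card \<sigma> + 2 = n \<Longrightarrow> reverse_cs (\<lambda>x y. mixed [x, y] \<sigma>)"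
begin

text \<open>On the link of \<sigma> the form with classes \<open>v # us\<close> has a matrix h whose
  row G computes the product with \<open>v # us\<close> at the face enlarged by G. Entries on edges
  are positive by ampleness, connectedness of the link gives irreducibility, and the induction
  hypothesis at the neighbours gives the Bochner inequality. So
  \<open>qform_nonpos_on_orthogonal\<close> applies, with v, made positive on the link, as
  Perron-Frobenius vector.\<close>

lemma mixed_nonpos_on_orthogonal:
  assumes \<sigma>: "\<sigma> \<in> faces" "card \<sigma> + length us + 3 = n"
    and v: "ample v" and us: "\<forall>v\<in>set us. ample v"
    and IH: "\<And>G. G \<in> lk \<sigma> \<Longrightarrow> reverse_cs (\<lambda>x y. mixed (x # y # us) (insert G \<sigma>))"
    and orth: "mixed (x # v # v # us) \<sigma> = 0"
  shows "mixed (x # x # v # us) \<sigma> \<le> 0"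
proof -
  define W where "W = mixed (v # us)"
  define S where "S = lk \<sigma>"
  obtain f where f: "f \<in> lins" "\<forall>G\<in>\<sigma>. f G = v G" "\<forall>G\<in>lk \<sigma>. f G < v G"
    by (rule ampleE[OF v \<sigma>(1)])
  \<comment> \<open>The representative of v that vanishes on \<sigma> and is positive on the
    link.\<close>
  define v' where "v' = (\<lambda>G. v G - f G)"
  have v'0: "\<forall>G\<in>\<sigma>. v' G = 0" and v'pos: "\<And>G. G \<in> S \<Longrightarrow> v' G > 0"
    using f by (auto simp: v'_def S_def)
  have balW: "balanced_at W (insert G \<sigma>)" if "G \<in> S" for G
    unfolding W_def by (rule mixed_balanced) (use that \<sigma> lk_face lk_card in \<open>auto simp: S_def\<close>)
  define d where "d G = dual (insert G \<sigma>) G" for G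
  \<comment> \<open>The diagonal entry is the self-intersection of G; its sign is arbitrary, and it
    is what makes row G equal to \<open>mul y W\<close> at the enlarged face.\<close>
  define h where "h G H = (if G = H then - (\<Sum>K\<in>lk (insert G \<sigma>). d G K * W (insert K (insert G \<sigma>)))
      else if H \<in> lk (insert G \<sigma>) then W (insert H (insert G \<sigma>)) else 0)" for G H
  have hsum: "(\<Sum>H\<in>S. h G H * y H) = mul y W (insert G \<sigma>)" if G: "G \<in> S" and y: "\<forall>H\<in>\<sigma>. y H = 0" for G y
  proof -
    have "mul y W (insert G \<sigma>) = (\<Sum>H\<in>lk (insert G \<sigma>). y H * W (insert H (insert G \<sigma>)))
      - y G * (\<Sum>H\<in>lk (insert G \<sigma>). d G H * W (insert H (insert G \<sigma>)))"
      unfolding d_def by (rule mul_insert)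
        (use G balW y dual_insert in \<open>auto simp: S_def\<close>)
    also have "\<dots> = (\<Sum>H\<in>lk (insert G \<sigma>). h G H * y H) + h G G * y G"
    proof -
      have "G \<notin> lk (insert G \<sigma>)" by (simp add: lk_def)
      then have "(\<Sum>H\<in>lk (insert G \<sigma>). y H * W (insert H (insert G \<sigma>))) = (\<Sum>H\<in>lk (insert G \<sigma>). h G H * y H)"
        by (intro sum.cong) (auto simp: h_def)
      then show ?thesis by (simp add: h_def)
    qed
    also have "\<dots> = (\<Sum>H\<in>insert G (lk (insert G \<sigma>)). h G H * y H)"
      using finite_lk[of "insert G \<sigma>"] by (subst sum.insert) (auto simp: lk_def)
    also have "\<dots> = (\<Sum>H\<in>S. h G H * y H)"
      using G lk_insert_subset by (intro sum.mono_neutral_left) (auto simp: S_def finite_lk h_def)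
    finally show ?thesis by simp
  qed
  have qf: "qform S h y z = mul y (mul z W) \<sigma>" if "\<forall>H\<in>\<sigma>. y H = 0" "\<forall>H\<in>\<sigma>. z H = 0" for y z
    unfolding qform_def mul_vanishing[OF that(1)] S_def[symmetric]
    by (rule sum.cong) (simp_all add: hsum that)
  have hsym: "h G H = h H G" if "G \<in> S" "H \<in> S" for G H
  proof -
    have "H \<in> lk (insert G \<sigma>) \<longleftrightarrow> G \<in> lk (insert H \<sigma>)"
      using that lk_insert_commute[of G \<sigma> H] by (simp add: S_def)
    then show ?thesis by (simp add: h_def insert_commute[of G H])
  qed
  have Wpos: "W (insert H (insert G \<sigma>)) > 0" if "G \<in> S" "H \<in> lk (insert G \<sigma>)" for G H
    unfolding W_def
    by (rule mixed_pos) (use that \<sigma> v us lk_face lk_card in \<open>auto simp: S_def\<close>)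
  define u where "u G = mul v' W (insert G \<sigma>)" for G
  have u_eq: "u G = mixed (v # v # us) (insert G \<sigma>)" if "G \<in> S" for G
    unfolding u_def v'_def mixed.simps W_def[unfolded mixed.simps, symmetric]
    by (rule mul_diff_lins) (use that balW f lk_face in \<open>auto simp: S_def\<close>)
  have upos: "u G > 0" if "G \<in> S" for G
    unfolding u_eq[OF that]
    by (rule mixed_pos) (use that \<sigma> v us lk_face lk_card in \<open>auto simp: S_def\<close>)
  have boch0: "qform S h y y \<le> (\<Sum>G\<in>S. v' G / u G * (\<Sum>H\<in>S. h G H * y H)\<^sup>2)"
    if y: "\<forall>H\<in>\<sigma>. y H = 0" for y
  proof -
    \<comment> \<open>Commutativity brings v to the front, where the linear part can be removed. As
      \<open>v'\<close> vanishes on \<sigma>, the form becomes a positive combination of the forms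
      at the neighbours.\<close>
    have "qform S h y y = mixed ([y, y] @ v # us) \<sigma>" using qf y by (simp add: W_def)
    also have "\<dots> = mixed (v # [y, y] @ us) \<sigma>" by (rule mixed_move) (use \<sigma> in auto)
    also have "\<dots> = mixed (v' # [y, y] @ us) \<sigma>"
      unfolding v'_def by (rule mixed_diff_lins[symmetric]) (use \<sigma> f in auto)
    also have "\<dots> = (\<Sum>G\<in>S. v' G * mixed (y # y # us) (insert G \<sigma>))"
      using v'0 by (simp add: mul_vanishing S_def)
    also have "\<dots> \<le> (\<Sum>G\<in>S. v' G / u G * (\<Sum>H\<in>S. h G H * y H)\<^sup>2)"
    proof (rule sum_mono)
      fix G assume G: "G \<in> S"
      have "mixed (y # y # us) (insert G \<sigma>) * u G \<le> (mixed (y # v # us) (insert G \<sigma>))\<^sup>2"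
        using IH[of G] G upos[OF G] unfolding reverse_cs_def S_def u_eq[OF G] by blast
      also have "mixed (y # v # us) (insert G \<sigma>) = (\<Sum>H\<in>S. h G H * y H)"
        using hsum[OF G y] by (simp add: W_def)
      finally have "mixed (y # y # us) (insert G \<sigma>) \<le> (\<Sum>H\<in>S. h G H * y H)\<^sup>2 / u G"
        using upos[OF G] by (simp add: field_simps)
      then show "v' G * mixed (y # y # us) (insert G \<sigma>) \<le> v' G / u G * (\<Sum>H\<in>S. h G H * y H)\<^sup>2"
        using v'pos[OF G] mult_left_mono[of _ _ "v' G"] by fastforce
    qed
    finally show ?thesis .
  qed
  have boch: "qform S h y y \<le> (\<Sum>G\<in>S. v' G / u G * (\<Sum>H\<in>S. h G H * y H)\<^sup>2)" for y
  proof -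
    have "H \<in> S \<Longrightarrow> H \<notin> \<sigma>" for H by (simp add: S_def lk_notin)
    then show ?thesis using boch0[of "\<lambda>H. if H \<in> \<sigma> then 0 else y H"]
      by (simp add: qform_def cong: sum.cong)
  qed
  define x' where "x' = (\<lambda>G. x G - interp \<sigma> x G)"
  have x'0: "\<forall>G\<in>\<sigma>. x' G = 0" using interp_eq \<sigma> by (simp add: x'_def)
  have red: "mixed (x' # ys) \<sigma> = mixed (x # ys) \<sigma>" if "length ys = length us + 2" for ys
    unfolding x'_def by (rule mixed_diff_lins) (use \<sigma> that interp_lins in auto)
  have red2: "mixed (y # x' # v # us) \<sigma> = mixed (y # x # v # us) \<sigma>" for y
    using mixed_swap[of \<sigma> "v # us" y x'] mixed_swap[of \<sigma> "v # us" x y] red[of "y # v # us"] \<sigma>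
    by (simp del: mixed.simps)
  have "(\<Sum>G\<in>S. u G * x' G) = mixed (x' # v' # v # us) \<sigma>"
    using x'0 by (simp add: mul_vanishing u_def W_def S_def mult.commute)
  also have "\<dots> = mixed (v' # x' # v # us) \<sigma>" by (rule mixed_swap) (use \<sigma> in auto)
  also have "\<dots> = mixed (v # x' # v # us) \<sigma>"
    unfolding v'_def by (rule mixed_diff_lins) (use \<sigma> f in auto)
  also have "\<dots> = 0" using red2[of v] mixed_swap[of \<sigma> "v # us" v x] \<sigma> orth by simp
  finally have x'orth: "(\<Sum>G\<in>S. u G * x' G) = 0" .
  have "qform S h x' x' \<le> 0"
  proof (rule qform_nonpos_on_orthogonal[where v = v' and u = u])
    show "finite S" by (simp add: S_def finite_lk)
    show "h i j \<ge> 0" if "i \<in> S" "j \<in> S" "i \<noteq> j" for i j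
      using that Wpos[of i j] by (auto simp: h_def less_imp_le)
    show "(\<Sum>j\<in>S. h i j * v' j) = u i" if "i \<in> S" for i
      using hsum[OF that v'0] by (simp add: u_def)
    show "\<exists>k. \<forall>i\<in>S. z i = k"
      if z: "\<And>i j. i \<in> S \<Longrightarrow> j \<in> S \<Longrightarrow> i \<noteq> j \<Longrightarrow> h i j > 0 \<Longrightarrow> z i = z j" for z :: "_ \<Rightarrow> real"
    proof -
      have "z G = z H" if "G \<in> S" "H \<in> S" for G H
      proof -
        have "z F = z K" if FK: "F \<in> lk \<sigma>" "K \<in> lk (insert F \<sigma>)" for F K
          by (rule z) (use FK lk_insert_subset lk_notin[OF FK(2)] Wpos in \<open>auto simp: S_def h_def\<close>)
        then show ?thesis using link_connected[of \<sigma> G H] \<sigma> that by (auto simp: S_def)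
      qed
      then show ?thesis by blast
    qed
  qed (use hsym v'pos upos boch x'orth in auto)
  also have "qform S h x' x' = mixed (x # x # v # us) \<sigma>"
    using qf[OF x'0 x'0] red[of "x' # v # us"] red2[of x] by (simp add: W_def)
  finally show ?thesis .
qed

theorem mixed_reverse_cs:
  "\<sigma> \<in> faces \<Longrightarrow> card \<sigma> + length ws + 2 = n \<Longrightarrow> \<forall>v\<in>set ws. ample v \<Longrightarrow>
    reverse_cs (\<lambda>x y. mixed (x # y # ws) \<sigma>)"
proof (induction ws arbitrary: \<sigma>)
  case Nil
  then show ?case using reverse_cs_codim2 by simp
next
  case (Cons v us)
  show ?case
  proof (rule reverse_csI[where L = "\<lambda>x. mixed (x # v # v # us) \<sigma>"])
    show "mixed (x # x # v # us) \<sigma> \<le> 0" if "mixed (x # v # v # us) \<sigma> = 0" for x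
      by (rule mixed_nonpos_on_orthogonal) (use Cons lk_face lk_card that in auto)
  next
    fix x y t
    show "mixed ((\<lambda>G. x G + t * y G) # (\<lambda>G. x G + t * y G) # v # us) \<sigma>
       = mixed (x # x # v # us) \<sigma> + 2 * t * mixed (x # y # v # us) \<sigma> + t\<^sup>2 * mixed (y # y # v # us) \<sigma>"
      by (rule mixed_bilinear) (use Cons.prems in auto)
  qed (simp add: mul_add)
qed

text \<open>Adding e times the ample v to every class makes a and all of \<open>ws\<close> ample, so
  that the index inequality applies with a positive square of a; both sides are polynomial in e, and
  e tends to 0.\<close>

theorem mixed_nef_log_concave:
  assumes v: "ample v" and ws: "\<forall>x\<in>set ws. nef x" and a: "nef a"
    and \<sigma>: "\<sigma> \<in> faces" "card \<sigma> + length ws + 2 = n"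
  shows "mixed (b # b # ws) \<sigma> * mixed (a # a # ws) \<sigma> \<le> (mixed (b # a # ws) \<sigma>)\<^sup>2"
proof -
  let ?p = "\<lambda>e x G. x G + e * v G"
  let ?m = "\<lambda>e xs. mixed (map (?p e) xs) \<sigma>"
  have le: "?m e (b # b # ws) * ?m e (a # a # ws) \<le> (?m e (b # a # ws))\<^sup>2" if e: "e > 0" for e
  proof -
    have amp: "\<forall>x\<in>set (map (?p e) (a # a # ws)). ample x" using v ws a e ample_perturb by auto
    then have "reverse_cs (\<lambda>x y. mixed (x # y # map (?p e) ws) \<sigma>)"
      using \<sigma> by (intro mixed_reverse_cs) auto
    moreover have "?m e (a # a # ws) > 0" by (rule mixed_pos) (use amp \<sigma> in auto)
    ultimately show ?thesis unfolding reverse_cs_def by simp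
  qed
  show ?thesis
  proof (rule tendsto_le)
    show "((\<lambda>e. (?m e (b # a # ws))\<^sup>2) \<longlongrightarrow> (mixed (b # a # ws) \<sigma>)\<^sup>2) (at_right 0)"
      by (intro tendsto_power mixed_tendsto)
    show "((\<lambda>e. ?m e (b # b # ws) * ?m e (a # a # ws)) \<longlongrightarrow> mixed (b # b # ws) \<sigma> * mixed (a # a # ws) \<sigma>) (at_right 0)"
      by (intro tendsto_mult mixed_tendsto)
    show "\<forall>\<^sub>F e in at_right 0. ?m e (b # b # ws) * ?m e (a # a # ws) \<le> (?m e (b # a # ws))\<^sup>2"
      using le by (intro eventually_at_right_less[THEN eventually_mono]) auto
  qed simp
qed

end

section \<open>Flags of flats\<close>

text \<open>The flats of a loopless matroid. The rank is a parameter, and \<open>cover\<close>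
  together with closure under intersection yields the covering partition: an element outside F lies
  in exactly one flat of rank one more above F.\<close>

locale flat_lattice =
  fixes E :: "'e set" and flats :: "'e set set" and rk :: "'e set \<Rightarrow> nat"
  assumes finite_ground: "finite E" and ground_nonempty: "E \<noteq> {}"
    and flat_subset: "F \<in> flats \<Longrightarrow> F \<subseteq> E"
    and empty_flat: "{} \<in> flats" and ground_flat: "E \<in> flats"
    and Int_flat: "F \<in> flats \<Longrightarrow> G \<in> flats \<Longrightarrow> F \<inter> G \<in> flats"
    and rk_empty: "rk {} = 0"
    and rk_strict: "F \<in> flats \<Longrightarrow> G \<in> flats \<Longrightarrow> F \<subset> G \<Longrightarrow> rk F < rk G"
    and cover: "F \<in> flats \<Longrightarrow> x \<in> E - F \<Longrightarrow> \<exists>G\<in>flats. insert x F \<subseteq> G \<and> rk G = Suc (rk F)"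
begin

lemma finite_flat: "F \<in> flats \<Longrightarrow> finite F"
  using flat_subset finite_ground finite_subset by blast

lemma finite_flats: "finite flats"
  by (rule finite_subset[of _ "Pow E"]) (use flat_subset finite_ground in auto)

lemma rk_mono: "F \<in> flats \<Longrightarrow> G \<in> flats \<Longrightarrow> F \<subseteq> G \<Longrightarrow> rk F \<le> rk G"
  using rk_strict[of F G] by (cases "F = G") (auto simp: psubset_eq)

lemma rk_eq: "F \<in> flats \<Longrightarrow> G \<in> flats \<Longrightarrow> F \<subseteq> G \<Longrightarrow> rk G \<le> rk F \<Longrightarrow> F = G"
  using rk_strict[of F G] by auto

lemma rk_le_ground: "F \<in> flats \<Longrightarrow> rk F \<le> rk E"
  using rk_mono flat_subset ground_flat by blast

lemma rk_pos: "F \<in> flats \<Longrightarrow> F \<noteq> {} \<Longrightarrow> rk F > 0"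
  using rk_strict[of "{}" F] empty_flat rk_empty by (auto simp: psubset_eq)

lemma rk_less_ground: "F \<in> flats \<Longrightarrow> F \<noteq> E \<Longrightarrow> rk F < rk E"
  using rk_strict[of F E] ground_flat flat_subset by auto

text \<open>Intersecting a cover of F by x with B keeps x, so the rank stays above that of F and the
  intersection is the whole cover.\<close>

lemma cover_within:
  assumes "F \<in> flats" "B \<in> flats" "F \<subseteq> B" "x \<in> B - F"
  obtains G where "G \<in> flats" "insert x F \<subseteq> G" "G \<subseteq> B" "rk G = Suc (rk F)"
proof -
  obtain G where G: "G \<in> flats" "insert x F \<subseteq> G" "rk G = Suc (rk F)"
    using cover[of F x] assms flat_subset by blast
  have GB: "G \<inter> B \<in> flats" using G assms Int_flat by blast
  have "rk F < rk (G \<inter> B)" by (rule rk_strict) (use G GB assms in auto)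
  then have "G \<inter> B = G" by (intro rk_eq GB G(1)) (use G in auto)
  then show ?thesis using that G by blast
qed

lemma cover_unique:
  assumes "F \<in> flats" "G \<in> flats" "H \<in> flats" "F \<subseteq> G" "F \<subseteq> H" "x \<in> G \<inter> H - F"
    and "rk G = Suc (rk F)" "rk H = Suc (rk F)"
  shows "G = H"
proof -
  have GH: "G \<inter> H \<in> flats" using assms Int_flat by blast
  have "rk F < rk (G \<inter> H)" by (rule rk_strict) (use GH assms in auto)
  then have "G \<inter> H = G" "G \<inter> H = H" using assms GH by (intro rk_eq; auto)+
  then show ?thesis by simp
qed

definition points :: "'e set \<Rightarrow> 'e set \<Rightarrow> 'e set set" where
  "points A B = {G \<in> flats. A \<subset> G \<and> G \<subseteq> B \<and> rk G = Suc (rk A)}"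

lemma finite_points: "finite (points A B)"
  using finite_flats by (simp add: points_def)

lemma point_of:
  assumes "A \<in> flats" "B \<in> flats" "A \<subseteq> B" "x \<in> B - A"
  shows "\<exists>!G. G \<in> points A B \<and> x \<in> G"
proof -
  obtain G where G: "G \<in> flats" "insert x A \<subseteq> G" "G \<subseteq> B" "rk G = Suc (rk A)"
    using cover_within[OF assms] by blast
  show ?thesis
  proof (rule ex1I[of _ G])
    show "G \<in> points A B \<and> x \<in> G" using G assms by (auto simp: points_def)
    show "H = G" if "H \<in> points A B \<and> x \<in> H" for H
      by (rule cover_unique[of A _ _ x]) (use that G assms in \<open>auto simp: points_def\<close>)
  qed
qed

text \<open>The atoms of an interval partition \<open>B - A\<close>; this is the source of
  balancing.\<close>

lemma sum_points:
  fixes c :: "'e \<Rightarrow> real"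
  assumes "A \<in> flats" "B \<in> flats" "A \<subseteq> B"
  shows "(\<Sum>G\<in>points A B. sum c (G - A)) = sum c (B - A)"
proof -
  have "B - A = (\<Union>G\<in>points A B. G - A)"
  proof (intro equalityI subsetI)
    fix x assume "x \<in> B - A"
    then obtain G where "G \<in> points A B" "x \<in> G" using point_of[OF assms] by blast
    then show "x \<in> (\<Union>G\<in>points A B. G - A)" using \<open>x \<in> B - A\<close> by blast
  qed (auto simp: points_def)
  moreover have "\<forall>G\<in>points A B. \<forall>H\<in>points A B. G \<noteq> H \<longrightarrow> (G - A) \<inter> (H - A) = {}"
  proof (intro ballI impI, rule ccontr)
    fix G H assume GH: "G \<in> points A B" "H \<in> points A B" "G \<noteq> H" "(G - A) \<inter> (H - A) \<noteq> {}"
    then obtain x where "x \<in> G" "x \<in> H" "x \<notin> A" by auto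
    then show False using point_of[OF assms, of x] GH by (auto simp: points_def)
  qed
  ultimately show ?thesis
    using sum.UNION_disjoint[of "points A B" "\<lambda>G. G - A" c] finite_points finite_flat
    by (simp add: points_def)
qed

text \<open>Provides the nonzero terms in the positivity proofs for the Moebius function and the
  Whitney numbers.\<close>

lemma avoiding_flat:
  "F \<in> flats \<Longrightarrow> x \<in> F \<Longrightarrow> r < rk F \<Longrightarrow> \<exists>H\<in>flats. H \<subseteq> F \<and> x \<notin> H \<and> rk H = r"
proof (induction r)
  case 0
  then show ?case using empty_flat rk_empty by auto
next
  case (Suc r)
  then obtain H where H: "H \<in> flats" "H \<subseteq> F" "x \<notin> H" "rk H = r" by auto
  obtain C where C: "C \<in> flats" "insert x H \<subseteq> C" "C \<subseteq> F" "rk C = Suc (rk H)"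
    by (rule cover_within[of H F x]) (use H Suc.prems in auto)
  \<comment> \<open>C is the only cover of H through x, so a cover through an element outside C
    avoids x and has the next rank.\<close>
  have "C \<noteq> F" using C H Suc.prems by auto
  then obtain y where y: "y \<in> F" "y \<notin> C" using C by auto
  obtain C' where C': "C' \<in> flats" "insert y H \<subseteq> C'" "C' \<subseteq> F" "rk C' = Suc (rk H)"
    by (rule cover_within[of H F y]) (use Suc.prems(1) H y C in auto)
  have "x \<notin> C'" using cover_unique[of H C C' x] C C' H y by auto
  then show ?case using C' H by auto
qed

section \<open>The complex of flags and its linear functions\<close>

definition proper_flats :: "'e set set" where
  "proper_flats = {F \<in> flats. F \<noteq> {} \<and> F \<noteq> E}"

definition flags :: "'e set set set" where
  "flags = {\<sigma>. \<sigma> \<subseteq> proper_flats \<and> (\<forall>F\<in>\<sigma>. \<forall>G\<in>\<sigma>. F \<subseteq> G \<or> G \<subseteq> F)}"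

text \<open>The ray of a flat is its indicator vector modulo the all-ones vector, so linear
  functions are given by coefficients c of total zero. Values at sets that are not flats are left
  free.\<close>

definition linear_functions :: "('e set \<Rightarrow> real) set" where
  "linear_functions = {f. \<exists>c. sum c E = 0 \<and> (\<forall>F\<in>flats. f F = sum c F)}"

lemma flag_flats: "\<sigma> \<in> flags \<Longrightarrow> F \<in> \<sigma> \<Longrightarrow> F \<in> flats"
  and flag_chain: "\<sigma> \<in> flags \<Longrightarrow> F \<in> \<sigma> \<Longrightarrow> G \<in> \<sigma> \<Longrightarrow> F \<subseteq> G \<or> G \<subseteq> F"
  and flag_proper: "\<sigma> \<in> flags \<Longrightarrow> F \<in> \<sigma> \<Longrightarrow> F \<noteq> {} \<and> F \<noteq> E"
  by (auto simp: flags_def proper_flats_def)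

lemma finite_flag: "\<sigma> \<in> flags \<Longrightarrow> finite \<sigma>"
  using finite_flats by (rule finite_subset[rotated]) (auto simp: flag_flats)

lemma flag_insert:
  "\<sigma> \<in> flags \<Longrightarrow> insert G \<sigma> \<in> flags \<longleftrightarrow> G \<in> proper_flats \<and> (\<forall>F\<in>\<sigma>. F \<subseteq> G \<or> G \<subseteq> F)"
  by (auto simp: flags_def)

lemma flag_rk_inj: "\<sigma> \<in> flags \<Longrightarrow> inj_on rk \<sigma>"
proof (rule inj_onI)
  fix F G assume "\<sigma> \<in> flags" "F \<in> \<sigma>" "G \<in> \<sigma>" "rk F = rk G"
  then show "F = G" using flag_chain[of \<sigma> F G] flag_flats rk_eq[of F G] rk_eq[of G F] by auto
qed

lemma flag_rk_range: "\<sigma> \<in> flags \<Longrightarrow> F \<in> \<sigma> \<Longrightarrow> rk F \<in> {1..rk E - 1}"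
  using rk_pos[of F] rk_less_ground[of F] flag_flats[of \<sigma> F] flag_proper[of \<sigma> F] by auto

definition gaps :: "'e set set \<Rightarrow> nat set" where
  "gaps \<sigma> = {1..rk E - 1} - rk ` \<sigma>"

lemma card_gaps: "\<sigma> \<in> flags \<Longrightarrow> card \<sigma> + card (gaps \<sigma>) = rk E - 1"
proof -
  assume \<sigma>: "\<sigma> \<in> flags"
  have sub: "rk ` \<sigma> \<subseteq> {1..rk E - 1}" using flag_rk_range[OF \<sigma>] by blast
  then have "card (gaps \<sigma>) = (rk E - 1) - card \<sigma>" "card \<sigma> \<le> rk E - 1"
    using card_Diff_subset[of "rk ` \<sigma>" "{1..rk E - 1}"] card_mono[of "{1..rk E - 1}" "rk ` \<sigma>"]
      card_image[OF flag_rk_inj[OF \<sigma>]] finite_flag[OF \<sigma>]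
    by (simp_all add: gaps_def)
  then show ?thesis by simp
qed

lemma chain_greatest:
  assumes "finite S" "S \<noteq> {}" "\<forall>F\<in>S. \<forall>G\<in>S. F \<subseteq> G \<or> G \<subseteq> (F :: 'e set)"
  shows "\<exists>A\<in>S. \<forall>F\<in>S. F \<subseteq> A"
proof -
  obtain A where "A \<in> S" "\<forall>F\<in>S. A \<subseteq> F \<longrightarrow> F = A"
    using finite_has_maximal[OF assms(1,2)] by metis
  then show ?thesis using assms(3) by (intro bexI[of _ A]) auto
qed

lemma chain_least:
  assumes "finite S" "S \<noteq> {}" "\<forall>F\<in>S. \<forall>G\<in>S. F \<subseteq> G \<or> G \<subseteq> (F :: 'e set)"
  shows "\<exists>A\<in>S. \<forall>F\<in>S. A \<subseteq> F"
proof -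
  obtain A where "A \<in> S" "\<forall>F\<in>S. F \<subseteq> A \<longrightarrow> F = A"
    using finite_has_minimal[OF assms(1,2)] by metis
  then show ?thesis using assms(3) by (intro bexI[of _ A]) auto
qed

text \<open>The link of a flag splits according to the intervals between consecutive members of the
  flag with \<open>{}\<close> and E added. A and B are the neighbours that enclose the missing rank
  r.\<close>

lemma gap_bounds:
  assumes \<sigma>: "\<sigma> \<in> flags" and r: "r \<in> gaps \<sigma>"
  obtains A B where "A \<in> insert {} \<sigma>" "B \<in> insert E \<sigma>" "A \<in> flats" "B \<in> flats" "A \<subset> B"
    "rk A < r" "r < rk B" "\<forall>F\<in>\<sigma>. F \<subseteq> A \<or> B \<subseteq> F"
proof -
  have r': "0 < r" "r < rk E" "\<And>F. F \<in> \<sigma> \<Longrightarrow> rk F \<noteq> r" using r by (auto simp: gaps_def)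
  let ?L = "{F \<in> insert {} \<sigma>. rk F < r}" and ?U = "{F \<in> insert E \<sigma>. r < rk F}"
  have "\<exists>A\<in>?L. \<forall>F\<in>?L. F \<subseteq> A"
  proof (rule chain_greatest)
    have "{} \<in> ?L" using r' rk_empty by simp
    then show "?L \<noteq> {}" by blast
  qed (use finite_flag[OF \<sigma>] flag_chain[OF \<sigma>] in auto)
  moreover have "\<exists>B\<in>?U. \<forall>F\<in>?U. B \<subseteq> F"
  proof (rule chain_least)
    have "E \<in> ?U" using r' by simp
    then show "?U \<noteq> {}" by blast
    have "F \<subseteq> E" if "F \<in> \<sigma>" for F using flag_flats[OF \<sigma> that] flat_subset by blast
    then show "\<forall>F\<in>?U. \<forall>G\<in>?U. F \<subseteq> G \<or> G \<subseteq> F" using flag_chain[OF \<sigma>] by blast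
  qed (use finite_flag[OF \<sigma>] in auto)
  ultimately obtain A B where A: "A \<in> ?L" "\<forall>F\<in>?L. F \<subseteq> A"
    and B: "B \<in> ?U" "\<forall>F\<in>?U. B \<subseteq> F" by (elim bexE)
  have fl: "A \<in> flats" "B \<in> flats"
    using A(1) B(1) flag_flats[OF \<sigma>] empty_flat ground_flat by auto
  have "A \<subseteq> B \<or> B \<subseteq> A"
    using A(1) B(1) flag_chain[OF \<sigma>, of A B] fl flat_subset by blast
  moreover have "\<not> B \<subseteq> A" using rk_mono[OF fl(2,1)] A(1) B(1) by auto
  ultimately have "A \<subset> B" by auto
  have "F \<subseteq> A \<or> B \<subseteq> F" if "F \<in> \<sigma>" for F
    using bspec[OF A(2), of F] bspec[OF B(2), of F] that r'(3)[OF that] by (cases "rk F < r") auto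
  then have bd: "\<forall>F\<in>\<sigma>. F \<subseteq> A \<or> B \<subseteq> F" by blast
  show ?thesis by (rule that[of A B]) (use A(1) B(1) fl bd \<open>A \<subset> B\<close> in auto)
qed

lemma between_gaps:
  assumes \<sigma>: "\<sigma> \<in> flags" and A: "A \<in> flats" "B \<in> flats" "\<forall>F\<in>\<sigma>. F \<subseteq> A \<or> B \<subseteq> F"
    and "rk A < s" "s < rk B"
  shows "s \<in> gaps \<sigma>"
proof -
  have "rk F \<noteq> s" if "F \<in> \<sigma>" for F
    using bspec[OF A(3) that] rk_mono[of F A] rk_mono[of B F] A flag_flats[OF \<sigma> that] assms(5,6) by auto
  then show ?thesis using assms rk_le_ground[of B] by (auto simp: gaps_def)
qed

lemma linear_functions_zero: "(\<lambda>_. 0) \<in> linear_functions"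
  unfolding linear_functions_def by (rule CollectI, rule exI[of _ "\<lambda>_. 0"]) simp

lemma linear_functions_add:
  assumes "f \<in> linear_functions" "g \<in> linear_functions"
  shows "(\<lambda>G. f G + g G) \<in> linear_functions"
proof -
  obtain c d where "sum c E = 0" "\<forall>F\<in>flats. f F = sum c F" "sum d E = 0" "\<forall>F\<in>flats. g F = sum d F"
    using assms by (auto simp: linear_functions_def)
  then show ?thesis unfolding linear_functions_def
    by (intro CollectI exI[of _ "\<lambda>e. c e + d e"]) (simp add: sum.distrib)
qed

lemma linear_functions_scale:
  assumes "f \<in> linear_functions"
  shows "(\<lambda>G. k * f G) \<in> linear_functions"
proof -
  obtain c where "sum c E = 0" "\<forall>F\<in>flats. f F = sum c F"
    using assms by (auto simp: linear_functions_def)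
  then show ?thesis unfolding linear_functions_def
    by (intro CollectI exI[of _ "\<lambda>e. k * c e"]) (simp add: sum_distrib_left[symmetric])
qed

definition alpha :: "'e \<Rightarrow> 'e set \<Rightarrow> real" where
  "alpha i F = of_bool (i \<in> F)"

text \<open>Hence the class of \<alpha> does not depend on the chosen element, and proofs may switch
  to one adapted to a flag.\<close>

lemma alpha_diff_linear:
  assumes "i \<in> E" "j \<in> E"
  shows "(\<lambda>F. alpha i F - alpha j F) \<in> linear_functions"
proof -
  let ?c = "\<lambda>e. (if e = i then 1 else 0) - (if e = j then 1 else (0::real))"
  have "sum ?c F = alpha i F - alpha j F" if "finite F" for F
    using that by (simp add: sum_subtractf alpha_def)
  then show ?thesis
    using assms finite_ground finite_flat unfolding linear_functions_def
    by (intro CollectI exI[of _ ?c]) (simp add: alpha_def)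
qed

text \<open>No member of \<sigma> separates an element of \<open>G - A\<close> from one of
  \<open>B - G\<close>, but G does.\<close>

lemma flag_dual:
  assumes \<sigma>: "\<sigma> \<in> flags" and G: "G \<in> flats" and A: "A \<in> flats" "B \<in> flats" "A \<subset> G" "G \<subset> B"
    and AB: "\<forall>F\<in>\<sigma>. F \<subseteq> A \<or> B \<subseteq> F"
  obtains i j where "i \<in> G - A" "j \<in> B - G" "i \<in> E" "j \<in> E"
    "(\<lambda>F. alpha i F - alpha j F) \<in> linear_functions"
    "alpha i G - alpha j G = 1" "\<forall>F\<in>\<sigma>. alpha i F - alpha j F = 0"
proof -
  obtain i j where ij: "i \<in> G - A" "j \<in> B - G" using A by auto
  moreover have "i \<in> E" "j \<in> E" using ij G A flat_subset by blast+
  moreover have "alpha i F - alpha j F = 0" if "F \<in> \<sigma>" for F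
    using bspec[OF AB that] ij A by (auto simp: alpha_def)
  ultimately show ?thesis using that alpha_diff_linear by (auto simp: alpha_def)
qed

lemma between_flag:
  assumes \<sigma>: "\<sigma> \<in> flags" and "A \<in> flats" "B \<in> flats" "\<forall>F\<in>\<sigma>. F \<subseteq> A \<or> B \<subseteq> F"
    and "G \<in> flats" "A \<subset> G" "G \<subset> B"
  shows "G \<notin> \<sigma>" "insert G \<sigma> \<in> flags"
proof -
  show "G \<notin> \<sigma>" using bspec[OF assms(4), of G] assms by auto
  have "G \<in> proper_flats" using assms flat_subset[of B] by (auto simp: proper_flats_def)
  then show "insert G \<sigma> \<in> flags" using assms(4) assms by (auto simp: flag_insert[OF \<sigma>])
qed

lemma link_flag_between:
  assumes \<sigma>: "\<sigma> \<in> flags" and A: "A \<in> insert {} \<sigma>" "B \<in> insert E \<sigma>"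
    and G: "G \<notin> \<sigma>" "insert G \<sigma> \<in> flags" and r: "rk A < rk G" "rk G < rk B"
  shows "G \<in> flats" "A \<subset> G" "G \<subset> B"
proof -
  show Gf: "G \<in> flats" using G by (auto simp: flags_def proper_flats_def)
  have AG: "A \<subseteq> G \<or> G \<subseteq> A" "B \<subseteq> G \<or> G \<subseteq> B"
    using flag_chain[OF G(2), of A G] flag_chain[OF G(2), of B G] A flat_subset[OF Gf] by auto
  have fl: "A \<in> flats" "B \<in> flats" using A flag_flats[OF \<sigma>] empty_flat ground_flat by auto
  show "A \<subset> G" "G \<subset> B"
    using AG rk_mono[OF Gf fl(1)] rk_mono[OF fl(2) Gf] r by auto
qed

lemma link_flag_gap:
  assumes "\<sigma> \<in> flags" "G \<notin> \<sigma>" "insert G \<sigma> \<in> flags"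
  shows "rk G \<in> gaps \<sigma>"
proof -
  have "rk G \<in> {1..rk E - 1}" using flag_rk_range[OF assms(3)] by blast
  moreover have "rk G \<notin> rk ` \<sigma>" using flag_rk_inj[OF assms(3)] assms(2) by (auto simp: inj_on_def)
  ultimately show ?thesis by (simp add: gaps_def)
qed

lemma flag_extend:
  assumes \<sigma>: "\<sigma> \<in> flags" and r: "r \<in> gaps \<sigma>"
  obtains G where "G \<notin> \<sigma>" "insert G \<sigma> \<in> flags"
proof -
  obtain A B where AB: "A \<in> insert {} \<sigma>" "B \<in> insert E \<sigma>" "A \<in> flats" "B \<in> flats" "A \<subset> B"
    "rk A < r" "r < rk B" "\<forall>F\<in>\<sigma>. F \<subseteq> A \<or> B \<subseteq> F"
    by (rule gap_bounds[OF assms])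
  obtain x where "x \<in> B - A" using AB by auto
  then obtain G where G: "G \<in> flats" "insert x A \<subseteq> G" "G \<subseteq> B" "rk G = Suc (rk A)"
    using cover_within[of A B x] AB by auto
  have "A \<subset> G" "G \<subset> B" using G AB \<open>x \<in> B - A\<close> by auto
  then show ?thesis using that between_flag[OF \<sigma> AB(3,4,8) G(1)] by blast
qed

lemma interval_length2:
  assumes "A \<in> flats" "B \<in> flats" "rk B = rk A + 2"
  shows "{G \<in> flats. A \<subset> G \<and> G \<subset> B} = points A B"
proof (intro equalityI subsetI)
  fix G assume "G \<in> {G \<in> flats. A \<subset> G \<and> G \<subset> B}"
  then show "G \<in> points A B"
    using rk_strict[OF assms(1), of G] rk_strict[OF _ assms(2), of G] assms(3) by (auto simp: points_def)
next
  fix G assume "G \<in> points A B"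
  then show "G \<in> {G \<in> flats. A \<subset> G \<and> G \<subset> B}" using assms(3) by (auto simp: points_def)
qed

text \<open>A flag of codimension one leaves a single interval of rank two open, and its link
  consists of the atoms there. Summing c over the pieces \<open>G - A\<close> gives
  \<open>sum c (B - A)\<close>, which vanishes.\<close>

lemma flags_balanced:
  assumes \<sigma>: "\<sigma> \<in> flags" "Suc (card \<sigma>) = rk E - 1" and f: "f \<in> linear_functions" "\<forall>G\<in>\<sigma>. f G = 0"
  shows "(\<Sum>G\<in>{G. G \<notin> \<sigma> \<and> insert G \<sigma> \<in> flags}. f G) = 0"
proof -
  obtain c where c: "sum c E = 0" "\<And>F. F \<in> flats \<Longrightarrow> f F = sum c F"
    using f by (auto simp: linear_functions_def)
  have "card (gaps \<sigma>) = 1" using card_gaps[OF \<sigma>(1)] \<sigma>(2) by simp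
  then obtain r where r: "gaps \<sigma> = {r}" by (auto simp: card_1_singleton_iff)
  obtain A B where AB: "A \<in> insert {} \<sigma>" "B \<in> insert E \<sigma>" "A \<in> flats" "B \<in> flats" "A \<subset> B"
    "rk A < r" "r < rk B" "\<forall>F\<in>\<sigma>. F \<subseteq> A \<or> B \<subseteq> F"
    by (rule gap_bounds[OF \<sigma>(1), of r]) (use r in simp)
  have "s = r" if "rk A < s" "s < rk B" for s
    using between_gaps[OF \<sigma>(1) AB(3,4,8) that] r by simp
  from this[of "Suc (rk A)"] this[of "rk B - 1"] have rr: "r = Suc (rk A)" "rk B = rk A + 2"
    using AB by auto
  have "G \<in> flats \<and> A \<subset> G \<and> G \<subset> B" if "G \<notin> \<sigma>" "insert G \<sigma> \<in> flags" for G
    using link_flag_between[OF \<sigma>(1) AB(1,2) that] link_flag_gap[OF \<sigma>(1) that] AB(6,7) r by simp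
  then have "{G. G \<notin> \<sigma> \<and> insert G \<sigma> \<in> flags} = {G \<in> flats. A \<subset> G \<and> G \<subset> B}"
    using between_flag[OF \<sigma>(1) AB(3,4,8)] by blast
  also have "\<dots> = points A B" using interval_length2 AB rr by simp
  finally have lk: "{G. G \<notin> \<sigma> \<and> insert G \<sigma> \<in> flags} = points A B" .
  \<comment> \<open>A and B are members of \<sigma>, where f vanishes, or one of \<open>{}\<close>
    and E, where every linear function does.\<close>
  have fA: "sum c A = 0" "sum c B = 0"
    using AB(1,2) f(2) c flag_flats[OF \<sigma>(1)] by auto
  have "(\<Sum>G\<in>points A B. f G) = (\<Sum>G\<in>points A B. sum c (G - A))"
  proof (rule sum.cong[OF refl])
    fix G assume G: "G \<in> points A B"
    then have "sum c G = sum c A + sum c (G - A)"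
      using sum.subset_diff[of A G c] finite_flat by (auto simp: points_def)
    then show "f G = sum c (G - A)" using G c fA by (simp add: points_def)
  qed
  also have "\<dots> = sum c (B - A)" using sum_points AB by auto
  also have "\<dots> = 0" using sum.subset_diff[of A B c] AB fA finite_flat by auto
  finally show ?thesis by (simp add: lk)
qed

sublocale balanced_complex flags linear_functions "rk E - 1"
proof
  show "finite (\<Union>flags)"
    by (rule finite_subset[OF _ finite_flats]) (auto simp: flag_flats)
  show "\<rho> \<in> flags" if "\<sigma> \<in> flags" "\<rho> \<subseteq> \<sigma>" for \<sigma> \<rho>
  proof -
    have "\<rho> \<subseteq> proper_flats" using that by (auto simp: flags_def)
    moreover have "F \<subseteq> G \<or> G \<subseteq> F" if "F \<in> \<rho>" "G \<in> \<rho>" for F G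
      by (rule flag_chain[OF \<open>\<sigma> \<in> flags\<close>]) (use \<open>\<rho> \<subseteq> \<sigma>\<close> that in auto)
    ultimately show ?thesis by (simp add: flags_def)
  qed
  show "\<exists>G. G \<notin> \<sigma> \<and> insert G \<sigma> \<in> flags" if "\<sigma> \<in> flags" "card \<sigma> < rk E - 1" for \<sigma>
  proof -
    have "gaps \<sigma> \<noteq> {}" using card_gaps[OF that(1)] that(2) by auto
    then show ?thesis using flag_extend[OF that(1)] by blast
  qed
  show "\<exists>f\<in>linear_functions. f G = 1 \<and> (\<forall>H\<in>\<sigma> - {G}. f H = 0)" if \<sigma>: "\<sigma> \<in> flags" "G \<in> \<sigma>" for \<sigma> G
  proof -
    have \<tau>: "\<sigma> - {G} \<in> flags" "insert G (\<sigma> - {G}) \<in> flags" "G \<notin> \<sigma> - {G}"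
      using \<sigma> by (auto simp: flags_def insert_absorb)
    obtain A B where AB: "A \<in> insert {} (\<sigma> - {G})" "B \<in> insert E (\<sigma> - {G})" "A \<in> flats" "B \<in> flats"
      "rk A < rk G" "rk G < rk B" "\<forall>F\<in>\<sigma> - {G}. F \<subseteq> A \<or> B \<subseteq> F"
      by (rule gap_bounds[OF \<tau>(1) link_flag_gap[OF \<tau>(1,3,2)]])
    note lf = link_flag_between[OF \<tau>(1) AB(1,2) \<tau>(3,2) AB(5,6)]
    obtain i j where ij: "(\<lambda>F. alpha i F - alpha j F) \<in> linear_functions" "alpha i G - alpha j G = 1"
      "\<forall>F\<in>\<sigma> - {G}. alpha i F - alpha j F = 0"
      by (rule flag_dual[OF \<tau>(1) lf(1) AB(3,4) lf(2,3) AB(7)])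
    show ?thesis by (rule bexI[OF _ ij(1)]) (use ij(2,3) in auto)
  qed
qed (use flags_balanced linear_functions_zero linear_functions_add linear_functions_scale in auto)

lemma link_flat: "G \<in> lk \<sigma> \<Longrightarrow> G \<in> flats"
  and link_proper: "G \<in> lk \<sigma> \<Longrightarrow> G \<noteq> {} \<and> G \<noteq> E"
  using flag_flats[of "insert G \<sigma>" G] flag_proper[of "insert G \<sigma>" G] by (auto dest: lk_face)

lemma link_comparable: "G \<in> lk \<sigma> \<Longrightarrow> F \<in> \<sigma> \<Longrightarrow> F \<subset> G \<or> G \<subset> F"
  using flag_chain[of "insert G \<sigma>" F G] lk_face[of G \<sigma>] lk_notin[of G \<sigma>] by auto

lemma link_between:
  assumes "\<sigma> \<in> flags" "A \<in> insert {} \<sigma>" "B \<in> insert E \<sigma>" "G \<in> lk \<sigma>" "rk A < rk G" "rk G < rk B"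
  shows "A \<subset> G" "G \<subset> B"
  using link_flag_between[OF assms(1-3) _ _ assms(5,6)] lk_face lk_notin assms(4) by auto

lemma between_link:
  assumes "\<sigma> \<in> flags" "A \<in> flats" "B \<in> flats" "\<forall>F\<in>\<sigma>. F \<subseteq> A \<or> B \<subseteq> F"
    and "G \<in> flats" "A \<subset> G" "G \<subset> B"
  shows "G \<in> lk \<sigma>"
  using between_flag[OF assms] by (simp add: lk_def)

lemma link_gap: "\<sigma> \<in> flags \<Longrightarrow> G \<in> lk \<sigma> \<Longrightarrow> rk G \<in> gaps \<sigma>"
  using link_flag_gap by (simp add: lk_def)

lemma link_adjacent:
  assumes "\<sigma> \<in> flags" "G \<in> lk \<sigma>"
  shows "H \<in> lk (insert G \<sigma>) \<longleftrightarrow> H \<in> lk \<sigma> \<and> (H \<subset> G \<or> G \<subset> H)"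
proof
  assume "H \<in> lk (insert G \<sigma>)"
  then show "H \<in> lk \<sigma> \<and> (H \<subset> G \<or> G \<subset> H)"
    using lk_insert_subset link_comparable[of H "insert G \<sigma>" G] by auto
next
  assume H: "H \<in> lk \<sigma> \<and> (H \<subset> G \<or> G \<subset> H)"
  then have "insert H (insert G \<sigma>) \<in> flags"
    using lk_face[OF assms(2)] lk_face[of H \<sigma>] flag_insert[of "insert G \<sigma>" H] flag_insert[OF assms(1), of H]
    by auto
  then show "H \<in> lk (insert G \<sigma>)" using H by (auto simp: lk_def)
qed

end

section \<open>Connectedness of links\<close>

context flat_lattice begin

text \<open>Incomparable G and H lie in the same interval of \<sigma>. If its rank exceeds two, walk
  from G down to an atom p, up to the join of p and an atom q below H, then via q to H. If its rank
  is two, another rank is missing from \<sigma> outside the interval, and a flat inserted there is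
  comparable with both.\<close>

lemma flags_link_connected:
  fixes z :: "'e set \<Rightarrow> real"
  assumes \<sigma>: "\<sigma> \<in> flags" "card \<sigma> + 2 \<le> rk E - 1"
    and z: "\<And>G H. G \<in> lk \<sigma> \<Longrightarrow> H \<in> lk (insert G \<sigma>) \<Longrightarrow> z G = z H"
    and GH: "G \<in> lk \<sigma>" "H \<in> lk \<sigma>"
  shows "z G = z H"
proof (cases "G \<subseteq> H \<or> H \<subseteq> G")
  case True
  then show ?thesis using z[OF GH(1), of H] link_adjacent[OF \<sigma>(1) GH(1), of H] GH by auto
next
  case incomparable: False
  have zc: "z F = z K" if "F \<in> lk \<sigma>" "K \<in> lk \<sigma>" "F \<subseteq> K \<or> K \<subseteq> F" for F K
    using z[OF that(1), of K] link_adjacent[OF \<sigma>(1) that(1), of K] that by auto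
  note G = link_flat[OF GH(1)] and H = link_flat[OF GH(2)]
  obtain A B where AB: "A \<in> insert {} \<sigma>" "B \<in> insert E \<sigma>" "A \<in> flats" "B \<in> flats" "A \<subset> B"
    "rk A < rk G" "rk G < rk B" "\<forall>F\<in>\<sigma>. F \<subseteq> A \<or> B \<subseteq> F"
    by (rule gap_bounds[OF \<sigma>(1) link_gap[OF \<sigma>(1) GH(1)]])
  have AG: "A \<subset> G" "G \<subset> B" using link_between[OF \<sigma>(1) AB(1,2) GH(1) AB(6,7)] by auto
  have AH: "A \<subset> H" "H \<subset> B"
  proof -
    have "A \<subset> H \<or> H \<subset> A" using AB(1) link_comparable[OF GH(2), of A] link_proper[OF GH(2)] by auto
    then show "A \<subset> H" using incomparable AG by auto
    have "B \<subset> H \<or> H \<subset> B"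
      using AB(2) link_comparable[OF GH(2), of B] link_proper[OF GH(2)] flat_subset[OF H] by auto
    then show "H \<subset> B" using incomparable AG by auto
  qed
  have between: "F \<in> lk \<sigma>" if "F \<in> flats" "A \<subset> F" "F \<subset> B" for F
    by (rule between_link[OF \<sigma>(1) AB(3,4,8) that])
  show ?thesis
  proof (cases "rk A + 2 < rk B")
    case True
    obtain x where x: "x \<in> G - A" using AG by auto
    obtain y where y: "y \<in> H - A" using AH by auto
    obtain p where p: "p \<in> flats" "insert x A \<subseteq> p" "p \<subseteq> G" "rk p = Suc (rk A)"
      by (rule cover_within[of A G x]) (use AB(3-7) G AG x in auto)
    obtain q where q: "q \<in> flats" "insert y A \<subseteq> q" "q \<subseteq> H" "rk q = Suc (rk A)"
      by (rule cover_within[of A H y]) (use AB(3-7) H AH y in auto)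
    have plk: "p \<in> lk \<sigma>" using x p AG by (intro between) auto
    have qlk: "q \<in> lk \<sigma>" using y q AH by (intro between) auto
    have "z p = z q"
    proof (cases "y \<in> p")
      case True
      then have "p = q" using cover_unique[of A p q y] p q y AB(3-7) by auto
      then show ?thesis by simp
    next
      case False
      obtain K where K: "K \<in> flats" "insert y p \<subseteq> K" "K \<subseteq> B" "rk K = Suc (rk p)"
        by (rule cover_within[of p B y]) (use p AB(3-7) AG AH y False in auto)
      have Kq: "K \<inter> q \<in> flats" using K q Int_flat by blast
      have "rk A < rk (K \<inter> q)" by (rule rk_strict) (use AB(3-7) Kq K p q y in auto)
      then have "K \<inter> q = q" using Kq q by (intro rk_eq) auto
      then have "q \<subseteq> K" by auto
      moreover have "K \<in> lk \<sigma>"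
        by (rule between) (use K p q AB(3-7) x True in auto)
      ultimately show ?thesis using zc[OF plk, of K] zc[OF qlk, of K] K by auto
    qed
    then show ?thesis using zc[OF GH(1) plk] zc[OF GH(2) qlk] p q by auto
  next
    case False
    have rG: "rk G = Suc (rk A)" "rk B = rk A + 2"
      using rk_strict[OF AB(3) G AG(1)] rk_strict[OF G AB(4) AG(2)] False by auto
    have "card (gaps \<sigma>) \<ge> 2" using card_gaps[OF \<sigma>(1)] \<sigma>(2) by simp
    then have "gaps \<sigma> \<noteq> {} \<and> gaps \<sigma> \<noteq> {rk G}" by auto
    then obtain s where s: "s \<in> gaps \<sigma>" "s \<noteq> rk G" by auto
    obtain A' B' where AB': "A' \<in> insert {} \<sigma>" "B' \<in> insert E \<sigma>" "A' \<in> flats" "B' \<in> flats" "A' \<subset> B'"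
      "rk A' < s" "s < rk B'" "\<forall>F\<in>\<sigma>. F \<subseteq> A' \<or> B' \<subseteq> F"
      by (rule gap_bounds[OF \<sigma>(1) s(1)])
    obtain x where x: "x \<in> B' - A'" using AB' by auto
    obtain K where K: "K \<in> flats" "insert x A' \<subseteq> K" "K \<subseteq> B'" "rk K = Suc (rk A')"
      by (rule cover_within[of A' B' x]) (use AB'(3-7) x in auto)
    have Klk: "K \<in> lk \<sigma>"
      by (rule between_link[OF \<sigma>(1) AB'(3,4,8) K(1)]) (use K x AB'(3-7) in auto)
    have "s \<noteq> rk A" "s \<noteq> rk B"
      using s(1) AB(1,2) rk_empty by (auto simp: gaps_def)
    then consider "s < rk A" | "rk B < s" using s(2) rG by linarith
    then have "K \<subseteq> A \<or> B \<subseteq> K"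
    proof cases
      case 1
      then have "A \<in> \<sigma>" using AB(1) rk_empty by auto
      moreover have "\<not> A \<subseteq> A'" using 1 AB'(3-7) rk_mono[OF AB(3) AB'(3)] by auto
      ultimately have "B' \<subseteq> A" using AB'(8) by auto
      then show ?thesis using K by auto
    next
      case 2
      have "rk B < rk E" using 2 s(1) by (auto simp: gaps_def)
      then have "B \<in> \<sigma>" using AB(2) by auto
      moreover have "\<not> B' \<subseteq> B" using 2 AB'(3-7) rk_mono[OF AB'(4) AB(4)] by auto
      ultimately have "B \<subseteq> A'" using AB'(8) by auto
      then show ?thesis using K by auto
    qed
    then have "K \<subseteq> G \<and> K \<subseteq> H \<or> G \<subseteq> K \<and> H \<subseteq> K" using AG AH by auto
    then show ?thesis using zc[OF GH(1) Klk] zc[OF GH(2) Klk] by auto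
  qed
qed

section \<open>The quadratic forms at flags of codimension two\<close>

lemma alpha_dual_sum:
  assumes \<sigma>: "\<sigma> \<in> flags" and G: "G \<in> flats" and A: "A \<in> flats" "B \<in> flats" "A \<subset> G" "G \<subset> B"
    and AB: "\<forall>F\<in>\<sigma>. F \<subseteq> A \<or> B \<subseteq> F"
    and k: "\<And>i j. i \<in> G - A \<Longrightarrow> j \<in> B - G \<Longrightarrow> (\<Sum>H\<in>S. alpha i H - alpha j H) = k"
  shows "\<exists>f\<in>linear_functions. f G = 1 \<and> (\<forall>H\<in>\<sigma>. f H = 0) \<and> (\<Sum>H\<in>S. f H) = k"
proof -
  obtain i j where ij: "i \<in> G - A" "j \<in> B - G" "(\<lambda>F. alpha i F - alpha j F) \<in> linear_functions"
      "alpha i G - alpha j G = 1" "\<forall>F\<in>\<sigma>. alpha i F - alpha j F = 0"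
    by (rule flag_dual[OF \<sigma> G A AB])
  show ?thesis by (rule bexI[OF _ ij(3)]) (use ij k in auto)
qed

text \<open>The link is complete bipartite between the atoms of the two intervals, and all
  self-intersections vanish, because the elements i and j of a dual function lie in all or in none
  of the flats on the other side. The form is twice the product of the two coordinate sums.\<close>

lemma two_gaps_nonpos:
  assumes \<sigma>: "\<sigma> \<in> flags" "card \<sigma> + 2 = rk E - 1"
    and A: "A \<in> flats" "B \<in> flats" "A \<subset> B" "\<forall>F\<in>\<sigma>. F \<subseteq> A \<or> B \<subseteq> F"
    and C: "C \<in> flats" "D \<in> flats" "C \<subset> D" "\<forall>F\<in>\<sigma>. F \<subseteq> C \<or> D \<subseteq> F"
    and BC: "B \<subseteq> C" and lk: "lk \<sigma> = points A B \<union> points C D"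
    and rks: "rk B = rk A + 2" "rk D = rk C + 2"
    and x: "\<forall>H\<in>\<sigma>. x H = 0" "(\<Sum>G\<in>points A B. x G) = 0"
  shows "mixed [x, x] \<sigma> \<le> 0"
proof -
  have P: "G \<in> flats" "A \<subset> G" "G \<subset> B" if "G \<in> points A B" for G
    using that rks by (auto simp: points_def)
  have L: "G \<in> flats" "C \<subset> G" "G \<subset> D" if "G \<in> points C D" for G
    using that rks by (auto simp: points_def)
  have lkP: "lk (insert G \<sigma>) = points C D" if G: "G \<in> points A B" for G
  proof -
    have "G \<in> lk \<sigma>" using G lk by simp
    moreover have "H \<subset> G \<or> G \<subset> H" if "H \<in> points C D" for H using P[OF G] L[OF that] BC by auto
    moreover have "\<not> (H \<subset> G \<or> G \<subset> H)" if "H \<in> points A B" for H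
      using rk_strict[of H G] rk_strict[of G H] G that by (auto simp: points_def)
    ultimately show ?thesis using link_adjacent[OF \<sigma>(1), of G] lk by auto
  qed
  have lkL: "lk (insert G \<sigma>) = points A B" if G: "G \<in> points C D" for G
  proof -
    have "G \<in> lk \<sigma>" using G lk by simp
    moreover have "H \<subset> G \<or> G \<subset> H" if "H \<in> points A B" for H using L[OF G] P[OF that] BC by auto
    moreover have "\<not> (H \<subset> G \<or> G \<subset> H)" if "H \<in> points C D" for H
      using rk_strict[of H G] rk_strict[of G H] G that by (auto simp: points_def)
    ultimately show ?thesis using link_adjacent[OF \<sigma>(1), of G] lk by auto
  qed
  have "mixed [x, x] \<sigma> = (\<Sum>G\<in>lk \<sigma>. x G * ((\<Sum>H\<in>lk (insert G \<sigma>). x H) - 0 * x G))"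
  proof (rule mixed_codim2[OF \<sigma> x(1)])
    fix G assume "G \<in> lk \<sigma>"
    then consider "G \<in> points A B" | "G \<in> points C D" using lk by auto
    then show "\<exists>f\<in>linear_functions. f G = 1 \<and> (\<forall>H\<in>\<sigma>. f H = 0) \<and> (\<Sum>H\<in>lk (insert G \<sigma>). f H) = 0"
    proof cases
      case 1
      show ?thesis unfolding lkP[OF 1]
      proof (rule alpha_dual_sum[OF \<sigma>(1) P(1)[OF 1] A(1,2) P(2,3)[OF 1] A(4)])
        fix i j assume ij: "i \<in> G - A" "j \<in> B - G"
        have "i \<in> H" "j \<in> H" if "H \<in> points C D" for H using ij L[OF that] P[OF 1] BC by auto
        then show "(\<Sum>H\<in>points C D. alpha i H - alpha j H) = 0" by (simp add: alpha_def)
      qed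
    next
      case 2
      show ?thesis unfolding lkL[OF 2]
      proof (rule alpha_dual_sum[OF \<sigma>(1) L(1)[OF 2] C(1,2) L(2,3)[OF 2] C(4)])
        fix i j assume ij: "i \<in> G - C" "j \<in> D - G"
        have "i \<notin> H" "j \<notin> H" if "H \<in> points A B" for H using ij P[OF that] L[OF 2] BC by auto
        then show "(\<Sum>H\<in>points A B. alpha i H - alpha j H) = 0" by (simp add: alpha_def)
      qed
    qed
  qed
  also have "\<dots> = (\<Sum>G\<in>points A B. x G * (\<Sum>H\<in>points C D. x H)) + (\<Sum>G\<in>points C D. x G * (\<Sum>H\<in>points A B. x H))"
  proof -
    have "points A B \<inter> points C D = {}" using P L BC by fastforce
    then show ?thesis unfolding lk by (subst sum.union_disjoint) (auto simp: finite_points lkP lkL)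
  qed
  also have "\<dots> = 0" using x(2) by (simp add: sum_distrib_right[symmetric])
  finally show ?thesis by simp
qed

text \<open>Distinct points meet in A only, so a line through both is a cover of p by an element y
  of \<open>q - A\<close>; such a cover is unique, and it contains q because q is an atom.\<close>

lemma card_lines_through_pair:
  assumes A: "A \<in> flats" "B \<in> flats" "rk B = rk A + 3" and pq: "p \<in> points A B" "q \<in> points A B" "p \<noteq> q"
  shows "card {l \<in> flats. A \<subset> l \<and> l \<subset> B \<and> rk l = rk A + 2 \<and> p \<subset> l \<and> q \<subset> l} = 1"
proof -
  have p: "p \<in> flats" "A \<subset> p" "p \<subseteq> B" "rk p = Suc (rk A)" and q: "q \<in> flats" "A \<subset> q" "q \<subseteq> B" "rk q = Suc (rk A)"
    using pq by (auto simp: points_def)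
  have pIq: "p \<inter> q = A"
  proof (rule ccontr)
    assume "p \<inter> q \<noteq> A"
    have I: "p \<inter> q \<in> flats" using p(1) q(1) by (rule Int_flat)
    have "rk A < rk (p \<inter> q)" using p(2) q(2) \<open>p \<inter> q \<noteq> A\<close> by (intro rk_strict A(1) I) auto
    then have "p \<inter> q = p" using p(4) by (intro rk_eq I p(1)) auto
    then have "p = q" using p(4) q(4) by (intro rk_eq p(1) q(1)) auto
    then show False using pq(3) by simp
  qed
  obtain y where y: "y \<in> q - A" using q by auto
  obtain K where K: "K \<in> flats" "insert y p \<subseteq> K" "K \<subseteq> B" "rk K = Suc (rk p)"
    by (rule cover_within[of p B y]) (use p q A y pIq in auto)
  have Kq: "K \<inter> q \<in> flats" using K q Int_flat by blast
  have "rk A < rk (K \<inter> q)" by (rule rk_strict) (use A Kq K p q y in auto)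
  then have "K \<inter> q = q" using Kq q by (intro rk_eq) auto
  then have qK: "q \<subset> K" using K p q by auto
  have "{l \<in> flats. A \<subset> l \<and> l \<subset> B \<and> rk l = rk A + 2 \<and> p \<subset> l \<and> q \<subset> l} = {K}"
  proof (intro equalityI subsetI)
    fix l assume "l \<in> {l \<in> flats. A \<subset> l \<and> l \<subset> B \<and> rk l = rk A + 2 \<and> p \<subset> l \<and> q \<subset> l}"
    then show "l \<in> {K}" using cover_unique[of p l K y] p K y q pIq by auto
  next
    fix l assume "l \<in> {K}"
    then show "l \<in> {l \<in> flats. A \<subset> l \<and> l \<subset> B \<and> rk l = rk A + 2 \<and> p \<subset> l \<and> q \<subset> l}"
      using K p qK A by auto
  qed
  then show ?thesis by simp
qed

text \<open>
  For the points \<open>p\<close> and lines \<open>l\<close> of a rank three interval the form is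
  \<open>(\<Sum>\<^sub>p x\<^sub>p)\<^sup>2 - \<Sum>\<^sub>l (x\<^sub>l - \<Sum>\<^sub>p\<^sub>\<subset>\<^sub>l x\<^sub>p)\<^sup>2\<close>, since any two points lie on exactly one line.
\<close>

lemma rank3_gap_nonpos:
  assumes \<sigma>: "\<sigma> \<in> flags" "card \<sigma> + 2 = rk E - 1"
    and A: "A \<in> flats" "B \<in> flats" "A \<subset> B" "\<forall>F\<in>\<sigma>. F \<subseteq> A \<or> B \<subseteq> F"
    and L_def: "L = {l \<in> flats. A \<subset> l \<and> l \<subset> B \<and> rk l = rk A + 2}"
    and lk: "lk \<sigma> = points A B \<union> L" and rks: "rk B = rk A + 3"
    and x: "\<forall>H\<in>\<sigma>. x H = 0" "(\<Sum>G\<in>points A B. x G) = 0"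
  shows "mixed [x, x] \<sigma> \<le> 0"
proof -
  define P where "P = points A B"
  have P: "p \<in> flats" "A \<subset> p" "p \<subset> B" "rk p = Suc (rk A)" if "p \<in> P" for p
    using that rks by (auto simp: P_def points_def)
  have L: "l \<in> flats" "A \<subset> l" "l \<subset> B" "rk l = rk A + 2" if "l \<in> L" for l
    using that rks by (auto simp: L_def)
  have fin: "finite P" "finite L" using finite_points finite_flats by (auto simp: P_def L_def)
  have lkPL: "lk \<sigma> = P \<union> L" using lk P_def by simp
  have disj: "P \<inter> L = {}" using P(4) L(4) by fastforce
  have lkP: "lk (insert p \<sigma>) = {l \<in> L. p \<subset> l}" if p: "p \<in> P" for p
  proof -
    have "p \<in> lk \<sigma>" using p lkPL by simp
    moreover have "\<not> (H \<subset> p \<or> p \<subset> H)" if "H \<in> P" for H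
      using rk_strict[of H p] rk_strict[of p H] P[OF that] P[OF p] by auto
    moreover have "\<not> H \<subset> p" if "H \<in> L" for H using rk_strict[of H p] L[OF that] P[OF p] by auto
    ultimately show ?thesis using link_adjacent[OF \<sigma>(1), of p] lkPL by auto
  qed
  have lkL: "lk (insert l \<sigma>) = {p \<in> P. p \<subset> l}" if l: "l \<in> L" for l
  proof -
    have "l \<in> lk \<sigma>" using l lkPL by simp
    moreover have "\<not> (H \<subset> l \<or> l \<subset> H)" if "H \<in> L" for H
      using rk_strict[of H l] rk_strict[of l H] L[OF that] L[OF l] by auto
    moreover have "\<not> l \<subset> H" if "H \<in> P" for H using rk_strict[of l H] P[OF that] L[OF l] by auto
    ultimately show ?thesis using link_adjacent[OF \<sigma>(1), of l] lkPL by auto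
  qed
  define m where "m p = real (card {l \<in> L. p \<subset> l})" for p
  \<comment> \<open>For a dual function \<open>alpha i - alpha j\<close> at a point G, every line
    through G contains i and exactly one contains j, which leaves m - 1. At a line G exactly one of
    its points contains i and none contains j, which leaves 1.\<close>
  define k where "k G = (if G \<in> P then m G - 1 else 1)" for G
  have "mixed [x, x] \<sigma> = (\<Sum>G\<in>lk \<sigma>. x G * ((\<Sum>H\<in>lk (insert G \<sigma>). x H) - k G * x G))"
  proof (rule mixed_codim2[OF \<sigma> x(1)])
    fix G assume "G \<in> lk \<sigma>"
    then consider "G \<in> P" | "G \<in> L" using lkPL by auto
    then show "\<exists>f\<in>linear_functions. f G = 1 \<and> (\<forall>H\<in>\<sigma>. f H = 0) \<and> (\<Sum>H\<in>lk (insert G \<sigma>). f H) = k G"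
    proof cases
      case 1
      show ?thesis unfolding lkP[OF 1]
      proof (rule alpha_dual_sum[OF \<sigma>(1) P(1)[OF 1] A(1,2) P(2,3)[OF 1] A(4)])
        fix i j assume ij: "i \<in> G - A" "j \<in> B - G"
        obtain K where K: "K \<in> flats" "insert j G \<subseteq> K" "K \<subseteq> B" "rk K = Suc (rk G)"
          by (rule cover_within[of G B j]) (use P[OF 1] A ij in auto)
        have KL: "K \<in> {l \<in> L. G \<subset> l}" using K ij P[OF 1] rks by (auto simp: L_def)
        have uniq: "l = K" if "l \<in> {l \<in> L. G \<subset> l}" "j \<in> l" for l
          using cover_unique[of G l K j] P[OF 1] K L[of l] ij that by auto
        have "(\<Sum>H\<in>{l \<in> L. G \<subset> l}. alpha i H - alpha j H) = (\<Sum>H\<in>{l \<in> L. G \<subset> l}. 1 - (if H = K then 1 else 0))"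
        proof (rule sum.cong[OF refl])
          fix H assume H: "H \<in> {l \<in> L. G \<subset> l}"
          then have "j \<in> H \<longleftrightarrow> H = K" using uniq[OF H] K by auto
          then show "alpha i H - alpha j H = 1 - (if H = K then 1 else 0)" using H ij by (auto simp: alpha_def)
        qed
        also have "\<dots> = m G - 1" using KL fin by (simp add: sum_subtractf m_def)
        finally show "(\<Sum>H\<in>{l \<in> L. G \<subset> l}. alpha i H - alpha j H) = k G" using 1 by (simp add: k_def)
      qed
    next
      case 2
      show ?thesis unfolding lkL[OF 2]
      proof (rule alpha_dual_sum[OF \<sigma>(1) L(1)[OF 2] A(1,2) L(2,3)[OF 2] A(4)])
        fix i j assume ij: "i \<in> G - A" "j \<in> B - G"
        obtain K where K: "K \<in> flats" "insert i A \<subseteq> K" "K \<subseteq> G" "rk K = Suc (rk A)"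
          by (rule cover_within[of A G i]) (use L[OF 2] A ij in auto)
        have "K \<noteq> G" using K L[OF 2] by auto
        then have KP: "K \<in> {p \<in> P. p \<subset> G}" using K ij L[OF 2] by (auto simp: P_def points_def)
        have uniq: "p = K" if "p \<in> {p \<in> P. p \<subset> G}" "i \<in> p" for p
          using cover_unique[of A p K i] A K P[of p] ij that by auto
        have "(\<Sum>H\<in>{p \<in> P. p \<subset> G}. alpha i H - alpha j H) = (\<Sum>H\<in>{p \<in> P. p \<subset> G}. if H = K then 1 else 0)"
        proof (rule sum.cong[OF refl])
          fix H assume H: "H \<in> {p \<in> P. p \<subset> G}"
          then have "i \<in> H \<longleftrightarrow> H = K" using uniq[OF H] K by auto
          then show "alpha i H - alpha j H = (if H = K then 1 else 0)" using H ij by (auto simp: alpha_def)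
        qed
        also have "\<dots> = 1" using KP fin by simp
        finally show "(\<Sum>H\<in>{p \<in> P. p \<subset> G}. alpha i H - alpha j H) = k G" using 2 disj by (auto simp: k_def)
      qed
    qed
  qed
  also have "\<dots> = (\<Sum>p\<in>P. x p * ((\<Sum>l\<in>{l \<in> L. p \<subset> l}. x l) - (m p - 1) * x p))
      + (\<Sum>l\<in>L. x l * ((\<Sum>p\<in>{p \<in> P. p \<subset> l}. x p) - x l))"
  proof -
    have "k l = 1" if "l \<in> L" for l using that disj by (auto simp: k_def)
    then show ?thesis unfolding lkPL using disj fin
      by (subst sum.union_disjoint) (auto simp: lkP lkL k_def cong: sum.cong)
  qed
  also have "\<dots> = (\<Sum>p\<in>P. \<Sum>l\<in>{l \<in> L. p \<subset> l}. x p * x l) - (\<Sum>p\<in>P. (m p - 1) * (x p)\<^sup>2)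
      + (\<Sum>l\<in>L. x l * (\<Sum>p\<in>{p \<in> P. p \<subset> l}. x p)) - (\<Sum>l\<in>L. (x l)\<^sup>2)"
    by (simp add: right_diff_distrib sum_subtractf sum_distrib_left power2_eq_square mult.left_commute)
  also have "(\<Sum>p\<in>P. \<Sum>l\<in>{l \<in> L. p \<subset> l}. x p * x l) = (\<Sum>l\<in>L. x l * (\<Sum>p\<in>{p \<in> P. p \<subset> l}. x p))"
    by (subst sum.swap_restrict[OF fin]) (simp add: sum_distrib_left mult.commute)
  \<comment> \<open>In the expanded squares a pair of distinct points occurs for one line and a
    point with itself for \<open>m p\<close> lines. So the right side exceeds the left by the square
    of the total sum, which is zero.\<close>
  also have "(\<Sum>p\<in>P. (m p - 1) * (x p)\<^sup>2) = (\<Sum>l\<in>L. (\<Sum>p\<in>{p \<in> P. p \<subset> l}. x p)\<^sup>2)"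
  proof -
    have "(\<Sum>l\<in>L. (\<Sum>p\<in>{p \<in> P. p \<subset> l}. x p)\<^sup>2)
        = (\<Sum>l\<in>L. \<Sum>p\<in>{p \<in> P. p \<subset> l}. \<Sum>q\<in>{q \<in> P. q \<subset> l}. x p * x q)"
      by (simp add: power2_eq_square sum_product)
    also have "\<dots> = (\<Sum>p\<in>P. \<Sum>l\<in>{l \<in> L. p \<subset> l}. \<Sum>q\<in>{q \<in> P. q \<subset> l}. x p * x q)"
      by (rule sum.swap_restrict[OF fin(2,1)])
    also have "\<dots> = (\<Sum>p\<in>P. \<Sum>q\<in>P. \<Sum>l\<in>{l \<in> {l \<in> L. p \<subset> l}. q \<subset> l}. x p * x q)"
      by (intro sum.cong refl sum.swap_restrict) (use fin in auto)
    also have "\<dots> = (\<Sum>p\<in>P. \<Sum>q\<in>P. x p * x q + (if q = p then (m p - 1) * (x p)\<^sup>2 else 0))"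
    proof (intro sum.cong refl)
      fix p q assume pq: "p \<in> P" "q \<in> P"
      show "(\<Sum>l\<in>{l \<in> {l \<in> L. p \<subset> l}. q \<subset> l}. x p * x q)
          = x p * x q + (if q = p then (m p - 1) * (x p)\<^sup>2 else 0)"
      proof (cases "q = p")
        case True
        then show ?thesis by (simp add: m_def power2_eq_square algebra_simps)
      next
        case False
        have "{l \<in> {l \<in> L. p \<subset> l}. q \<subset> l}
            = {l \<in> flats. A \<subset> l \<and> l \<subset> B \<and> rk l = rk A + 2 \<and> p \<subset> l \<and> q \<subset> l}" by (auto simp: L_def)
        then have "card {l \<in> {l \<in> L. p \<subset> l}. q \<subset> l} = 1"
          using card_lines_through_pair[OF A(1,2) rks, of p q] pq False by (simp add: P_def)
        then show ?thesis using False by simp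
      qed
    qed
    also have "\<dots> = (\<Sum>p\<in>P. x p * (\<Sum>q\<in>P. x q)) + (\<Sum>p\<in>P. (m p - 1) * (x p)\<^sup>2)"
      using fin by (simp add: sum.distrib sum_distrib_left)
    also have "(\<Sum>p\<in>P. x p * (\<Sum>q\<in>P. x q)) = 0" using x(2) by (simp add: P_def)
    finally show ?thesis by simp
  qed
  also have "(\<Sum>l\<in>L. x l * (\<Sum>p\<in>{p \<in> P. p \<subset> l}. x p)) - (\<Sum>l\<in>L. (\<Sum>p\<in>{p \<in> P. p \<subset> l}. x p)\<^sup>2)
      + (\<Sum>l\<in>L. x l * (\<Sum>p\<in>{p \<in> P. p \<subset> l}. x p)) - (\<Sum>l\<in>L. (x l)\<^sup>2)
      = - (\<Sum>l\<in>L. (x l - (\<Sum>p\<in>{p \<in> P. p \<subset> l}. x p))\<^sup>2)"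
    by (simp add: power2_diff sum.distrib sum_subtractf sum_distrib_left mult.assoc)
  also have "\<dots> \<le> 0" by (simp add: sum_nonneg)
  finally show ?thesis .
qed

text \<open>Two ranks r < s are missing. They fall either into one interval of rank three or into
  two separate intervals of rank two, which are the two forms computed above.\<close>

lemma flags_reverse_cs_codim2:
  assumes \<sigma>: "\<sigma> \<in> flags" "card \<sigma> + 2 = rk E - 1"
  shows "reverse_cs (\<lambda>x y. mixed [x, y] \<sigma>)"
proof -
  have "card (gaps \<sigma>) = 2" using card_gaps[OF \<sigma>(1)] \<sigma>(2) by simp
  then obtain r s where rs: "gaps \<sigma> = {r, s}" "r < s"
    by (metis card_2_iff insert_commute linorder_neqE_nat)
  obtain A B where AB: "A \<in> insert {} \<sigma>" "B \<in> insert E \<sigma>" "A \<in> flats" "B \<in> flats" "A \<subset> B"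
    "rk A < r" "r < rk B" "\<forall>F\<in>\<sigma>. F \<subseteq> A \<or> B \<subseteq> F"
    by (rule gap_bounds[OF \<sigma>(1), of r]) (use rs in auto)
  have inAB: "t = r \<or> t = s" if "rk A < t" "t < rk B" for t
    using between_gaps[OF \<sigma>(1) AB(3,4,8) that] rs by simp
  have rA: "r = Suc (rk A)" using inAB[of "Suc (rk A)"] AB(6,7) rs(2) by auto
  have G: "rk G = r \<or> rk G = s" if "G \<in> lk \<sigma>" for G using link_gap[OF \<sigma>(1) that] rs by simp
  have memAB: "G \<in> lk \<sigma>" if "G \<in> flats" "A \<subset> G" "G \<subset> B" for G
    by (rule between_link[OF \<sigma>(1) AB(3,4,8) that])
  show ?thesis
  proof (cases "s < rk B")
    case True
    have ss: "s = Suc r" using inAB[of "Suc r"] True rs(2) rA by auto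
    have rB: "rk B = rk A + 3" using inAB[of "rk B - 1"] True ss rA AB(6,7) by presburger
    define L where "L = {l \<in> flats. A \<subset> l \<and> l \<subset> B \<and> rk l = rk A + 2}"
    have lk: "lk \<sigma> = points A B \<union> L"
    proof (intro equalityI subsetI)
      fix G assume g: "G \<in> lk \<sigma>"
      have "A \<subset> G" "G \<subset> B"
        using link_between[OF \<sigma>(1) AB(1,2) g] G[OF g] rA ss rB by auto
      then show "G \<in> points A B \<union> L" using G[OF g] link_flat[OF g] rA ss by (auto simp: points_def L_def)
    next
      fix G assume "G \<in> points A B \<union> L"
      then show "G \<in> lk \<sigma>" using rB by (intro memAB) (auto simp: points_def L_def)
    qed
    show ?thesis
      by (rule reverse_cs_codim2I[OF \<sigma>, of "points A B"])
        (rule rank3_gap_nonpos[OF \<sigma> AB(3,4,5,8) L_def lk rB])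
  next
    case False
    have rB: "rk B = rk A + 2" using inAB[of "rk B - 1"] False rs(2) rA AB(6,7) by presburger
    obtain C D where CD: "C \<in> insert {} \<sigma>" "D \<in> insert E \<sigma>" "C \<in> flats" "D \<in> flats" "C \<subset> D"
      "rk C < s" "s < rk D" "\<forall>F\<in>\<sigma>. F \<subseteq> C \<or> D \<subseteq> F"
      by (rule gap_bounds[OF \<sigma>(1), of s]) (use rs in auto)
    have "s < rk E" using CD(7) rk_le_ground[OF CD(4)] by simp
    then have "B \<in> \<sigma>" using AB(2) False by auto
    moreover have "\<not> D \<subseteq> B" using False CD(7) rk_mono[OF CD(4) AB(4)] by auto
    ultimately have BC: "B \<subseteq> C" using CD(8) by auto
    have rBC: "rk B \<le> rk C" using rk_mono[OF AB(4) CD(3) BC] .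
    have inCD: "t = s" if "rk C < t" "t < rk D" for t
      using between_gaps[OF \<sigma>(1) CD(3,4,8) that] rs rBC AB(7) that by auto
    have rC: "s = Suc (rk C)" "rk D = rk C + 2"
      using inCD[of "Suc (rk C)"] inCD[of "rk D - 1"] CD(6,7) by presburger+
    have lk: "lk \<sigma> = points A B \<union> points C D"
    proof (intro equalityI subsetI)
      fix G assume g: "G \<in> lk \<sigma>"
      from G[OF g] show "G \<in> points A B \<union> points C D"
      proof
        assume "rk G = r"
        then show ?thesis using link_between[OF \<sigma>(1) AB(1,2) g] AB(3-7) link_flat[OF g] rA
          by (auto simp: points_def)
      next
        assume "rk G = s"
        then show ?thesis using link_between[OF \<sigma>(1) CD(1,2) g] CD(3-7) link_flat[OF g] rC
          by (auto simp: points_def)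
      qed
    next
      fix G assume "G \<in> points A B \<union> points C D"
      then show "G \<in> lk \<sigma>"
      proof
        assume "G \<in> points A B"
        then show ?thesis using rB by (intro memAB) (auto simp: points_def)
      next
        assume "G \<in> points C D"
        then show ?thesis using rC
          by (intro between_link[OF \<sigma>(1) CD(3,4,8)]) (auto simp: points_def)
      qed
    qed
    show ?thesis
      by (rule reverse_cs_codim2I[OF \<sigma>, of "points A B"])
        (rule two_gaps_nonpos[OF \<sigma> AB(3,4,5,8) CD(3,4,5,8) BC lk rB rC(2)])
  qed
qed

sublocale lorentzian_complex flags linear_functions "rk E - 1"
proof
  fix \<sigma> G H assume "\<sigma> \<in> flags" "card \<sigma> + 2 \<le> rk E - 1" "G \<in> lk \<sigma>" "H \<in> lk \<sigma>"
  then show "\<forall>z :: _ \<Rightarrow> real. (\<forall>F\<in>lk \<sigma>. \<forall>K\<in>lk (insert F \<sigma>). z F = z K) \<longrightarrow> z G = z H"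
    using flags_link_connected[of \<sigma>] by simp
qed (rule flags_reverse_cs_codim2)

end

section \<open>The classes \<alpha> and \<beta>, and an ample class\<close>

context flat_lattice begin

lemma rk_zero_iff: "F \<in> flats \<Longrightarrow> rk F = 0 \<longleftrightarrow> F = {}"
  using rk_pos[of F] rk_empty by (cases "F = {}") auto

definition beta :: "'e \<Rightarrow> 'e set \<Rightarrow> real" where
  "beta i F = of_bool (i \<notin> F)"

lemma flag_outside:
  assumes \<sigma>: "\<sigma> \<in> flags"
  obtains j where "j \<in> E" "\<forall>F\<in>\<sigma>. j \<notin> F"
proof (cases "\<sigma> = {}")
  case True
  then show ?thesis using that ground_nonempty by auto
next
  case False
  then obtain A where A: "A \<in> \<sigma>" "\<forall>F\<in>\<sigma>. F \<subseteq> A"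
    using chain_greatest[OF finite_flag[OF \<sigma>]] flag_chain[OF \<sigma>] by meson
  then have "A \<subseteq> E" "A \<noteq> E" using flag_flats[OF \<sigma>] flag_proper[OF \<sigma>] flat_subset by auto
  then obtain j where "j \<in> E" "j \<notin> A" by auto
  then show ?thesis using that[of j] A by auto
qed

lemma flag_inside:
  assumes \<sigma>: "\<sigma> \<in> flags"
  obtains j where "j \<in> E" "\<forall>F\<in>\<sigma>. j \<in> F"
proof (cases "\<sigma> = {}")
  case True
  then show ?thesis using that ground_nonempty by auto
next
  case False
  then obtain A where A: "A \<in> \<sigma>" "\<forall>F\<in>\<sigma>. A \<subseteq> F"
    using chain_least[OF finite_flag[OF \<sigma>]] flag_chain[OF \<sigma>] by meson
  then have "A \<subseteq> E" "A \<noteq> {}" using flag_flats[OF \<sigma>] flag_proper[OF \<sigma>] flat_subset by auto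
  then obtain j where "j \<in> E" "j \<in> A" by auto
  then show ?thesis using that[of j] A by auto
qed

text \<open>For j outside all members of the flag, \<open>alpha i - alpha j\<close> agrees with
  \<open>alpha i\<close> on the flag and differs from it by the nonnegative \<open>alpha j\<close>
  elsewhere.\<close>

lemma nef_alpha:
  assumes "i \<in> E" shows "nef (alpha i)"
  unfolding nef_def
proof
  fix \<sigma> assume "\<sigma> \<in> flags"
  then obtain j where j: "j \<in> E" "\<forall>F\<in>\<sigma>. j \<notin> F" by (rule flag_outside)
  show "\<exists>f\<in>linear_functions. (\<forall>G\<in>\<sigma>. f G = alpha i G) \<and> (\<forall>G\<in>lk \<sigma>. f G \<le> alpha i G)"
    by (rule bexI[OF _ alpha_diff_linear[OF assms j(1)]]) (use j in \<open>auto simp: alpha_def\<close>)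
qed

lemma beta_diff_linear:
  assumes "i \<in> E" "j \<in> E"
  shows "(\<lambda>F. beta i F - beta j F) \<in> linear_functions"
proof -
  have "(\<lambda>F. beta i F - beta j F) = (\<lambda>F. alpha j F - alpha i F)"
    by (auto simp: alpha_def beta_def of_bool_def)
  then show ?thesis using alpha_diff_linear[OF assms(2,1)] by simp
qed

lemma nef_beta:
  assumes "i \<in> E" shows "nef (beta i)"
  unfolding nef_def
proof
  fix \<sigma> assume "\<sigma> \<in> flags"
  then obtain j where j: "j \<in> E" "\<forall>F\<in>\<sigma>. j \<in> F" by (rule flag_inside)
  show "\<exists>f\<in>linear_functions. (\<forall>G\<in>\<sigma>. f G = beta i G) \<and> (\<forall>G\<in>lk \<sigma>. f G \<le> beta i G)"
    by (rule bexI[OF _ beta_diff_linear[OF assms j(1)]]) (use j in \<open>auto simp: beta_def\<close>)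
qed

text \<open>
  The number of pairs \<open>(e, e')\<close> with \<open>e \<in> F\<close> and \<open>e' \<notin> F\<close>. The linear function matching it on \<open>\<sigma>\<close> counts such
  a pair with sign \<open>\<plusminus>1\<close> if \<open>\<sigma>\<close> separates \<open>e\<close> from \<open>e'\<close>, and with \<open>0\<close> otherwise.
\<close>

lemma ample_cut: "ample (\<lambda>F. real (card F) * real (card (E - F)))"
  unfolding ample_def
proof
  fix \<sigma> assume \<sigma>: "\<sigma> \<in> flags"
  define s where "s e e' = (of_bool (\<exists>F\<in>\<sigma>. e \<in> F \<and> e' \<notin> F) - of_bool (\<exists>F\<in>\<sigma>. e' \<in> F \<and> e \<notin> F) :: real)" for e e'
  have s_anti: "s e e' = - s e' e" for e e' by (simp add: s_def)
  have s_le: "s e e' \<le> 1" for e e' by (simp add: s_def of_bool_def)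
  \<comment> \<open>By antisymmetry pairs inside F cancel, so \<open>sum c F\<close> counts only the
    pairs that F cuts, and c has total zero.\<close>
  have anti0: "(\<Sum>e\<in>F. \<Sum>e'\<in>F. s e e') = 0" for F
  proof -
    have "(\<Sum>e\<in>F. \<Sum>e'\<in>F. s e e') = (\<Sum>e'\<in>F. \<Sum>e\<in>F. s e e')" by (rule sum.swap)
    also have "\<dots> = - (\<Sum>e'\<in>F. \<Sum>e\<in>F. s e' e)" by (subst s_anti) (simp add: sum_negf)
    finally show ?thesis by simp
  qed
  define c where "c e = (\<Sum>e'\<in>E. s e e')" for e
  have cF: "sum c F = (\<Sum>e\<in>F. \<Sum>e'\<in>E - F. s e e')" if F: "F \<in> flats" for F
  proof -
    have "c e = (\<Sum>e'\<in>E - F. s e e') + (\<Sum>e'\<in>F. s e e')" for e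
      unfolding c_def using sum.subset_diff[OF flat_subset[OF F] finite_ground] .
    then show ?thesis using anti0 by (simp add: sum.distrib)
  qed
  have lin: "sum c \<in> linear_functions"
    using anti0[of E] by (auto simp: linear_functions_def c_def)
  have cut: "real (card F) * real (card (E - F)) = (\<Sum>e\<in>F. \<Sum>e'\<in>E - F. 1)" for F by simp
  show "\<exists>f\<in>linear_functions. (\<forall>G\<in>\<sigma>. f G = real (card G) * real (card (E - G))) \<and>
      (\<forall>G\<in>lk \<sigma>. f G < real (card G) * real (card (E - G)))"
  proof (rule bexI[OF _ lin], intro conjI ballI)
    fix G assume G: "G \<in> \<sigma>"
    have "s e e' = 1" if "e \<in> G" "e' \<in> E - G" for e e'
    proof -
      have "\<not> (\<exists>F\<in>\<sigma>. e' \<in> F \<and> e \<notin> F)" using flag_chain[OF \<sigma> _ G] that by blast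
      moreover have "\<exists>F\<in>\<sigma>. e \<in> F \<and> e' \<notin> F" using G that by blast
      ultimately show ?thesis by (simp add: s_def)
    qed
    then show "sum c G = real (card G) * real (card (E - G))"
      unfolding cut cF[OF flag_flats[OF \<sigma> G]] by (intro sum.cong) auto
  next
    fix G assume G: "G \<in> lk \<sigma>"
    obtain A B where AB: "A \<in> insert {} \<sigma>" "B \<in> insert E \<sigma>" "A \<in> flats" "B \<in> flats" "A \<subset> B"
      "rk A < rk G" "rk G < rk B" "\<forall>F\<in>\<sigma>. F \<subseteq> A \<or> B \<subseteq> F"
      by (rule gap_bounds[OF \<sigma> link_gap[OF \<sigma> G]])
    \<comment> \<open>Strictness comes from one pair: G cuts i from j, but no member of \<sigma>
      does so in this direction, hence \<open>s i j < 1\<close>.\<close>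
    obtain i j where ij: "i \<in> G" "i \<notin> A" "j \<in> B" "j \<notin> G"
      using link_between[OF \<sigma> AB(1,2) G AB(6,7)] by auto
    have jE: "j \<in> E - G" using ij flat_subset[OF AB(4)] by auto
    have "\<not> (\<exists>F\<in>\<sigma>. i \<in> F \<and> j \<notin> F)" using AB(8) ij by blast
    then have sij: "s i j < 1" by (simp add: s_def)
    have fin: "finite G" "finite (E - G)" using finite_flat link_flat[OF G] finite_ground by auto
    have "(\<Sum>e'\<in>E - G. s i e') < (\<Sum>e'\<in>E - G. 1)"
      by (rule sum_strict_mono_ex1) (use fin s_le sij jE in auto)
    moreover have "(\<Sum>e'\<in>E - G. s e e') \<le> (\<Sum>e'\<in>E - G. 1)" for e
      by (rule sum_mono) (rule s_le)
    ultimately show "sum c G < real (card G) * real (card (E - G))"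
      unfolding cut cF[OF link_flat[OF G]] using fin ij(1) by (intro sum_strict_mono_ex1) auto
  qed
qed

text \<open>Replacing i by an element j outside all members of the flag makes \<alpha> vanish on the
  flag, so only its values on the link remain.\<close>

lemma mul_alpha:
  assumes \<sigma>: "\<sigma> \<in> flags" and w: "balanced_at w \<sigma>" and ij: "i \<in> E" "j \<in> E" "\<forall>F\<in>\<sigma>. j \<notin> F"
  shows "mul (alpha i) w \<sigma> = (\<Sum>G\<in>{G \<in> lk \<sigma>. j \<in> G}. w (insert G \<sigma>))"
proof -
  have "mul (alpha i) w \<sigma> = (\<Sum>G\<in>lk \<sigma>. (alpha i G - (alpha i G - alpha j G)) * w (insert G \<sigma>))"
    by (rule mul_eq[OF \<sigma> w alpha_diff_linear[OF ij(1,2)]]) (use ij in \<open>auto simp: alpha_def\<close>)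
  also have "\<dots> = (\<Sum>G\<in>lk \<sigma>. if j \<in> G then w (insert G \<sigma>) else 0)"
    by (rule sum.cong) (auto simp: alpha_def)
  finally show ?thesis by (simp add: sum.inter_filter finite_lk)
qed

lemma mul_beta:
  assumes \<sigma>: "\<sigma> \<in> flags" and w: "balanced_at w \<sigma>" and ij: "i \<in> E" "j \<in> E" "\<forall>F\<in>\<sigma>. j \<in> F"
  shows "mul (beta i) w \<sigma> = (\<Sum>G\<in>{G \<in> lk \<sigma>. j \<notin> G}. w (insert G \<sigma>))"
proof -
  have "mul (beta i) w \<sigma> = (\<Sum>G\<in>lk \<sigma>. (beta i G - (beta i G - beta j G)) * w (insert G \<sigma>))"
    by (rule mul_eq[OF \<sigma> w beta_diff_linear[OF ij(1,2)]]) (use ij in \<open>auto simp: beta_def\<close>)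
  also have "\<dots> = (\<Sum>G\<in>lk \<sigma>. if j \<notin> G then w (insert G \<sigma>) else 0)"
    by (rule sum.cong) (auto simp: beta_def)
  finally show ?thesis by (simp add: sum.inter_filter finite_lk)
qed

lemma flag_ranks:
  assumes \<sigma>: "\<sigma> \<in> flags" and r: "\<forall>F\<in>\<sigma>. j < rk F \<and> rk F \<le> k" and c: "card \<sigma> + j = k"
  shows "rk ` \<sigma> = {Suc j..k}"
proof (rule card_subset_eq)
  show "card (rk ` \<sigma>) = card {Suc j..k}" using card_image[OF flag_rk_inj[OF \<sigma>]] c by simp
qed (use r in auto)

text \<open>Powers of \<alpha> truncate the lattice from above. With j outside \<sigma>, only flats
  above the whole flag are inserted. If \<sigma> obeys the rank bound, its size forces its ranks to
  be 1 up to \<open>card \<sigma>\<close>, and exactly one insertion counts, the cover of its top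
  member by j.\<close>

lemma mixed_alpha:
  assumes i: "i \<in> E"
  shows "\<sigma> \<in> flags \<Longrightarrow> card \<sigma> + m = rk E - 1 \<Longrightarrow>
    mixed (replicate m (alpha i)) \<sigma> = of_bool (\<forall>F\<in>\<sigma>. rk F \<le> rk E - 1 - m)"
proof (induction m arbitrary: \<sigma>)
  case 0
  then show ?case using flag_rk_range[OF 0(1)] by simp
next
  case (Suc m)
  note \<sigma> = Suc.prems(1)
  let ?k = "rk E - 1 - m"
  obtain j where j: "j \<in> E" "\<forall>F\<in>\<sigma>. j \<notin> F" by (rule flag_outside[OF \<sigma>])
  have below: "F \<subset> G" if "G \<in> lk \<sigma>" "j \<in> G" "F \<in> \<sigma>" for F G
    using link_comparable[OF that(1,3)] j that by auto
  have rbelow: "rk F < rk G" if "G \<in> lk \<sigma>" "j \<in> G" "F \<in> \<sigma>" for F G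
    using rk_strict[OF flag_flats[OF \<sigma> that(3)] link_flat[OF that(1)] below[OF that]] .
  have "mixed (replicate (Suc m) (alpha i)) \<sigma>
      = (\<Sum>G\<in>{G \<in> lk \<sigma>. j \<in> G}. mixed (replicate m (alpha i)) (insert G \<sigma>))"
    unfolding replicate_Suc mixed.simps
    by (rule mul_alpha[OF \<sigma> mixed_balanced[OF \<sigma>] i j]) (use Suc.prems in simp)
  also have "\<dots> = (\<Sum>G\<in>{G \<in> lk \<sigma>. j \<in> G}. of_bool (rk G \<le> ?k))"
  proof (rule sum.cong[OF refl])
    fix G assume G: "G \<in> {G \<in> lk \<sigma>. j \<in> G}"
    then have "mixed (replicate m (alpha i)) (insert G \<sigma>) = of_bool (\<forall>F\<in>insert G \<sigma>. rk F \<le> ?k)"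
      using lk_card[of G \<sigma>] lk_face[of G \<sigma>] Suc.prems by (intro Suc.IH) auto
    also have "(\<forall>F\<in>insert G \<sigma>. rk F \<le> ?k) \<longleftrightarrow> rk G \<le> ?k"
      using rbelow[of G] G by fastforce
    finally show "mixed (replicate m (alpha i)) (insert G \<sigma>) = of_bool (rk G \<le> ?k)" .
  qed
  also have "\<dots> = of_bool (\<forall>F\<in>\<sigma>. rk F \<le> rk E - 1 - Suc m)"
  proof (cases "\<forall>F\<in>\<sigma>. rk F \<le> rk E - 1 - Suc m")
    case False
    then obtain F where F: "F \<in> \<sigma>" "rk E - 1 - Suc m < rk F" by auto
    have "\<not> rk G \<le> ?k" if "G \<in> lk \<sigma>" "j \<in> G" for G
      using rbelow[OF that F(1)] F(2) by simp
    then have "(\<Sum>G\<in>{G \<in> lk \<sigma>. j \<in> G}. of_bool (rk G \<le> ?k)) = (\<Sum>G\<in>{G \<in> lk \<sigma>. j \<in> G}. (0::real))"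
      by (intro sum.cong) auto
    then show ?thesis using False by (simp only: of_bool_eq(1) if_False sum.neutral_const)
  next
    case True
    have "\<forall>F\<in>\<sigma>. 0 < rk F \<and> rk F \<le> card \<sigma>"
      using True flag_rk_range[OF \<sigma>] Suc.prems by fastforce
    then have ranks: "rk ` \<sigma> = {Suc 0..card \<sigma>}" by (rule flag_ranks[OF \<sigma>]) simp
    have "\<exists>A\<in>insert {} \<sigma>. \<forall>F\<in>insert {} \<sigma>. F \<subseteq> A"
      by (rule chain_greatest) (use finite_flag[OF \<sigma>] flag_chain[OF \<sigma>] in auto)
    then obtain A where A: "A \<in> insert {} \<sigma>" "\<forall>F\<in>\<sigma>. F \<subseteq> A" by auto
    have Af: "A \<in> flats" using A(1) flag_flats[OF \<sigma>] empty_flat by auto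
    have rA: "rk A = card \<sigma>"
    proof (cases "\<sigma> = {}")
      case True then show ?thesis using A rk_empty by simp
    next
      case False
      then have "card \<sigma> \<in> rk ` \<sigma>" using finite_flag[OF \<sigma>] by (simp add: ranks Suc_leI card_gt_0_iff)
      then obtain F where F: "F \<in> \<sigma>" "rk F = card \<sigma>" by auto
      have "A \<in> \<sigma>" using False A F flag_proper[OF \<sigma> F(1)] by auto
      then have "rk A \<le> card \<sigma>" using ranks by fastforce
      then show ?thesis using rk_mono[OF flag_flats[OF \<sigma> F(1)] Af] A(2) F by auto
    qed
    have jA: "j \<notin> A" using A(1) j by auto
    obtain K where K: "K \<in> flats" "insert j A \<subseteq> K" "K \<subseteq> E" "rk K = Suc (rk A)"
      by (rule cover_within[of A E j]) (use Af ground_flat flat_subset[OF Af] j jA in auto)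
    have kk: "?k = Suc (card \<sigma>)" using Suc.prems by simp
    have "K \<noteq> E" using K(4) rA Suc.prems(2) by auto
    have Klk: "K \<in> lk \<sigma>"
      by (rule between_link[OF \<sigma> Af ground_flat]) (use A(2) K jA \<open>K \<noteq> E\<close> in auto)
    have "{G \<in> {G \<in> lk \<sigma>. j \<in> G}. rk G \<le> ?k} = {K}"
    proof (intro equalityI subsetI)
      fix G assume G: "G \<in> {G \<in> {G \<in> lk \<sigma>. j \<in> G}. rk G \<le> ?k}"
      have AG: "A \<subseteq> G" using A(1) below[of G] G by auto
      have "rk A < rk G" using AG jA G by (intro rk_strict Af link_flat[of G \<sigma>]) auto
      then have "rk G = Suc (rk A)" using G kk rA by simp
      then show "G \<in> {K}"
        using cover_unique[of A G K j] Af AG K G jA link_flat[of G \<sigma>] by auto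
    next
      fix G assume "G \<in> {K}"
      then show "G \<in> {G \<in> {G \<in> lk \<sigma>. j \<in> G}. rk G \<le> ?k}" using Klk K kk rA by auto
    qed
    moreover have "(\<Sum>G\<in>{G \<in> lk \<sigma>. j \<in> G}. of_bool (rk G \<le> ?k))
        = (\<Sum>G\<in>{G \<in> {G \<in> lk \<sigma>. j \<in> G}. rk G \<le> ?k}. (1::real))"
      by (subst sum.inter_filter) (auto simp: finite_lk of_bool_def)
    ultimately show ?thesis using True by simp
  qed
  finally show ?case .
qed

section \<open>The Moebius function and Weisner's theorem\<close>

function mobius :: "'e set \<Rightarrow> real" where
  "mobius F = (if F \<notin> flats then 0 else if F = {} then 1 else - (\<Sum>G\<in>{G \<in> flats. G \<subset> F}. mobius G))"
  by auto
termination
  by (relation "Wellfounded.measure card") (auto intro: psubset_card_mono finite_flat)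

declare mobius.simps [simp del]

lemma mobius_empty: "mobius {} = 1"
  using empty_flat by (simp add: mobius.simps)

lemma mobius_sum:
  assumes "F \<in> flats"
  shows "(\<Sum>G\<in>{G \<in> flats. G \<subseteq> F}. mobius G) = of_bool (F = {})"
proof -
  have "{G \<in> flats. G \<subseteq> F} = insert F {G \<in> flats. G \<subset> F}" using assms by auto
  then have "(\<Sum>G\<in>{G \<in> flats. G \<subseteq> F}. mobius G) = mobius F + (\<Sum>G\<in>{G \<in> flats. G \<subset> F}. mobius G)"
    using finite_flats by simp
  also have "\<dots> = of_bool (F = {})"
    using assms by (subst mobius.simps) (auto simp: mobius_empty)
  finally show ?thesis .
qed

text \<open>In the vanishing sum over the flats below F, each H that avoids x is charged to its
  unique cover K within F that contains x. By induction the group of every K other than F cancels,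
  and the group of F remains.\<close>

lemma weisner:
  "F \<in> flats \<Longrightarrow> x \<in> F \<Longrightarrow>
    mobius F = - (\<Sum>H\<in>{H \<in> flats. H \<subset> F \<and> x \<notin> H \<and> Suc (rk H) = rk F}. mobius H)"
proof (induction "rk F" arbitrary: F rule: less_induct)
  case less
  let ?C = "\<lambda>K. {H \<in> flats. H \<subset> K \<and> x \<notin> H \<and> Suc (rk H) = rk K}"
  let ?K = "{K \<in> flats. K \<subseteq> F \<and> x \<in> K}" and ?N = "{H \<in> flats. H \<subseteq> F \<and> x \<notin> H}"
  have "0 = (\<Sum>G\<in>{G \<in> flats. G \<subseteq> F}. mobius G)" using mobius_sum less.prems by auto
  also have "{G \<in> flats. G \<subseteq> F} = ?K \<union> ?N" by auto
  also have "(\<Sum>G\<in>?K \<union> ?N. mobius G) = (\<Sum>G\<in>?K. mobius G) + (\<Sum>G\<in>?N. mobius G)"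
    by (rule sum.union_disjoint) (use finite_flats in auto)
  also have "(\<Sum>H\<in>?N. mobius H) = (\<Sum>H\<in>?N. \<Sum>K\<in>{K \<in> ?K. H \<subset> K \<and> Suc (rk H) = rk K}. mobius H)"
  proof (rule sum.cong[OF refl])
    fix H assume H: "H \<in> ?N"
    obtain C where C: "C \<in> flats" "insert x H \<subseteq> C" "C \<subseteq> F" "rk C = Suc (rk H)"
      by (rule cover_within[of H F x]) (use H less.prems in auto)
    have "{K \<in> ?K. H \<subset> K \<and> Suc (rk H) = rk K} = {C}"
    proof (intro equalityI subsetI)
      fix K assume "K \<in> {K \<in> ?K. H \<subset> K \<and> Suc (rk H) = rk K}"
      then show "K \<in> {C}" using cover_unique[of H K C x] H C by auto
    next
      fix K assume "K \<in> {C}"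
      then show "K \<in> {K \<in> ?K. H \<subset> K \<and> Suc (rk H) = rk K}" using H C by auto
    qed
    then show "mobius H = (\<Sum>K\<in>{K \<in> ?K. H \<subset> K \<and> Suc (rk H) = rk K}. mobius H)" by simp
  qed
  also have "\<dots> = (\<Sum>K\<in>?K. \<Sum>H\<in>{H \<in> ?N. H \<subset> K \<and> Suc (rk H) = rk K}. mobius H)"
    by (rule sum.swap_restrict) (use finite_flats in auto)
  also have "\<dots> = (\<Sum>K\<in>?K. \<Sum>H\<in>?C K. mobius H)"
    by (intro sum.cong refl) auto
  finally have "0 = (\<Sum>K\<in>?K. mobius K + (\<Sum>H\<in>?C K. mobius H))" by (simp add: sum.distrib)
  also have "\<dots> = (\<Sum>K\<in>?K. if K = F then mobius F + (\<Sum>H\<in>?C F. mobius H) else 0)"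
  proof (rule sum.cong[OF refl])
    fix K assume K: "K \<in> ?K"
    show "mobius K + (\<Sum>H\<in>?C K. mobius H) = (if K = F then mobius F + (\<Sum>H\<in>?C F. mobius H) else 0)"
    proof (cases "K = F")
      case False
      then have "rk K < rk F" using K less.prems by (intro rk_strict) auto
      then show ?thesis using less.hyps[of K] K False by simp
    qed simp
  qed
  also have "\<dots> = mobius F + (\<Sum>H\<in>?C F. mobius H)"
    using less.prems finite_flats by (subst sum.delta) auto
  finally show ?case by simp
qed

definition abs_mobius :: "'e set \<Rightarrow> real" where
  "abs_mobius F = (-1) ^ rk F * mobius F"

lemma abs_mobius_rec:
  assumes "F \<in> flats" "x \<in> F"
  shows "abs_mobius F = (\<Sum>H\<in>{H \<in> flats. H \<subset> F \<and> x \<notin> H \<and> Suc (rk H) = rk F}. abs_mobius H)"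
proof -
  have "abs_mobius F = (\<Sum>H\<in>{H \<in> flats. H \<subset> F \<and> x \<notin> H \<and> Suc (rk H) = rk F}. - ((-1) ^ rk F * mobius H))"
    unfolding abs_mobius_def weisner[OF assms] by (simp add: sum_distrib_left sum_negf)
  also have "\<dots> = (\<Sum>H\<in>{H \<in> flats. H \<subset> F \<and> x \<notin> H \<and> Suc (rk H) = rk F}. abs_mobius H)"
  proof (rule sum.cong[OF refl])
    fix H assume "H \<in> {H \<in> flats. H \<subset> F \<and> x \<notin> H \<and> Suc (rk H) = rk F}"
    then have "rk F = Suc (rk H)" by simp
    then show "- ((-1) ^ rk F * mobius H) = abs_mobius H" by (simp add: abs_mobius_def)
  qed
  finally show ?thesis .
qed

text \<open>The recursion has no signs, and \<open>avoiding_flat\<close> shows that its sum is not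
  empty.\<close>

lemma abs_mobius_pos: "F \<in> flats \<Longrightarrow> abs_mobius F > 0"
proof (induction "rk F" arbitrary: F rule: less_induct)
  case less
  show ?case
  proof (cases "F = {}")
    case True
    then show ?thesis by (simp add: abs_mobius_def mobius_empty rk_empty)
  next
    case False
    then obtain x where x: "x \<in> F" by auto
    have "rk F > 0" using rk_pos less.prems False by blast
    then obtain H where "H \<in> flats" "H \<subseteq> F" "x \<notin> H" "rk H = rk F - 1"
      using avoiding_flat[OF less.prems x, of "rk F - 1"] by auto
    then have "H \<in> {H \<in> flats. H \<subset> F \<and> x \<notin> H \<and> Suc (rk H) = rk F}" using x \<open>rk F > 0\<close> by auto
    then show ?thesis unfolding abs_mobius_rec[OF less.prems x]
      using finite_flats less.hyps by (intro sum_pos) auto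
  qed
qed

lemma abs_mobius_atom:
  assumes "F \<in> flats" "rk F = 1"
  shows "abs_mobius F = 1"
proof -
  have "F \<noteq> {}" using assms rk_empty by auto
  then obtain x where x: "x \<in> F" by auto
  have "{H \<in> flats. H \<subset> F \<and> x \<notin> H \<and> Suc (rk H) = rk F} = {{}}"
    using assms rk_zero_iff empty_flat rk_empty x by auto
  then show ?thesis unfolding abs_mobius_rec[OF assms(1) x] by (simp add: abs_mobius_def rk_empty mobius_empty)
qed

section \<open>Whitney numbers as intersection numbers\<close>

lemma Inter_flag_insert:
  assumes "\<sigma> \<in> flags" "G \<in> lk \<sigma>" "x \<notin> G" "\<forall>F\<in>\<sigma>. x \<in> F"
  shows "\<Inter>(insert G \<sigma>) = G"
  using link_comparable[OF assms(2)] assms(3,4) by blast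

text \<open>A factor \<beta>, expanded with an element x of the least member A, inserts flats below
  A that avoid x. The rank condition leaves those of rank one less than A, and the sum over them is
  Weisner's recursion for \<open>abs_mobius A\<close>. The flag must be nonempty for
  \<open>\<Inter>\<sigma>\<close> to be its least member.\<close>

lemma mixed_beta_alpha_flag:
  assumes i: "i \<in> E" and k: "k \<le> rk E - 1"
  shows "\<sigma> \<in> flags \<Longrightarrow> \<sigma> \<noteq> {} \<Longrightarrow> card \<sigma> + j = k \<Longrightarrow>
    mixed (replicate j (beta i) @ replicate (rk E - 1 - k) (alpha i)) \<sigma>
     = of_bool (\<forall>F\<in>\<sigma>. j < rk F \<and> rk F \<le> k) * abs_mobius (\<Inter>\<sigma>)"
proof (induction j arbitrary: \<sigma>)
  case 0
  note \<sigma> = 0(1)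
  have "mixed (replicate (rk E - 1 - k) (alpha i)) \<sigma> = of_bool (\<forall>F\<in>\<sigma>. rk F \<le> rk E - 1 - (rk E - 1 - k))"
    using 0 k by (intro mixed_alpha[OF i]) auto
  also have "(\<forall>F\<in>\<sigma>. rk F \<le> rk E - 1 - (rk E - 1 - k)) \<longleftrightarrow> (\<forall>F\<in>\<sigma>. 0 < rk F \<and> rk F \<le> k)"
    using k flag_rk_range[OF \<sigma>] by fastforce
  also have "of_bool \<dots> = of_bool (\<forall>F\<in>\<sigma>. 0 < rk F \<and> rk F \<le> k) * abs_mobius (\<Inter>\<sigma>)"
  proof (cases "\<forall>F\<in>\<sigma>. 0 < rk F \<and> rk F \<le> k")
    case True
    \<comment> \<open>With j = 0 the ranks fill 1 to k, so the least member is an atom and the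
      factor is 1.\<close>
    have ranks: "rk ` \<sigma> = {Suc 0..k}" by (rule flag_ranks[OF \<sigma> True 0(3)])
    have "k > 0" using 0(2,3) finite_flag[OF \<sigma>] by (auto simp: card_gt_0_iff)
    then have "1 \<in> rk ` \<sigma>" by (simp add: ranks)
    then obtain A where A: "A \<in> \<sigma>" "rk A = 1" by auto
    have "A \<subseteq> F" if "F \<in> \<sigma>" for F
      using flag_chain[OF \<sigma> A(1) that] rk_eq[OF flag_flats[OF \<sigma> that] flag_flats[OF \<sigma> A(1)]] A(2)
        bspec[OF True that] by auto
    then have "\<Inter>\<sigma> = A" using A by auto
    then show ?thesis using abs_mobius_atom[OF flag_flats[OF \<sigma> A(1)] A(2)] by simp
  qed simp
  finally show ?case by simp
next
  case (Suc j)
  note \<sigma> = Suc.prems(1)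
  let ?P = "\<lambda>j \<sigma>. \<forall>F\<in>\<sigma>. j < rk F \<and> rk F \<le> k"
  have "\<exists>A\<in>\<sigma>. \<forall>F\<in>\<sigma>. A \<subseteq> F"
    by (rule chain_least) (use finite_flag[OF \<sigma>] flag_chain[OF \<sigma>] Suc.prems in auto)
  then obtain A where A: "A \<in> \<sigma>" "\<forall>F\<in>\<sigma>. A \<subseteq> F" by (elim bexE)
  have AI: "\<Inter>\<sigma> = A" using A by auto
  have Af: "A \<in> flats" using A flag_flats[OF \<sigma>] by auto
  obtain x where x: "x \<in> A" using flag_proper[OF \<sigma> A(1)] by auto
  have xE: "x \<in> E" and xall: "\<forall>F\<in>\<sigma>. x \<in> F" using x A flat_subset[OF Af] by auto
  have GA: "G \<subset> A" if "G \<in> lk \<sigma>" "x \<notin> G" for G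
    using link_comparable[OF that(1) A(1)] x that(2) by auto
  have rGA: "rk G < rk A" if "G \<in> lk \<sigma>" "x \<notin> G" for G
    using rk_strict[OF link_flat[OF that(1)] Af GA[OF that]] .
  have "mixed (replicate (Suc j) (beta i) @ replicate (rk E - 1 - k) (alpha i)) \<sigma>
    = (\<Sum>G\<in>{G \<in> lk \<sigma>. x \<notin> G}. mixed (replicate j (beta i) @ replicate (rk E - 1 - k) (alpha i)) (insert G \<sigma>))"
    unfolding replicate_Suc append_Cons mixed.simps
    by (rule mul_beta[OF \<sigma> mixed_balanced[OF \<sigma>] i xE xall]) (use Suc.prems k in simp)
  also have "\<dots> = (\<Sum>G\<in>{G \<in> lk \<sigma>. x \<notin> G}. of_bool (?P j (insert G \<sigma>)) * abs_mobius G)"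
  proof (rule sum.cong[OF refl])
    fix G assume G: "G \<in> {G \<in> lk \<sigma>. x \<notin> G}"
    then show "mixed (replicate j (beta i) @ replicate (rk E - 1 - k) (alpha i)) (insert G \<sigma>)
      = of_bool (?P j (insert G \<sigma>)) * abs_mobius G"
      using Suc.IH[of "insert G \<sigma>"] lk_face[of G \<sigma>] lk_card[of G \<sigma>] Suc.prems
        Inter_flag_insert[OF \<sigma> _ _ xall, of G] by simp
  qed
  also have "\<dots> = of_bool (?P (Suc j) \<sigma>) * abs_mobius A"
  proof (cases "?P (Suc j) \<sigma>")
    case True
    have ranks: "rk ` \<sigma> = {Suc (Suc j)..k}" by (rule flag_ranks[OF \<sigma> True Suc.prems(3)])
    have "card \<sigma> > 0" using Suc.prems(2) finite_flag[OF \<sigma>] by (simp add: card_gt_0_iff)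
    then have "Suc (Suc j) \<in> rk ` \<sigma>" using Suc.prems(3) by (simp add: ranks)
    then obtain F where F: "F \<in> \<sigma>" "rk F = Suc (Suc j)" by auto
    have rA: "rk A = Suc (Suc j)"
      using rk_mono[OF Af flag_flats[OF \<sigma> F(1)]] A F bspec[OF True A(1)] by auto
    have P: "?P j (insert G \<sigma>) \<longleftrightarrow> rk G = Suc j" if G: "G \<in> lk \<sigma>" "x \<notin> G" for G
    proof -
      have "?P j \<sigma>" using True by auto
      moreover have "rk A \<le> k" using True A by auto
      ultimately show ?thesis using rGA[OF G] rA by auto
    qed
    have "(\<Sum>G\<in>{G \<in> lk \<sigma>. x \<notin> G}. of_bool (?P j (insert G \<sigma>)) * abs_mobius G)
      = (\<Sum>G\<in>{G \<in> lk \<sigma>. x \<notin> G}. if rk G = Suc j then abs_mobius G else 0)"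
    proof (rule sum.cong[OF refl])
      fix G assume "G \<in> {G \<in> lk \<sigma>. x \<notin> G}"
      then have eq: "?P j (insert G \<sigma>) \<longleftrightarrow> rk G = Suc j" by (intro P) auto
      show "of_bool (?P j (insert G \<sigma>)) * abs_mobius G = (if rk G = Suc j then abs_mobius G else 0)"
        unfolding eq by (simp add: of_bool_def)
    qed
    also have "\<dots> = (\<Sum>G\<in>{G \<in> {G \<in> lk \<sigma>. x \<notin> G}. rk G = Suc j}. abs_mobius G)"
      by (rule sum.inter_filter[symmetric]) (simp add: finite_lk)
    also have "{G \<in> {G \<in> lk \<sigma>. x \<notin> G}. rk G = Suc j} = {H \<in> flats. H \<subset> A \<and> x \<notin> H \<and> Suc (rk H) = rk A}"
    proof (intro equalityI subsetI)
      fix G assume "G \<in> {G \<in> {G \<in> lk \<sigma>. x \<notin> G}. rk G = Suc j}"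
      then show "G \<in> {H \<in> flats. H \<subset> A \<and> x \<notin> H \<and> Suc (rk H) = rk A}"
        using GA link_flat[of G \<sigma>] rA by auto
    next
      fix G assume G: "G \<in> {H \<in> flats. H \<subset> A \<and> x \<notin> H \<and> Suc (rk H) = rk A}"
      then have "G \<noteq> {}" using rA rk_empty by auto
      then have "G \<in> lk \<sigma>" using G A(2)
        by (intro between_link[OF \<sigma> empty_flat Af]) auto
      then show "G \<in> {G \<in> {G \<in> lk \<sigma>. x \<notin> G}. rk G = Suc j}" using G rA by auto
    qed
    also have "(\<Sum>H\<in>{H \<in> flats. H \<subset> A \<and> x \<notin> H \<and> Suc (rk H) = rk A}. abs_mobius H) = abs_mobius A"
      using abs_mobius_rec[OF Af x] by simp
    finally show ?thesis using True by simp
  next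
    case False
    then obtain F where F: "F \<in> \<sigma>" "\<not> (Suc j < rk F \<and> rk F \<le> k)" by auto
    have nP: "\<not> ?P j (insert G \<sigma>)" if G: "G \<in> lk \<sigma>" "x \<notin> G" for G
    proof
      assume P: "?P j (insert G \<sigma>)"
      have "rk A \<le> rk F" by (rule rk_mono[OF Af flag_flats[OF \<sigma> F(1)]]) (use A F in auto)
      then show False using P F rGA[OF G] by auto
    qed
    have "(\<Sum>G\<in>{G \<in> lk \<sigma>. x \<notin> G}. of_bool (?P j (insert G \<sigma>)) * abs_mobius G)
      = (\<Sum>G\<in>{G \<in> lk \<sigma>. x \<notin> G}. 0)"
    proof (rule sum.cong[OF refl])
      fix G assume "G \<in> {G \<in> lk \<sigma>. x \<notin> G}"
      then have eq: "?P j (insert G \<sigma>) \<longleftrightarrow> False" using nP[of G] by simp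
      show "of_bool (?P j (insert G \<sigma>)) * abs_mobius G = 0" unfolding eq by simp
    qed
    then show ?thesis using False by (simp only: of_bool_eq mult_zero_left sum.neutral_const)
  qed
  finally show ?case by (simp only: AI)
qed

text \<open>If \<open>i\<close> is the hyperplane at infinity, these are the unsigned coefficients of the affine characteristic polynomial.\<close>

definition whitney :: "'e \<Rightarrow> nat \<Rightarrow> real" where
  "whitney i r = (\<Sum>F\<in>{F \<in> flats. rk F = r \<and> i \<notin> F}. abs_mobius F)"

lemma empty_flag: "{} \<in> flags" by (simp add: flags_def)

text \<open>The empty flag has no least member, so the first factor \<beta> is expanded with i
  itself; the one-element flags that result contribute exactly the flats of rank k avoiding
  i.\<close>

lemma mixed_beta_alpha:
  assumes i: "i \<in> E" and k: "k \<le> rk E - 1"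
  shows "mixed (replicate k (beta i) @ replicate (rk E - 1 - k) (alpha i)) {} = whitney i k"
proof (cases k)
  case 0
  have "{F \<in> flats. rk F = 0 \<and> i \<notin> F} = {{}}" using rk_zero_iff empty_flat rk_empty by auto
  then show ?thesis using 0 mixed_alpha[OF i empty_flag, of "rk E - 1"]
    by (simp add: whitney_def abs_mobius_def rk_empty mobius_empty)
next
  case (Suc j)
  have "mixed (replicate k (beta i) @ replicate (rk E - 1 - k) (alpha i)) {}
    = (\<Sum>G\<in>{G \<in> lk {}. i \<notin> G}. mixed (replicate j (beta i) @ replicate (rk E - 1 - k) (alpha i)) (insert G {}))"
    unfolding Suc replicate_Suc append_Cons mixed.simps
    by (rule mul_beta[OF empty_flag mixed_balanced[OF empty_flag] i i]) (use Suc k in auto)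
  also have "\<dots> = (\<Sum>G\<in>{G \<in> lk {}. i \<notin> G}. if rk G = k then abs_mobius G else 0)"
  proof (rule sum.cong[OF refl])
    fix G assume G: "G \<in> {G \<in> lk {}. i \<notin> G}"
    have "mixed (replicate j (beta i) @ replicate (rk E - 1 - k) (alpha i)) {G}
      = of_bool (\<forall>F\<in>{G}. j < rk F \<and> rk F \<le> k) * abs_mobius (\<Inter>{G})"
      by (rule mixed_beta_alpha_flag[OF i k]) (use G Suc lk_face[of G "{}"] in auto)
    also have "\<dots> = (if rk G = k then abs_mobius G else 0)" using Suc by auto
    finally show "mixed (replicate j (beta i) @ replicate (rk E - 1 - k) (alpha i)) {G}
      = (if rk G = k then abs_mobius G else 0)" .
  qed
  also have "\<dots> = (\<Sum>G\<in>{G \<in> {G \<in> lk {}. i \<notin> G}. rk G = k}. abs_mobius G)"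
    by (rule sum.inter_filter[symmetric]) (simp add: finite_lk)
  also have "{G \<in> {G \<in> lk {}. i \<notin> G}. rk G = k} = {F \<in> flats. rk F = k \<and> i \<notin> F}"
  proof (intro equalityI subsetI)
    fix G assume "G \<in> {G \<in> {G \<in> lk {}. i \<notin> G}. rk G = k}"
    then show "G \<in> {F \<in> flats. rk F = k \<and> i \<notin> F}" using link_flat[of G "{}"] by auto
  next
    fix G assume G: "G \<in> {F \<in> flats. rk F = k \<and> i \<notin> F}"
    then have "G \<noteq> {}" "G \<subset> E" using Suc rk_empty i flat_subset[of G] by auto
    then have "G \<in> lk {}" using G
      by (intro between_link[OF empty_flag empty_flat ground_flat]) auto
    then show "G \<in> {G \<in> {G \<in> lk {}. i \<notin> G}. rk G = k}" using G by auto
  qed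
  finally show ?thesis by (simp add: whitney_def)
qed

lemma whitney_pos:
  assumes "i \<in> E" "r \<le> rk E - 1"
  shows "whitney i r > 0"
proof -
  have "rk E > 0" using rk_pos ground_flat ground_nonempty by auto
  then obtain F where "F \<in> flats" "rk F = r" "i \<notin> F"
    using avoiding_flat[OF ground_flat assms(1), of r] assms(2) by fastforce
  then show ?thesis unfolding whitney_def using finite_flats abs_mobius_pos
    by (intro sum_pos) auto
qed

theorem whitney_log_concave:
  assumes i: "i \<in> E" and r: "0 < r" "r < rk E - 1"
  shows "whitney i (r - 1) * whitney i (r + 1) \<le> (whitney i r)\<^sup>2"
proof -
  let ?a = "alpha i" and ?b = "beta i" and ?n = "rk E - 1"
  \<comment> \<open>The common factor has r - 1 copies of \<beta> and n - r - 1 of \<alpha>.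
    Completing it by two \<beta>, one of each, or two \<alpha> gives the Whitney numbers of index r
    + 1, r and r - 1.\<close>
  let ?bs = "replicate (r - 1) ?b" and ?as = "replicate (?n - (r + 1)) ?a"
  have "mixed (?b # ?b # ?bs @ ?as) {} * mixed (?a # ?a # ?bs @ ?as) {} \<le> (mixed (?b # ?a # ?bs @ ?as) {})\<^sup>2"
    by (rule mixed_nef_log_concave[OF ample_cut])
      (use nef_alpha[OF i] nef_beta[OF i] empty_flag r in auto)
  moreover have "mixed (?b # ?b # ?bs @ ?as) {} = whitney i (r + 1)"
  proof -
    have "?b # ?b # ?bs = replicate (r + 1) ?b" using r(1) by (cases r) auto
    then show ?thesis using mixed_beta_alpha[OF i, of "r + 1"] r by (metis Suc_eq_plus1 Suc_leI append_Cons)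
  qed
  moreover have "mixed (?a # ?a # ?bs @ ?as) {} = whitney i (r - 1)"
  proof -
    have "mixed (?a # ?a # ?bs @ ?as) {} = mixed ((?a # ?bs) @ ?a # ?as) {}"
      by (subst mixed_move[OF empty_flag]) (use r in auto)
    also have "\<dots> = mixed (?a # ?bs @ ?a # ?as) {}" by simp
    also have "\<dots> = mixed (?bs @ ?a # ?a # ?as) {}"
      by (rule mixed_move[OF empty_flag, symmetric]) (use r in auto)
    also have "?a # ?a # ?as = replicate (?n - (r - 1)) ?a"
    proof -
      have eq: "?n - (r - 1) = Suc (Suc (?n - (r + 1)))" using r by simp
      show ?thesis unfolding eq replicate_Suc ..
    qed
    also have "mixed (?bs @ replicate (?n - (r - 1)) ?a) {} = whitney i (r - 1)"
      by (rule mixed_beta_alpha[OF i]) (use r in simp)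
    finally show ?thesis .
  qed
  moreover have "mixed (?b # ?a # ?bs @ ?as) {} = whitney i r"
  proof -
    have "mixed (?b # ?a # ?bs @ ?as) {} = mixed (?a # ?b # ?bs @ ?as) {}"
      by (rule mixed_swap[OF empty_flag]) (use r in auto)
    also have "\<dots> = mixed ((?b # ?bs) @ ?a # ?as) {}"
      by (subst mixed_move[OF empty_flag]) (use r in auto)
    also have "?b # ?bs = replicate r ?b" using r(1) by (cases r) auto
    also have "?a # ?as = replicate (?n - r) ?a"
    proof -
      have eq: "?n - r = Suc (?n - (r + 1))" using r by simp
      show ?thesis unfolding eq replicate_Suc ..
    qed
    also have "mixed (replicate r ?b @ replicate (?n - r) ?a) {} = whitney i r"
      by (rule mixed_beta_alpha[OF i]) (use r in simp)
    finally show ?thesis .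
  qed
  ultimately show ?thesis by (simp add: mult.commute)
qed

end

section \<open>Connected components of a relation\<close>

definition conn :: "'a rel \<Rightarrow> 'a rel" where
  "conn S = (S \<union> S\<inverse>)\<^sup>*"

lemma conn_refl [simp]: "(a, a) \<in> conn S"
  by (simp add: conn_def)

lemma conn_sym: "(a, b) \<in> conn S \<Longrightarrow> (b, a) \<in> conn S"
  unfolding conn_def by (rule symD[OF sym_rtrancl]) (auto simp: sym_def)

lemma conn_trans: "(a, b) \<in> conn S \<Longrightarrow> (b, c) \<in> conn S \<Longrightarrow> (a, c) \<in> conn S"
  unfolding conn_def by (rule rtrancl_trans)

lemma conn_base: "S \<subseteq> conn S"
  by (auto simp: conn_def)

lemma conn_induct [consumes 1, case_names refl step sym_step]:
  assumes "(a, b) \<in> conn S" "P a"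
    and "\<And>b c. (a, b) \<in> conn S \<Longrightarrow> P b \<Longrightarrow> (b, c) \<in> S \<Longrightarrow> P c"
    and "\<And>b c. (a, b) \<in> conn S \<Longrightarrow> P b \<Longrightarrow> (c, b) \<in> S \<Longrightarrow> P c"
  shows "P b"
  using assms(1)[unfolded conn_def]
proof (induction rule: rtrancl_induct)
  case base
  show ?case by (rule assms(2))
next
  case (step b c)
  have ab: "(a, b) \<in> conn S" using step(1) by (simp add: conn_def)
  show ?case
  proof (cases "(b, c) \<in> S")
    case True
    show ?thesis by (rule assms(3)[OF ab step(3) True])
  next
    case False
    then have "(c, b) \<in> S" using step(2) by simp
    then show ?thesis by (rule assms(4)[OF ab step(3)])
  qed
qed

lemma conn_least:
  assumes "S \<subseteq> conn T" shows "conn S \<subseteq> conn T"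
proof -
  have "(a, b) \<in> conn T" if "(a, b) \<in> conn S" for a b
    using that
  proof (induction rule: conn_induct)
    case (step b c)
    show ?case by (rule conn_trans[OF step.IH subsetD[OF assms step.hyps(2)]])
  next
    case (sym_step b c)
    show ?case by (rule conn_trans[OF sym_step.IH conn_sym[OF subsetD[OF assms sym_step.hyps(2)]]])
  qed simp
  then show ?thesis by auto
qed

lemma conn_mono: "S \<subseteq> T \<Longrightarrow> conn S \<subseteq> conn T"
  by (rule conn_least[OF subset_trans[OF _ conn_base]])

lemma conn_eqI: "S \<subseteq> conn T \<Longrightarrow> T \<subseteq> conn S \<Longrightarrow> conn S = conn T"
  by (intro equalityI conn_least)

lemma conn_invariant:
  assumes "(a, b) \<in> conn S" "\<And>x y. (x, y) \<in> S \<Longrightarrow> f x = f y"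
  shows "f a = f b"
  using assms(1) by (induction rule: conn_induct) (auto dest: assms(2))

text \<open>Cut a connecting walk before its first and after its last use of the new pair; the two
  outer pieces are walks in S.\<close>

lemma conn_insertE:
  assumes "(a, b) \<in> conn (insert (u, v) S)"
  shows "(a, b) \<in> conn S \<or> (a, u) \<in> conn S \<and> (v, b) \<in> conn S \<or> (a, v) \<in> conn S \<and> (u, b) \<in> conn S"
  using assms
proof (induction rule: conn_induct)
  case (step b c)
  show ?case
  proof (cases "(b, c) = (u, v)")
    case True
    then show ?thesis using step.IH by auto
  next
    case False
    then have "(b, c) \<in> S" using step.hyps(2) by auto
    then have "(b, c) \<in> conn S" by (rule subsetD[OF conn_base])
    then show ?thesis using step.IH conn_trans[OF _ \<open>(b, c) \<in> conn S\<close>] by blast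
  qed
next
  case (sym_step b c)
  show ?case
  proof (cases "(c, b) = (u, v)")
    case True
    then show ?thesis using sym_step.IH by auto
  next
    case False
    then have "(c, b) \<in> S" using sym_step.hyps(2) by auto
    then have "(b, c) \<in> conn S" by (rule conn_sym[OF subsetD[OF conn_base]])
    then show ?thesis using sym_step.IH conn_trans[OF _ \<open>(b, c) \<in> conn S\<close>] by blast
  qed
qed simp

text \<open>The same cut, at the first and the last step taken inside W.\<close>

lemma conn_Un_clique:
  assumes "(a, b) \<in> conn (S \<union> W \<times> W)"
  shows "(a, b) \<in> conn S \<or> (\<exists>w\<in>W. \<exists>w'\<in>W. (a, w) \<in> conn S \<and> (w', b) \<in> conn S)"
  using assms
proof (induction rule: conn_induct)
  case (step b c)
  show ?case
  proof (cases "(b, c) \<in> S")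
    case True
    then have bc: "(b, c) \<in> conn S" by (rule subsetD[OF conn_base])
    show ?thesis using step.IH conn_trans[OF _ bc] by blast
  next
    case False
    then have "b \<in> W" "c \<in> W" using step by auto
    then show ?thesis using step.IH conn_refl[of c S] by blast
  qed
next
  case (sym_step b c)
  show ?case
  proof (cases "(c, b) \<in> S")
    case True
    then have bc: "(b, c) \<in> conn S" by (rule conn_sym[OF subsetD[OF conn_base]])
    show ?thesis using sym_step.IH conn_trans[OF _ bc] by blast
  next
    case False
    then have "b \<in> W" "c \<in> W" using sym_step by auto
    then show ?thesis using sym_step.IH conn_refl[of c S] by blast
  qed
qed simp

section \<open>Counting components\<close>

definition component :: "'a rel \<Rightarrow> 'a \<Rightarrow> 'a set" where
  "component S v = conn S `` {v}"

definition ncomp :: "'a set \<Rightarrow> 'a rel \<Rightarrow> nat" where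
  "ncomp V S = card (component S ` V)"

lemma mem_component: "b \<in> component S a \<longleftrightarrow> (a, b) \<in> conn S"
  by (simp add: component_def)

lemma component_eq_iff: "component S a = component S b \<longleftrightarrow> (a, b) \<in> conn S"
proof
  assume "component S a = component S b"
  then have "b \<in> component S a" by (simp add: mem_component)
  then show "(a, b) \<in> conn S" by (simp add: mem_component)
next
  assume ab: "(a, b) \<in> conn S"
  show "component S a = component S b"
    using conn_trans[OF ab] conn_trans[OF conn_sym[OF ab]] by (auto simp: mem_component set_eq_iff)
qed

lemma ncomp_cong: "conn S = conn T \<Longrightarrow> ncomp V S = ncomp V T"
  by (simp add: ncomp_def component_def)

text \<open>Components of T are unions of components of S, so merging maps the latter onto the
  former.\<close>

lemma ncomp_mono:
  assumes "finite V" "S \<subseteq> T" shows "ncomp V T \<le> ncomp V S"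
proof -
  have eq: "component T v = (\<Union>x\<in>component S v. component T x)" for v
  proof -
    have "component T x = component T v" if "x \<in> component S v" for x
      unfolding component_eq_iff
      by (rule conn_sym[OF subsetD[OF conn_mono[OF assms(2)]]]) (use that in \<open>simp add: mem_component\<close>)
    moreover have "v \<in> component S v" by (simp add: mem_component)
    ultimately show ?thesis by blast
  qed
  have "component T ` V = (\<lambda>C. \<Union>x\<in>C. component T x) ` component S ` V"
    unfolding image_image by (rule image_cong[OF refl eq])
  then show ?thesis unfolding ncomp_def using assms(1) by (metis card_image_le finite_imageI)
qed

lemma ncomp_insert:
  assumes V: "finite V" and uv: "u \<in> V" "v \<in> V" "(u, v) \<notin> conn S"
  shows "ncomp V S = Suc (ncomp V (insert (u, v) S))"
proof -
  let ?S = "insert (u, v) S" and ?X = "component S u" and ?Y = "component S v"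
  \<comment> \<open>R collects the components that the new pair leaves alone; the other two merge
    into one.\<close>
  define R where "R = component S ` {x \<in> V. x \<notin> ?X \<union> ?Y}"
  have sub: "conn S \<subseteq> conn ?S" by (rule conn_mono) auto
  have uvS: "(u, v) \<in> conn ?S" using conn_base[of ?S] by auto
  have subD: "(a, b) \<in> conn ?S" if "(a, b) \<in> conn S" for a b using sub that by blast
  have X_new: "component ?S u = ?X \<union> ?Y"
  proof (intro equalityI subsetI)
    fix x assume "x \<in> component ?S u"
    then show "x \<in> ?X \<union> ?Y" using conn_insertE[of u x u v S] uv(3) by (auto simp: mem_component)
  next
    fix x assume "x \<in> ?X \<union> ?Y"
    then show "x \<in> component ?S u" using subD conn_trans[OF uvS] by (auto simp: mem_component)
  qed
  have new: "component ?S x = ?X \<union> ?Y" if "x \<in> ?X \<union> ?Y" for x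
  proof -
    have "(u, x) \<in> conn ?S" using that X_new by (auto simp flip: mem_component)
    then show ?thesis using X_new component_eq_iff[of ?S u x] by simp
  qed
  have old: "component ?S x = component S x" if x: "x \<notin> ?X \<union> ?Y" for x
  proof (intro equalityI subsetI)
    fix y assume "y \<in> component ?S x"
    moreover have "(x, u) \<notin> conn S" "(x, v) \<notin> conn S" using x conn_sym[of x u S] conn_sym[of x v S] by (auto simp: mem_component)
    ultimately show "y \<in> component S x" using conn_insertE[of x y u v S] by (auto simp: mem_component)
  qed (use subD in \<open>auto simp: mem_component\<close>)
  have RXY: "?X \<notin> R" "?Y \<notin> R" "?X \<union> ?Y \<notin> R"
  proof -
    have "C \<noteq> ?X \<and> C \<noteq> ?Y \<and> C \<noteq> ?X \<union> ?Y" if "C \<in> R" for C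
    proof -
      obtain x where x: "C = component S x" "x \<notin> ?X \<union> ?Y" using \<open>C \<in> R\<close> by (auto simp: R_def)
      have "x \<in> C" by (simp add: x(1) mem_component)
      then show ?thesis using x(2) by blast
    qed
    then show "?X \<notin> R" "?Y \<notin> R" "?X \<union> ?Y \<notin> R" by blast+
  qed
  have "component S ` V = insert ?X (insert ?Y R)"
  proof -
    have "component S x = ?X \<or> component S x = ?Y" if "x \<in> ?X \<union> ?Y" for x
      using that conn_sym[of u x S] conn_sym[of v x S] by (auto simp: component_eq_iff mem_component)
    then show ?thesis using uv by (auto simp: R_def)
  qed
  moreover have "component ?S ` V = insert (?X \<union> ?Y) R"
  proof -
    have "u \<in> ?X \<union> ?Y" by (simp add: mem_component)
    then have "?X \<union> ?Y \<in> component ?S ` V" using new uv by (metis imageI)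
    moreover have "component ?S x \<in> insert (?X \<union> ?Y) R" if "x \<in> V" for x
      using new[of x] old[of x] that by (cases "x \<in> ?X \<union> ?Y") (auto simp: R_def)
    moreover have "R \<subseteq> component ?S ` V"
    proof
      fix C assume "C \<in> R"
      then obtain x where x: "x \<in> V" "C = component S x" "x \<notin> ?X \<union> ?Y" by (auto simp: R_def)
      then show "C \<in> component ?S ` V" using old[OF x(3)] by blast
    qed
    ultimately show ?thesis by blast
  qed
  moreover have "?X \<noteq> ?Y" using uv by (simp add: component_eq_iff)
  moreover have "finite R" using V by (simp add: R_def)
  ultimately show ?thesis unfolding ncomp_def using RXY by simp
qed

lemma ncomp_strict:
  assumes V: "finite V" and "S \<subseteq> T" "u \<in> V" "v \<in> V" "(u, v) \<in> conn T" "(u, v) \<notin> conn S"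
  shows "ncomp V T < ncomp V S"
proof -
  have "conn T = conn (insert (u, v) T)"
    using assms(5) conn_base[of T] conn_base[of "insert (u, v) T"] by (intro conn_eqI) auto
  then have "ncomp V T = ncomp V (insert (u, v) T)" by (rule ncomp_cong)
  also have "\<dots> \<le> ncomp V (insert (u, v) S)" by (rule ncomp_mono) (use assms in auto)
  also have "\<dots> < ncomp V S" using ncomp_insert[OF V assms(3,4,6)] by simp
  finally show ?thesis .
qed

lemma ncomp_clique:
  assumes "finite V" "W \<subseteq> V" "W \<noteq> {}"
  shows "ncomp V (W \<times> W) = Suc (card V - card W)"
proof -
  have eq: "(a, b) \<in> conn (W \<times> W) \<longleftrightarrow> a = b \<or> a \<in> W \<and> b \<in> W" for a b
  proof
    assume "(a, b) \<in> conn (W \<times> W)"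
    then show "a = b \<or> a \<in> W \<and> b \<in> W" by (induction rule: conn_induct) auto
  qed (use conn_base[of "W \<times> W"] in auto)
  have "component (W \<times> W) v = (if v \<in> W then W else {v})" for v
    by (auto simp: mem_component eq set_eq_iff)
  then have "component (W \<times> W) ` V = insert W ((\<lambda>v. {v}) ` (V - W))" using assms by auto
  moreover have "W \<notin> (\<lambda>v. {v}) ` (V - W)" using assms by auto
  moreover have "card ((\<lambda>v. {v}) ` (V - W)) = card V - card W"
    using assms by (simp add: card_image card_Diff_subset finite_subset)
  ultimately show ?thesis using assms(1) by (simp add: ncomp_def)
qed

section \<open>The flats of a graph relative to a clique\<close>

text \<open>\<open>w0\<close> names one vertex of W: its loop represents the hyperplane at infinity,
  and its component stands for the contracted clique.\<close>

locale clique_graph = pair_graph G for G :: "'a pair_pre_digraph" +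
  fixes W :: "'a set" and w0 :: 'a
  assumes clique: "clique G W" and w0: "w0 \<in> W"
    and connected_graph: "Digraph_Component.connected (with_proj G)"
begin

abbreviation "V \<equiv> pverts G"
abbreviation "A \<equiv> parcs G"

text \<open>
  All pairs in \<open>W \<times> W\<close>, in particular the loop \<open>(w0, w0)\<close>, stand for the hyperplane at infinity. Affine
  flats keep the vertices of \<open>W\<close> in distinct components, infinite ones identify them all. Including the
  loops covers \<open>l = 1\<close>, where there is no arc inside \<open>W\<close>.
\<close>

definition ground :: "'a rel" where
  "ground = A \<union> W \<times> W"

text \<open>Once the clique has distinct fixed colours, the equations of S have a common solution
  exactly if S joins no two clique vertices.\<close>

definition affine_flat :: "'a rel \<Rightarrow> bool" where
  "affine_flat S \<longleftrightarrow> S \<subseteq> A \<and> A \<inter> conn S \<subseteq> S \<and> (\<forall>w\<in>W. \<forall>w'\<in>W. (w, w') \<in> conn S \<longrightarrow> w = w')"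

definition infinite_flat :: "'a rel \<Rightarrow> bool" where
  "infinite_flat S \<longleftrightarrow> W \<times> W \<subseteq> S \<and> S \<subseteq> ground \<and> ground \<inter> conn S \<subseteq> S"

definition graph_flats :: "'a rel set" where
  "graph_flats = {S. affine_flat S \<or> infinite_flat S}"

text \<open>The codimension in the cone. Components meeting W carry fixed values, so W is contracted
  before counting; the hyperplane at infinity contributes one more.\<close>

definition graph_rank :: "'a rel \<Rightarrow> nat" where
  "graph_rank S = (ncomp V (W \<times> W) - ncomp V (S \<union> W \<times> W)) + of_bool (W \<times> W \<subseteq> S)"

lemma clique_subset: "W \<subseteq> V"
  and clique_arc: "u \<in> W \<Longrightarrow> v \<in> W \<Longrightarrow> u \<noteq> v \<Longrightarrow> (u, v) \<in> A"
  using clique by (auto simp: Defs.clique_def)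

lemma arcs_in: "A \<subseteq> V \<times> V"
  using in_arcsD1 in_arcsD2 by auto

lemma ground_in: "ground \<subseteq> V \<times> V"
  using arcs_in clique_subset by (auto simp: ground_def)

lemma no_loop: "(a, a) \<notin> A"
  using pair_no_loops by fastforce

lemma affine_arcs: "affine_flat S \<Longrightarrow> S \<subseteq> A"
  and affine_closed: "affine_flat S \<Longrightarrow> A \<inter> conn S \<subseteq> S"
  and affine_sep: "affine_flat S \<Longrightarrow> w \<in> W \<Longrightarrow> w' \<in> W \<Longrightarrow> (w, w') \<in> conn S \<Longrightarrow> w = w'"
  by (simp_all add: affine_flat_def)

lemma infinite_clique: "infinite_flat S \<Longrightarrow> W \<times> W \<subseteq> S"
  and infinite_ground: "infinite_flat S \<Longrightarrow> S \<subseteq> ground"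
  and infinite_closed: "infinite_flat S \<Longrightarrow> ground \<inter> conn S \<subseteq> S"
  by (simp_all add: infinite_flat_def)

lemma arcs_ground: "A \<subseteq> ground"
  by (simp add: ground_def)

lemma w0_clique: "(w0, w0) \<in> W \<times> W"
  using w0 by simp

lemma graph_flats_cases:
  assumes "S \<in> graph_flats"
  obtains "affine_flat S" | "infinite_flat S"
  using assms unfolding graph_flats_def by fast

lemma affine_not_infinite: "affine_flat S \<Longrightarrow> \<not> W \<times> W \<subseteq> S"
proof
  assume "affine_flat S" "W \<times> W \<subseteq> S"
  then have "(w0, w0) \<in> A" using w0_clique affine_arcs by (meson subsetD)
  then show False using no_loop by simp
qed

lemma affine_iff: "S \<in> graph_flats \<Longrightarrow> affine_flat S \<longleftrightarrow> (w0, w0) \<notin> S"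
proof
  assume "affine_flat S"
  then show "(w0, w0) \<notin> S" using no_loop[of w0] affine_arcs by (meson subsetD)
next
  assume S: "S \<in> graph_flats" "(w0, w0) \<notin> S"
  from S(1) show "affine_flat S"
    by (rule graph_flats_cases) (use S(2) w0_clique infinite_clique in \<open>meson subsetD\<close>)+
qed

lemma flat_in: "S \<in> graph_flats \<Longrightarrow> S \<subseteq> ground"
  by (erule graph_flats_cases) (use affine_arcs infinite_ground arcs_ground in blast)+

lemma flat_closed: "S \<in> graph_flats \<Longrightarrow> A \<inter> conn S \<subseteq> S"
  by (erule graph_flats_cases) (use affine_closed infinite_closed arcs_ground in blast)+

lemma conn_clique: "conn (S \<union> W \<times> W) = conn S" if "W \<times> W \<subseteq> S"
  using that by (simp add: Un_absorb2)

lemma ncomp_clique_le: "ncomp V (S \<union> W \<times> W) \<le> ncomp V (W \<times> W)"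
  by (rule ncomp_mono) (use pair_finite_verts in auto)

lemma Int_affine: "affine_flat S \<Longrightarrow> S' \<in> graph_flats \<Longrightarrow> affine_flat (S \<inter> S')"
proof -
  assume S: "affine_flat S" and S': "S' \<in> graph_flats"
  have sub: "conn (S \<inter> S') \<subseteq> conn S" "conn (S \<inter> S') \<subseteq> conn S'" by (auto intro!: conn_mono)
  show "affine_flat (S \<inter> S')" unfolding affine_flat_def
  proof (intro conjI ballI impI)
    show "S \<inter> S' \<subseteq> A" using affine_arcs[OF S] by auto
    show "A \<inter> conn (S \<inter> S') \<subseteq> S \<inter> S'" using affine_closed[OF S] flat_closed[OF S'] sub by blast
    show "w = w'" if "w \<in> W" "w' \<in> W" "(w, w') \<in> conn (S \<inter> S')" for w w'
      using affine_sep[OF S that(1,2)] that(3) sub(1) by auto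
  qed
qed

lemma Int_infinite: "infinite_flat S \<Longrightarrow> infinite_flat S' \<Longrightarrow> infinite_flat (S \<inter> S')"
proof -
  assume S: "infinite_flat S" and S': "infinite_flat S'"
  have sub: "conn (S \<inter> S') \<subseteq> conn S" "conn (S \<inter> S') \<subseteq> conn S'" by (auto intro!: conn_mono)
  show "infinite_flat (S \<inter> S')" unfolding infinite_flat_def
    using infinite_clique[OF S] infinite_clique[OF S'] infinite_ground[OF S]
      infinite_closed[OF S] infinite_closed[OF S'] sub by blast
qed

lemma rank_strict:
  assumes F: "F \<in> graph_flats" and H: "H \<in> graph_flats" and FH: "F \<subset> H"
  shows "graph_rank F < graph_rank H"
proof -
  have mono: "ncomp V (H \<union> W \<times> W) \<le> ncomp V (F \<union> W \<times> W)"
    by (rule ncomp_mono) (use FH pair_finite_verts in auto)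
  have strict: "ncomp V (H \<union> W \<times> W) < ncomp V (F \<union> W \<times> W)"
    if "(u, v) \<in> H" "(u, v) \<notin> conn (F \<union> W \<times> W)" for u v
  proof (rule ncomp_strict[OF pair_finite_verts _ _ _ _ that(2)])
    show "u \<in> V" "v \<in> V" using that(1) flat_in[OF H] ground_in by auto
    show "(u, v) \<in> conn (H \<union> W \<times> W)" using that(1) conn_base[of "H \<union> W \<times> W"] by auto
  qed (use FH in auto)
  obtain u v where uv: "(u, v) \<in> H" "(u, v) \<notin> F" using FH by auto
  show ?thesis
  proof (cases "infinite_flat H")
    case Hinf: True
    show ?thesis
    proof (cases "infinite_flat F")
      case True
      then have "(u, v) \<notin> conn F" using uv flat_in[OF H] infinite_closed[OF True] by blast
      moreover have "W \<times> W \<subseteq> F" using True by (simp add: infinite_flat_def)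
      ultimately show ?thesis using strict[OF uv(1)] conn_clique[of F] ncomp_clique_le[of F] Hinf
        by (simp add: graph_rank_def infinite_flat_def)
    next
      case False
      then have "\<not> W \<times> W \<subseteq> F" using F affine_not_infinite by (auto simp: graph_flats_def)
      then show ?thesis using mono Hinf by (simp add: graph_rank_def infinite_flat_def)
    qed
  next
    case False
    then have Haff: "affine_flat H" using H by (simp add: graph_flats_def)
    have nW: "\<not> W \<times> W \<subseteq> H" "\<not> W \<times> W \<subseteq> F" using affine_not_infinite[OF Haff] FH by blast+
    then have Faff: "affine_flat F" using F infinite_clique by (auto elim: graph_flats_cases)
    \<comment> \<open>Otherwise F joins u to some w and v to some \<open>w'\<close> in W without
      joining u to v. The pair (u, v) of H then joins w to \<open>w'\<close>, which in an affine
      flat means that they are equal, and F joins u to v after all.\<close>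
    have "(u, v) \<notin> conn (F \<union> W \<times> W)"
    proof
      assume "(u, v) \<in> conn (F \<union> W \<times> W)"
      moreover have nF: "(u, v) \<notin> conn F" using affine_closed[OF Faff] affine_arcs[OF Haff] uv by blast
      ultimately obtain w w' where w: "w \<in> W" "w' \<in> W" "(u, w) \<in> conn F" "(w', v) \<in> conn F"
        using conn_Un_clique[of u v F W] by blast
      have FHc: "conn F \<subseteq> conn H" using FH by (intro conn_mono) auto
      have "(w, u) \<in> conn H" using conn_sym[OF w(3)] FHc by auto
      moreover have "(u, v) \<in> conn H" using uv(1) conn_base[of H] by auto
      moreover have "(v, w') \<in> conn H" using conn_sym[OF w(4)] FHc by auto
      ultimately have "(w, w') \<in> conn H" by (meson conn_trans)
      then have "w = w'" by (rule affine_sep[OF Haff w(1,2)])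
      then show False using conn_trans[OF w(3)] w(4) nF by blast
    qed
    from strict[OF uv(1) this] show ?thesis
      using nW ncomp_clique_le[of F] by (simp add: graph_rank_def)
  qed
qed

text \<open>If u and v are already joined after W is contracted, the generated infinite flat has the
  same contracted components as F; its rank is larger only through the summand for infinity.\<close>

lemma cover_infinite:
  assumes F: "affine_flat F" and uv: "(u, v) \<in> ground" "(u, v) \<in> conn (F \<union> W \<times> W)"
  shows "\<exists>H\<in>graph_flats. insert (u, v) F \<subseteq> H \<and> graph_rank H = Suc (graph_rank F)"
proof -
  let ?P = "F \<union> W \<times> W"
  let ?H = "ground \<inter> conn ?P"
  have PH: "?P \<subseteq> ?H" using affine_arcs[OF F] conn_base[of ?P] by (auto simp: ground_def)
  have conn_eq: "conn ?H = conn ?P" using PH conn_base[of ?H] by (intro conn_eqI) auto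
  have "infinite_flat ?H" using PH conn_eq by (auto simp: infinite_flat_def)
  moreover have "graph_rank ?H = Suc (graph_rank F)"
  proof -
    have "ncomp V (?H \<union> W \<times> W) = ncomp V ?P"
      by (rule ncomp_cong) (use PH conn_eq conn_clique[of ?H] in auto)
    then show ?thesis using PH affine_not_infinite[OF F] by (auto simp: graph_rank_def)
  qed
  ultimately show ?thesis using PH uv by (intro bexI[of _ ?H]) (auto simp: graph_flats_def)
qed

lemma rank_insert:
  assumes H: "conn (H \<union> W \<times> W) = conn (insert (u, v) (F \<union> W \<times> W))"
    and uv: "u \<in> V" "v \<in> V" "(u, v) \<notin> conn (F \<union> W \<times> W)" and W: "W \<times> W \<subseteq> H \<longleftrightarrow> W \<times> W \<subseteq> F"
  shows "graph_rank H = Suc (graph_rank F)"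
proof -
  have "ncomp V (F \<union> W \<times> W) = Suc (ncomp V (H \<union> W \<times> W))"
    using ncomp_insert[OF pair_finite_verts uv] ncomp_cong[OF H] by simp
  then show ?thesis using ncomp_clique_le[of F] W by (simp add: graph_rank_def)
qed

lemma cover_same_type:
  assumes F: "F \<in> graph_flats" and uv: "(u, v) \<in> ground" "(u, v) \<notin> conn (F \<union> W \<times> W)"
  shows "\<exists>H\<in>graph_flats. insert (u, v) F \<subseteq> H \<and> graph_rank H = Suc (graph_rank F)"
proof -
  let ?F = "insert (u, v) F"
  have uvV: "u \<in> V" "v \<in> V" using uv(1) ground_in by auto
  show ?thesis
  proof (cases "affine_flat F")
    case True
    let ?H = "A \<inter> conn ?F"
    have "(u, v) \<notin> W \<times> W" using uv(2) conn_base[of "F \<union> W \<times> W"] by auto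
    then have "(u, v) \<in> A" using uv(1) by (auto simp: ground_def)
    then have FH: "?F \<subseteq> ?H" using affine_arcs[OF True] conn_base[of ?F] by auto
    have conn_eq: "conn ?H = conn ?F" using FH conn_base[of ?H] by (intro conn_eqI) auto
    have FP: "conn F \<subseteq> conn (F \<union> W \<times> W)" by (rule conn_mono) auto
    have WP: "W \<times> W \<subseteq> conn (F \<union> W \<times> W)" using conn_base[of "F \<union> W \<times> W"] by auto
    \<comment> \<open>If the new pair linked the components of two clique vertices, u and v would
      already be joined after contracting W. So the enlarged flat stays affine.\<close>
    have no: False if w: "a \<in> W" "b \<in> W" "(a, u) \<in> conn F" "(v, b) \<in> conn F" for a b
    proof -
      have "(u, a) \<in> conn (F \<union> W \<times> W)" using conn_sym[OF w(3)] FP by auto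
      moreover have "(a, b) \<in> conn (F \<union> W \<times> W)" using WP w by auto
      moreover have "(b, v) \<in> conn (F \<union> W \<times> W)" using conn_sym[OF w(4)] FP by auto
      ultimately have "(u, v) \<in> conn (F \<union> W \<times> W)" by (meson conn_trans)
      then show False using uv(2) by simp
    qed
    have sep: "w = w'" if w: "w \<in> W" "w' \<in> W" "(w, w') \<in> conn ?F" for w w'
    proof -
      have "(w, w') \<in> conn F"
        using conn_insertE[OF w(3)] no[OF w(1,2)] no[OF w(2,1)] conn_sym[of w v F] conn_sym[of u w' F] by blast
      then show ?thesis by (rule affine_sep[OF True w(1,2)])
    qed
    have "affine_flat ?H" unfolding affine_flat_def conn_eq using sep by auto
    moreover have "graph_rank ?H = Suc (graph_rank F)"
    proof (rule rank_insert[OF _ uvV uv(2)])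
      show "conn (?H \<union> W \<times> W) = conn (insert (u, v) (F \<union> W \<times> W))"
      proof (rule conn_eqI)
        have "conn ?F \<subseteq> conn (insert (u, v) (F \<union> W \<times> W))" by (rule conn_mono) auto
        then show "?H \<union> W \<times> W \<subseteq> conn (insert (u, v) (F \<union> W \<times> W))"
          using conn_base[of "insert (u, v) (F \<union> W \<times> W)"] by auto
        have "?H \<union> W \<times> W \<subseteq> conn (?H \<union> W \<times> W)" by (rule conn_base)
        then show "insert (u, v) (F \<union> W \<times> W) \<subseteq> conn (?H \<union> W \<times> W)" using FH by blast
      qed
      show "W \<times> W \<subseteq> ?H \<longleftrightarrow> W \<times> W \<subseteq> F"
        using affine_not_infinite[OF True] affine_not_infinite[OF \<open>affine_flat ?H\<close>] by simp
    qed
    ultimately show ?thesis using FH by (intro bexI[of _ ?H]) (auto simp: graph_flats_def)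
  next
    case False
    then have inf: "infinite_flat F" using F by (simp add: graph_flats_def)
    let ?H = "ground \<inter> conn ?F"
    have FH: "?F \<subseteq> ?H" using infinite_ground[OF inf] uv(1) conn_base[of ?F] by auto
    have conn_eq: "conn ?H = conn ?F" using FH conn_base[of ?H] by (intro conn_eqI) auto
    have WF: "W \<times> W \<subseteq> F" using inf by (simp add: infinite_flat_def)
    have "infinite_flat ?H" unfolding infinite_flat_def conn_eq using FH WF by auto
    moreover have "graph_rank ?H = Suc (graph_rank F)"
    proof (rule rank_insert[OF _ uvV uv(2)])
      have "?H \<union> W \<times> W = ?H" "F \<union> W \<times> W = F" using FH WF by auto
      then show "conn (?H \<union> W \<times> W) = conn (insert (u, v) (F \<union> W \<times> W))" using conn_eq by simp
    qed (use FH WF in auto)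
    ultimately show ?thesis using FH by (intro bexI[of _ ?H]) (auto simp: graph_flats_def)
  qed
qed

lemma empty_affine: "affine_flat {}"
proof -
  have "conn {} = (Id :: 'a rel)" by (simp add: conn_def)
  then show ?thesis using no_loop by (auto simp: affine_flat_def)
qed

sublocale flat_lattice ground graph_flats graph_rank
proof
  show "finite ground"
    by (rule finite_subset[OF ground_in]) (use pair_finite_verts in auto)
  show "ground \<noteq> {}" using w0 by (auto simp: ground_def)
  show "{} \<in> graph_flats" using empty_affine by (simp add: graph_flats_def)
  show "ground \<in> graph_flats" by (auto simp: graph_flats_def infinite_flat_def ground_def)
  show "graph_rank {} = 0" using w0 by (auto simp: graph_rank_def)
  show "F \<inter> H \<in> graph_flats" if "F \<in> graph_flats" "H \<in> graph_flats" for F H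
  proof (cases "affine_flat F \<or> affine_flat H")
    case True
    then show ?thesis using Int_affine that by (metis (no_types) graph_flats_def mem_Collect_eq inf_commute)
  next
    case False
    then show ?thesis using Int_infinite that by (simp add: graph_flats_def)
  qed
  show "\<exists>H\<in>graph_flats. insert x F \<subseteq> H \<and> graph_rank H = Suc (graph_rank F)"
    if F: "F \<in> graph_flats" and x: "x \<in> ground - F" for F x
  proof -
    obtain u v where uv: "x = (u, v)" by (cases x)
    show ?thesis
    proof (cases "(u, v) \<in> conn (F \<union> W \<times> W)")
      case True
      have "\<not> infinite_flat F"
      proof
        assume inf: "infinite_flat F"
        then have "(u, v) \<in> conn F" using True conn_clique[OF infinite_clique[OF inf]] by simp
        then show False using infinite_closed[OF inf] x uv by blast
      qed
      then have "affine_flat F" using F by (simp add: graph_flats_def)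
      then show ?thesis using cover_infinite True x by (simp add: uv)
    next
      case False
      then show ?thesis using cover_same_type[OF F] x by (simp add: uv)
    qed
  qed
qed (use flat_in rank_strict in auto)

lemma conn_arcs: "u \<in> V \<Longrightarrow> v \<in> V \<Longrightarrow> (u, v) \<in> conn A"
proof -
  assume uv: "u \<in> V" "v \<in> V"
  have "strongly_connected (with_proj (mk_symmetric (with_proj G)))"
    using connected_graph by (simp add: Digraph_Component.connected_def)
  then have "u \<rightarrow>\<^sup>*\<^bsub>with_proj (mk_symmetric (with_proj G))\<^esub> v"
    using uv by (simp add: strongly_connected_def)
  then have "(u, v) \<in> (parcs (mk_symmetric (with_proj G)))\<^sup>*"
    by (auto simp: reachable_def dest: rtrancl_on_rtranclI)
  moreover have "parcs (mk_symmetric (with_proj G)) \<subseteq> A \<union> A\<inverse>" by (auto simp: parcs_mk_symmetric)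
  ultimately show "(u, v) \<in> conn A" unfolding conn_def using rtrancl_mono by blast
qed

text \<open>Connectedness of the graph enters here: the ground set has a single component, which
  makes the rank n + 1.\<close>

lemma rank_ground: "graph_rank ground = Suc (card V - card W)"
proof -
  have "component ground u = component ground w0" if "u \<in> V" for u
    unfolding component_eq_iff
    by (rule subsetD[OF conn_mono conn_arcs]) (use that w0 clique_subset in \<open>auto simp: ground_def\<close>)
  then have "component ground ` V = {component ground w0}" using w0 clique_subset by blast
  then have "ncomp V ground = 1" by (simp add: ncomp_def)
  moreover have "ground \<union> W \<times> W = ground" by (auto simp: ground_def)
  moreover have "ncomp V (W \<times> W) = Suc (card V - card W)"
    using ncomp_clique[OF pair_finite_verts clique_subset] w0 by auto
  ultimately show ?thesis by (auto simp: graph_rank_def ground_def)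
qed

section \<open>Counting colourings by Moebius inversion\<close>

definition extensions :: "('a \<Rightarrow> nat) \<Rightarrow> nat \<Rightarrow> 'a rel \<Rightarrow> ('a \<Rightarrow> nat) set" where
  "extensions f k F = {c \<in> V \<rightarrow>\<^sub>E {..<k}. (\<forall>w\<in>W. c w = f w) \<and> (\<forall>(a, b)\<in>F. c a = c b)}"

lemma finite_extensions: "finite (extensions f k F)"
  by (rule finite_subset[of _ "V \<rightarrow>\<^sub>E {..<k}"]) (auto simp: extensions_def intro: finite_PiE pair_finite_verts)

text \<open>Components that meet W get their colour from f, consistently because an affine flat
  separates clique vertices; every other component is coloured freely. After contracting W the
  former are the single component of \<open>w0\<close>, hence the - 1.\<close>

lemma card_extensions:
  assumes f: "f \<in> W \<rightarrow> {..<k}" and F: "affine_flat F"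
  shows "card (extensions f k F) = k ^ (ncomp V (F \<union> W \<times> W) - 1)"
proof -
  let ?P = "F \<union> W \<times> W"
  define D where "D = component ?P ` V - {component ?P w0}"
  \<comment> \<open>The clique vertex that F joins to v, whose colour v must take.\<close>
  define wit where "wit v = (SOME w. w \<in> W \<and> (v, w) \<in> conn F)" for v
  define col where "col g = (\<lambda>v. if v \<in> V then (if (v, w0) \<in> conn ?P then f (wit v) else g (component ?P v)) else undefined)"
    for g :: "'a set \<Rightarrow> nat"
  have FP: "conn F \<subseteq> conn ?P" by (rule conn_mono) auto
  have wit: "wit v \<in> W \<and> (v, wit v) \<in> conn F" if "(v, w0) \<in> conn ?P" for v
  proof -
    have "\<exists>w. w \<in> W \<and> (v, w) \<in> conn F" using conn_Un_clique[OF that] w0 by blast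
    then show ?thesis unfolding wit_def by (rule someI_ex)
  qed
  have W0: "(w, w0) \<in> conn ?P" if "w \<in> W" for w using that w0 conn_base[of ?P] by auto
  have witW: "wit w = w" if "w \<in> W" for w
    using wit[OF W0[OF that]] affine_sep[OF F that, of "wit w"] by simp
  have wit_cong: "wit a = wit b" if "(a, b) \<in> conn F" for a b
  proof -
    have "(a, w) \<in> conn F \<longleftrightarrow> (b, w) \<in> conn F" for w
      using conn_trans[OF that] conn_trans[OF conn_sym[OF that]] by blast
    then show ?thesis by (simp add: wit_def)
  qed
  \<comment> \<open>Away from the clique, contracting W creates no new connections, so a component
    there is monochromatic already because of F.\<close>
  have away: "(v, x) \<in> conn F" if v: "(v, x) \<in> conn ?P" "(v, w0) \<notin> conn ?P" for v x
  proof (rule ccontr)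
    assume "(v, x) \<notin> conn F"
    then obtain w where w: "w \<in> W" "(v, w) \<in> conn F" using conn_Un_clique[OF v(1)] by blast
    then have "(v, w0) \<in> conn ?P" using conn_trans[OF subsetD[OF FP w(2)] W0] by blast
    then show False using v(2) by simp
  qed
  have D: "component ?P v \<in> D \<longleftrightarrow> (v, w0) \<notin> conn ?P" if "v \<in> V" for v
    using that by (auto simp: D_def component_eq_iff)
  have "bij_betw col (D \<rightarrow>\<^sub>E {..<k}) (extensions f k F)"
  proof (rule bij_betwI')
    fix g h assume g: "g \<in> D \<rightarrow>\<^sub>E {..<k}" and h: "h \<in> D \<rightarrow>\<^sub>E {..<k}"
    show "(col g = col h) = (g = h)"
    proof
      assume eq: "col g = col h"
      show "g = h"
      proof (rule PiE_ext[OF g h])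
        fix C assume C: "C \<in> D"
        then obtain v where v: "v \<in> V" "C = component ?P v" by (auto simp: D_def)
        then have "(v, w0) \<notin> conn ?P" using D C by simp
        then show "g C = h C" using fun_cong[OF eq, of v] v by (simp add: col_def)
      qed
    qed simp
  next
    fix g assume g: "g \<in> D \<rightarrow>\<^sub>E {..<k}"
    have lt: "col g v < k" if v: "v \<in> V" for v
    proof (cases "(v, w0) \<in> conn ?P")
      case True
      then show ?thesis using wit[OF True] f v by (auto simp: col_def)
    next
      case False
      then have "g (component ?P v) \<in> {..<k}" using D[OF v] g by (intro PiE_mem[OF g]) auto
      then show ?thesis using False v by (simp add: col_def)
    qed
    have onW: "col g w = f w" if "w \<in> W" for w
      using that W0 witW clique_subset by (auto simp: col_def)
    have onF: "col g a = col g b" if ab: "(a, b) \<in> F" for a b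
    proof -
      have abF: "(a, b) \<in> conn F" using ab conn_base[of F] by auto
      then have abP: "(a, b) \<in> conn ?P" using FP by auto
      have "a \<in> V" "b \<in> V" using ab affine_arcs[OF F] in_arcsD1 in_arcsD2 by blast+
      moreover have "(a, w0) \<in> conn ?P \<longleftrightarrow> (b, w0) \<in> conn ?P"
        using conn_trans[OF abP] conn_trans[OF conn_sym[OF abP]] by blast
      moreover have "component ?P a = component ?P b" using abP by (simp add: component_eq_iff)
      ultimately show ?thesis using wit_cong[OF abF] by (simp add: col_def)
    qed
    have "col g \<in> V \<rightarrow>\<^sub>E {..<k}"
      by (rule PiE_I) (simp add: lt, simp add: col_def)
    then show "col g \<in> extensions f k F"
      using onW onF unfolding extensions_def by blast
  next
    fix c assume c: "c \<in> extensions f k F"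
    define g where "g = restrict (\<lambda>C. c (SOME x. x \<in> C)) D"
    have cc: "c a = c b" if "(a, b) \<in> conn F" for a b
      using that by (rule conn_invariant) (use c in \<open>auto simp: extensions_def\<close>)
    have some: "(SOME x. x \<in> component ?P v) \<in> component ?P v" for v
      by (rule someI[of _ v]) (simp add: mem_component)
    have gc: "g (component ?P v) = c v" if v: "v \<in> V" "(v, w0) \<notin> conn ?P" for v
    proof -
      have "(v, SOME x. x \<in> component ?P v) \<in> conn ?P" using some[of v] by (simp add: mem_component)
      then have "c v = c (SOME x. x \<in> component ?P v)" using away[OF _ v(2)] cc by blast
      then show ?thesis using D[OF v(1)] v(2) by (simp add: g_def)
    qed
    have "g \<in> D \<rightarrow>\<^sub>E {..<k}"
    proof (rule PiE_I)
      fix C assume C: "C \<in> D"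
      then obtain v where v: "v \<in> V" "C = component ?P v" by (auto simp: D_def)
      then have "g C = c v" using gc D C by simp
      then show "g C \<in> {..<k}" using c v by (auto simp: extensions_def)
    qed (simp add: g_def)
    moreover have "c = col g"
    proof
      fix v
      consider "v \<notin> V" | "v \<in> V" "(v, w0) \<in> conn ?P" | "v \<in> V" "(v, w0) \<notin> conn ?P" by blast
      then show "c v = col g v"
      proof cases
        case 1
        then show ?thesis using c by (auto simp: col_def extensions_def PiE_def extensional_def)
      next
        case 2
        then have "c v = c (wit v)" using wit cc by blast
        then show ?thesis using 2 wit[OF 2(2)] c by (simp add: col_def extensions_def)
      next
        case 3
        then show ?thesis using gc by (simp add: col_def)
      qed
    qed
    ultimately show "\<exists>g\<in>D \<rightarrow>\<^sub>E {..<k}. c = col g" by blast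
  qed
  then have "card (extensions f k F) = card (D \<rightarrow>\<^sub>E {..<k})" by (simp add: bij_betw_same_card)
  also have "\<dots> = k ^ card D"
    by (subst card_funcsetE) (simp_all add: D_def pair_finite_verts)
  also have "card D = ncomp V ?P - 1"
    unfolding D_def ncomp_def using w0 clique_subset by (subst card_Diff_singleton) auto
  finally show ?thesis .
qed

lemma card_extensions_rank:
  assumes "f \<in> W \<rightarrow> {..<k}" "affine_flat F"
  shows "card (extensions f k F) = k ^ (card V - card W - graph_rank F)"
proof -
  have "ncomp V (W \<times> W) = Suc (card V - card W)"
    using ncomp_clique[OF pair_finite_verts clique_subset] w0 by auto
  then have "ncomp V (F \<union> W \<times> W) - 1 = card V - card W - graph_rank F"
    using ncomp_clique_le[of F] affine_not_infinite[OF assms(2)] by (simp add: graph_rank_def)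
  then show ?thesis using card_extensions[OF assms] by simp
qed

definition coincidences :: "('a \<Rightarrow> nat) \<Rightarrow> 'a rel" where
  "coincidences c = {(a, b) \<in> A. c a = c b}"

text \<open>This is the largest flat on which the colouring lies. Equality of colours is preserved
  along connections, and injectivity on the clique keeps its vertices apart.\<close>

lemma coincidences_affine:
  assumes "inj_on f W" "\<forall>w\<in>W. c w = f w"
  shows "affine_flat (coincidences c)"
proof -
  have c: "c a = c b" if "(a, b) \<in> conn (coincidences c)" for a b
    using that by (rule conn_invariant) (auto simp: coincidences_def)
  show ?thesis unfolding affine_flat_def
  proof (intro conjI ballI impI)
    show "A \<inter> conn (coincidences c) \<subseteq> coincidences c"
    proof (intro subrelI)
      fix a b assume ab: "(a, b) \<in> A \<inter> conn (coincidences c)"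
      then have "c a = c b" by (intro c) simp
      then show "(a, b) \<in> coincidences c" using ab by (simp add: coincidences_def)
    qed
    show "coincidences c \<subseteq> A" by (auto simp: coincidences_def)
    show "w = w'" if "w \<in> W" "w' \<in> W" "(w, w') \<in> conn (coincidences c)" for w w'
      using c[OF that(3)] assms(2) that(1,2) inj_onD[OF assms(1), of w w'] by simp
  qed
qed

text \<open>The characteristic polynomial of the affine arrangement, evaluated at k.\<close>

definition restricted_count :: "nat \<Rightarrow> real" where
  "restricted_count k = (\<Sum>F\<in>{F \<in> graph_flats. (w0, w0) \<notin> F}. mobius F * real k ^ (card V - card W - graph_rank F))"

text \<open>Exchanging summations, each colouring c contributes the Moebius sum over all flats below
  \<open>coincidences c\<close>, which is 1 for proper c and 0 otherwise. Those flats avoid the loop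
  at \<open>w0\<close> automatically.\<close>

lemma card_proper_extensions:
  assumes f: "f \<in> W \<rightarrow> {..<k}" "inj_on f W"
  shows "real (card {c \<in> extensions f k {}. coincidences c = {}}) = restricted_count k"
proof -
  let ?A = "{F \<in> graph_flats. (w0, w0) \<notin> F}" and ?X = "extensions f k {}"
  have fin: "finite ?A" using finite_flats by simp
  have "restricted_count k = (\<Sum>F\<in>?A. mobius F * real (card (extensions f k F)))"
    unfolding restricted_count_def
    by (rule sum.cong[OF refl]) (use card_extensions_rank[OF f(1)] affine_iff in auto)
  also have "\<dots> = (\<Sum>F\<in>?A. \<Sum>c\<in>{c \<in> ?X. F \<subseteq> coincidences c}. mobius F)"
  proof (rule sum.cong[OF refl])
    fix F assume "F \<in> ?A"
    then have "F \<subseteq> A" using affine_iff affine_arcs by auto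
    then have "extensions f k F = {c \<in> ?X. F \<subseteq> coincidences c}"
      by (auto simp: extensions_def coincidences_def)
    then show "mobius F * real (card (extensions f k F)) = (\<Sum>c\<in>{c \<in> ?X. F \<subseteq> coincidences c}. mobius F)"
      by simp
  qed
  also have "\<dots> = (\<Sum>c\<in>?X. \<Sum>F\<in>{F \<in> ?A. F \<subseteq> coincidences c}. mobius F)"
    by (rule sum.swap_restrict[OF fin finite_extensions])
  also have "\<dots> = (\<Sum>c\<in>?X. of_bool (coincidences c = {}))"
  proof (rule sum.cong[OF refl])
    fix c assume "c \<in> ?X"
    then have aff: "affine_flat (coincidences c)"
      by (intro coincidences_affine[OF f(2)]) (auto simp: extensions_def)
    then have cf: "coincidences c \<in> graph_flats" by (simp add: graph_flats_def)
    have "{F \<in> ?A. F \<subseteq> coincidences c} = {F \<in> graph_flats. F \<subseteq> coincidences c}"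
      using no_loop by (auto simp: coincidences_def)
    then show "(\<Sum>F\<in>{F \<in> ?A. F \<subseteq> coincidences c}. mobius F) = of_bool (coincidences c = {})"
      using mobius_sum[OF cf] by simp
  qed
  also have "\<dots> = real (card {c \<in> ?X. coincidences c = {}})"
    by (simp add: of_bool_def sum.If_cases finite_extensions Collect_conj_eq)
  finally show ?thesis by simp
qed

text \<open>The right side uses truncated subtraction; for k < l both products still vanish through
  the factor with i = k.\<close>

lemma poly_falling: "poly (falling_factorial_poly l) (real k) = real (\<Prod>i\<in>{0..<l}. k - i)"
proof (cases "l \<le> k")
  case True
  then show ?thesis
    by (simp add: falling_factorial_poly_def poly_prod of_nat_diff atLeast0LessThan)
next
  case False
  then have "(\<Prod>i\<in>{0..<l}. k - i) = 0" by (intro prod_zero) auto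
  moreover have "(\<Prod>i<l. real k - real i) = 0" using False by (intro prod_zero) auto
  moreover have "poly (falling_factorial_poly l) (real k) = (\<Prod>i<l. real k - real i)"
    by (simp add: falling_factorial_poly_def poly_prod)
  ultimately show ?thesis by (simp only: of_nat_0)
qed

text \<open>Sort proper colourings by their restriction to W. The restrictions are the injective
  maps, counted by the falling factorial, and the number of extensions does not depend on the
  restriction.\<close>

lemma card_proper_colourings_clique:
  "real (card (proper_colourings G k)) = poly (falling_factorial_poly (card W)) (real k) * restricted_count k"
proof -
  let ?I = "{f \<in> W \<rightarrow>\<^sub>E {..<k}. inj_on f W}"
  let ?C = "\<lambda>f. {c \<in> extensions f k {}. coincidences c = {}}"
  have finW: "finite W" using clique_subset pair_finite_verts finite_subset by blast
  have finI: "finite ?I"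
    by (rule finite_subset[of _ "W \<rightarrow>\<^sub>E {..<k}"]) (auto intro: finite_PiE finW)
  have "proper_colourings G k = (\<Union>f\<in>?I. ?C f)"
  proof (intro equalityI subsetI)
    fix c assume c: "c \<in> proper_colourings G k"
    have "inj_on c W"
    proof (rule inj_onI, rule ccontr)
      fix u v assume "u \<in> W" "v \<in> W" "c u = c v" "u \<noteq> v"
      then show False using clique_arc[of u v] c by (auto simp: proper_colourings_def)
    qed
    then have "restrict c W \<in> ?I" using c clique_subset
      by (auto simp: proper_colourings_def)
    moreover have "c \<in> ?C (restrict c W)"
      using c by (auto simp: proper_colourings_def extensions_def coincidences_def)
    ultimately show "c \<in> (\<Union>f\<in>?I. ?C f)" by blast
  next
    fix c assume "c \<in> (\<Union>f\<in>?I. ?C f)"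
    then show "c \<in> proper_colourings G k"
      by (auto simp: proper_colourings_def extensions_def coincidences_def)
  qed
  then have "card (proper_colourings G k) = card (\<Union>f\<in>?I. ?C f)" by simp
  also have "\<dots> = (\<Sum>f\<in>?I. card (?C f))"
  proof (rule card_UN_disjoint[OF finI])
    show "\<forall>f\<in>?I. finite (?C f)" using finite_extensions by auto
    show "\<forall>f\<in>?I. \<forall>g\<in>?I. f \<noteq> g \<longrightarrow> ?C f \<inter> ?C g = {}"
    proof (intro ballI impI)
      fix f g assume fg: "f \<in> ?I" "g \<in> ?I" "f \<noteq> g"
      then obtain w where "w \<in> W" "f w \<noteq> g w" using PiE_ext[of f W "\<lambda>_. {..<k}" g] by auto
      then show "?C f \<inter> ?C g = {}" by (auto simp: extensions_def)
    qed
  qed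
  finally have "real (card (proper_colourings G k)) = (\<Sum>f\<in>?I. real (card (?C f)))" by simp
  also have "\<dots> = (\<Sum>f\<in>?I. restricted_count k)"
    by (rule sum.cong[OF refl], rule card_proper_extensions) auto
  also have "\<dots> = real (card ?I) * restricted_count k" by simp
  also have "card ?I = (\<Prod>i\<in>{0..<card W}. k - i)"
    using card_inj_on_subset_funcset[OF finW, of "{..<k}" W] by simp
  finally show ?thesis by (simp add: poly_falling)
qed

section \<open>The quotient polynomial and its coefficients\<close>

definition quotient_poly :: "real poly" where
  "quotient_poly = (\<Sum>i\<le>card V - card W. monom ((-1) ^ i * whitney (w0, w0) i) (card V - card W - i))"

lemma w0_ground: "(w0, w0) \<in> ground"
  using w0 by (simp add: ground_def)

text \<open>Group the affine flats by rank. A flat avoiding the loop at \<open>w0\<close> is not the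
  ground set, so its rank is at most n and the exponents are not truncated.\<close>

lemma poly_quotient: "poly quotient_poly (real k) = restricted_count k"
proof -
  let ?n = "card V - card W" and ?A = "{F \<in> graph_flats. (w0, w0) \<notin> F}"
  have rank_le: "graph_rank F \<le> ?n" if F: "F \<in> ?A" for F
  proof -
    have "F \<noteq> ground" using F w0_ground by auto
    then show ?thesis using rk_less_ground[of F] F rank_ground by simp
  qed
  have "poly quotient_poly (real k) = (\<Sum>i\<le>?n. \<Sum>F\<in>{F \<in> ?A. graph_rank F = i}. mobius F * real k ^ (?n - graph_rank F))"
    unfolding quotient_poly_def poly_sum poly_monom
  proof (rule sum.cong[OF refl])
    fix i
    have "(-1) ^ i * whitney (w0, w0) i = (\<Sum>F\<in>{F \<in> ?A. graph_rank F = i}. mobius F)"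
      unfolding whitney_def sum_distrib_left
      by (rule sum.cong) (auto simp: abs_mobius_def simp flip: mult.assoc power_add)
    then show "(-1) ^ i * whitney (w0, w0) i * real k ^ (?n - i)
      = (\<Sum>F\<in>{F \<in> ?A. graph_rank F = i}. mobius F * real k ^ (?n - graph_rank F))"
      by (simp add: sum_distrib_right)
  qed
  also have "\<dots> = restricted_count k"
    unfolding restricted_count_def
    by (rule sum.group) (use finite_flats rank_le in auto)
  finally show ?thesis .
qed

lemma chromatic_polynomial_eq:
  "chromatic_polynomial G = falling_factorial_poly (card W) * quotient_poly"
  unfolding chromatic_polynomial_def
  by (rule the1_equality[OF ex1_chromatic_polynomial])
    (simp add: card_proper_colourings_clique poly_quotient)

lemma chromatic_polynomial_div: "chromatic_polynomial G div falling_factorial_poly (card W) = quotient_poly"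
proof -
  have "falling_factorial_poly (card W) \<noteq> 0" by (simp add: falling_factorial_poly_def)
  then show ?thesis by (simp add: chromatic_polynomial_eq)
qed

lemma coeff_quotient:
  assumes "i \<le> card V - card W"
  shows "coeff quotient_poly (card V - card W - i) = (-1) ^ i * whitney (w0, w0) i"
proof -
  let ?n = "card V - card W"
  have "coeff quotient_poly (?n - i) = (\<Sum>j\<le>?n. if j = i then (-1) ^ j * whitney (w0, w0) j else 0)"
    unfolding quotient_poly_def coeff_sum coeff_monom using assms by (intro sum.cong) auto
  also have "\<dots> = (-1) ^ i * whitney (w0, w0) i" using assms by simp
  finally show ?thesis .
qed

end

text \<open>Polynomial \<open>div\<close> returns a value even when there is a remainder; the first
  conjunct certifies that the division is exact, so that a lists all coefficients of the true
  quotient.\<close>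

theorem corollary3p11:
  fixes G :: "'a pair_pre_digraph" and W :: "'a set" and d l n :: nat and a :: "nat \<Rightarrow> real"
  assumes "pair_graph G"
    and "Digraph_Component.connected (with_proj G)"
    and "card (pverts G) = d"
    and "clique G W" and "card W = l" and "l \<ge> 1"
    and "n = d - l"
    and "a = (\<lambda>i. (-1) ^ i * coeff (chromatic_polynomial G div falling_factorial_poly l) (n - i))"
  shows "chromatic_polynomial G =
           falling_factorial_poly l * (\<Sum>i\<le>n. monom ((-1) ^ i * a i) (n - i))
         \<and> log_concave n a"
proof -
  have "W \<noteq> {}" using assms(5,6) by auto
  then obtain w0 where "w0 \<in> W" by blast
  then interpret clique_graph G W w0
    using assms(1,2,4) by (simp add: clique_graph_def clique_graph_axioms_def)
  have n: "n = card (pverts G) - card W" using assms(3,5,7) by simp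
  have a: "a i = whitney (w0, w0) i" if "i \<le> n" for i
  proof -
    have "a i = (-1) ^ i * ((-1) ^ i * whitney (w0, w0) i)"
      using coeff_quotient[of i] that n chromatic_polynomial_div assms(5) by (simp add: assms(8))
    then show ?thesis by (simp flip: mult.assoc power_add)
  qed
  have "quotient_poly = (\<Sum>i\<le>n. monom ((-1) ^ i * a i) (n - i))"
    unfolding quotient_poly_def n[symmetric] by (rule sum.cong) (simp_all add: a)
  moreover have "log_concave n a"
  proof -
    have rk: "graph_rank ground - 1 = n" using rank_ground n by simp
    have "a r > 0" if "r \<le> n" for r
      using whitney_pos[OF w0_ground, of r] that rk a by simp
    moreover have "a (r - 1) * a (r + 1) \<le> (a r)\<^sup>2" if "r \<in> {1..<n}" for r
      proof -
      have "a (r - 1) = whitney (w0, w0) (r - 1)" by (rule a) (use that in auto)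
      then show ?thesis using whitney_log_concave[OF w0_ground, of r] that rk a[of "r + 1"] a[of r] by simp
    qed
    ultimately show ?thesis by (simp add: log_concave_def)
  qed
  ultimately show ?thesis using chromatic_polynomial_eq assms(5) by simp
qed

end
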